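(* Let $k$ be a field of characteristic $0$, let $n\geq 6$ with $n\neq 7$, let $S=k[\alpha_1,\dots,\alpha_n]$ and let $P=k[x_1,\dots,x_n]$, on which $S$ acts by contraction. Then for a general $f\in P$ homogeneous of degree $3$, the apolar algebra $\mathrm{Apolar}(f)=S/\mathrm{Ann}(f)$ satisfies the small tangent space condition.
   Context: Contraction: $S$ acts $k$-linearly on $P$ by $\alpha_1^{b_1}\cdots\alpha_n^{b_n}\cdot x_1^{a_1}\cdots x_n^{a_n}=x_1^{a_1-b_1}\cdots x_n^{a_n-b_n}$ if $a_i\geq b_i$ for all $i$, and $0$ otherwise. For $f\in P$, $\mathrm{Ann}(f)=\{s\in S : s\cdot f=0\}$; for $f$ homogeneous this is a homogeneous ideal of $S$ (standard grading). For a graded $S$-module $M$ write $H(M)_i=\dim_k M_i$. "$M$ has Hilbert function $(h_0,\dots,h_j)$" means $H(M)_i=h_i$ for $0\le i\le j$ and $H(M)_i=0$ otherwise. Small tangent space condition: for $f\in P$ homogeneous of degree $3$ and $I=\mathrm{Ann}(f)$, $\mathrm{Apolar}(f)$ satisfies it if $S/I$ has Hilbert function $(1,n,n,1)$, $H(S/I^2)_4=n$ and $H(S/I^2)_5=0$. "For a general $f\in P$ homogeneous of degree $3$" means: there is an open dense subset $U$ of the affine space of cubics $\mathrm{Spec}\,\mathrm{Sym}((P_3)^\vee)$, where $P_3$ is the degree $3$ part of $P$ and $(-)^\vee=\mathrm{Hom}_k(-,k)$, such that the assertion holds for all rational points $f\in U(k)$. *)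

theory Defs
  imports
    "HOL-Library.Poly_Mapping"
    "HOL-Analysis.Abstract_Topology"
    "HOL-Algebra.QuotRing"
    "HOL-Algebra.Ideal_Product"
    "HOL-Algebra.Embedded_Algebras"
begin

section \<open>Polynomial rings\<close>

text \<open>A monomial is a finitely supported exponent vector, and a polynomial is a finitely supported
  family of coefficients indexed by monomials; multiplication is the convolution product.\<close>

type_synonym 'v monomial = "'v \<Rightarrow>\<^sub>0 nat"
type_synonym ('v, 'k) mpoly = "('v \<Rightarrow>\<^sub>0 nat) \<Rightarrow>\<^sub>0 'k"

definition mdeg :: "'v monomial \<Rightarrow> nat"
  where "mdeg m = (\<Sum>v\<in>Poly_Mapping.keys m. Poly_Mapping.lookup m v)"

definition mpoly_ring :: "'v set \<Rightarrow> (('v, 'k::field) mpoly) ring"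
  where "mpoly_ring V =
    \<lparr>carrier = {p. \<forall>m\<in>Poly_Mapping.keys p. Poly_Mapping.keys m \<subseteq> V},
     mult = (*), one = 1, zero = 0, add = (+)\<rparr>"

definition eval_mpoly :: "('v \<Rightarrow> 'k::field) \<Rightarrow> ('v, 'k) mpoly \<Rightarrow> 'k"
  where "eval_mpoly c p = (\<Sum>m\<in>Poly_Mapping.keys p. Poly_Mapping.lookup p m *
           (\<Prod>v\<in>Poly_Mapping.keys m. c v ^ Poly_Mapping.lookup m v))"

lemma cring_mpoly_ring: "cring (mpoly_ring V :: (('v, 'k::field) mpoly) ring)"
proof -
  have ops: "x \<oplus>\<^bsub>mpoly_ring V\<^esub> y = x + y" "x \<otimes>\<^bsub>mpoly_ring V\<^esub> y = x * y"
    "\<zero>\<^bsub>mpoly_ring V\<^esub> = (0 :: ('v, 'k) mpoly)" "\<one>\<^bsub>mpoly_ring V\<^esub> = (1 :: ('v, 'k) mpoly)"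
    for x y :: "('v, 'k) mpoly"
    by (simp_all add: mpoly_ring_def)
  have zero: "(0 :: ('v, 'k) mpoly) \<in> carrier (mpoly_ring V)"
    and one: "(1 :: ('v, 'k) mpoly) \<in> carrier (mpoly_ring V)"
    by (simp_all add: mpoly_ring_def)
  have mult: "p * q \<in> carrier (mpoly_ring V)"
    if pq: "p \<in> carrier (mpoly_ring V)" "q \<in> carrier (mpoly_ring V)"
    for p q :: "('v, 'k) mpoly"
  proof -
    have "Poly_Mapping.keys m \<subseteq> V" if m: "m \<in> Poly_Mapping.keys (p * q)" for m
    proof -
      obtain a b where "m = a + b" "a \<in> Poly_Mapping.keys p" "b \<in> Poly_Mapping.keys q"
        using keys_mult[of p q] m by blast
      then show ?thesis
        using Poly_Mapping.keys_add[of a b] pq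
        by (fastforce simp: mpoly_ring_def)
    qed
    then show ?thesis by (simp add: mpoly_ring_def)
  qed
  have add: "p + q \<in> carrier (mpoly_ring V)"
    if "p \<in> carrier (mpoly_ring V)" "q \<in> carrier (mpoly_ring V)"
    for p q :: "('v, 'k) mpoly"
    using that Poly_Mapping.keys_add[of p q] by (fastforce simp: mpoly_ring_def)
  have neg: "- p \<in> carrier (mpoly_ring V)"
    if "p \<in> carrier (mpoly_ring V)" for p :: "('v, 'k) mpoly"
    using that by (simp add: mpoly_ring_def in_keys_iff)
  show ?thesis
  proof (rule cringI)
    show "abelian_group (mpoly_ring V :: (('v, 'k) mpoly) ring)"
    proof (rule abelian_groupI)
      fix p :: "('v, 'k) mpoly" assume p: "p \<in> carrier (mpoly_ring V)"
      then show "\<exists>q\<in>carrier (mpoly_ring V). q \<oplus>\<^bsub>mpoly_ring V\<^esub> p = \<zero>\<^bsub>mpoly_ring V\<^esub>"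
        using neg[OF p] by (intro bexI[of _ "- p"]) (simp_all add: ops)
    qed (simp_all only: ops add zero add.assoc add_0_left, simp only: add.commute)
    show "Group.comm_monoid (mpoly_ring V :: (('v, 'k) mpoly) ring)"
      by (rule comm_monoidI)
        (simp_all only: ops mult one mult.assoc mult_1_left, simp only: mult.commute)
  qed (simp only: ops distrib_right)
qed


section \<open>The prime spectrum and its Zariski topology\<close>

definition spectrum :: "('a, 'b) ring_scheme \<Rightarrow> 'a set set"
  where "spectrum R = {\<pp>. primeideal \<pp> R}"

definition zariski :: "('a, 'b) ring_scheme \<Rightarrow> 'a set topology"
  where "zariski R =
    topology (\<lambda>U. \<exists>T\<subseteq>carrier R. U = {\<pp> \<in> spectrum R. \<not> T \<subseteq> \<pp>})"

lemma openin_zariski: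
  assumes "cring R"
  shows "openin (zariski R) U \<longleftrightarrow> (\<exists>T\<subseteq>carrier R. U = {\<pp> \<in> spectrum R. \<not> T \<subseteq> \<pp>})"
proof -
  let ?D = "\<lambda>T. {\<pp> \<in> spectrum R. \<not> T \<subseteq> \<pp>}"
  interpret cring R by fact
  have "istopology (\<lambda>U. \<exists>T\<subseteq>carrier R. U = ?D T)"
    unfolding istopology_def
  proof (intro conjI allI impI)
    fix A B assume "\<exists>T\<subseteq>carrier R. A = ?D T" "\<exists>T\<subseteq>carrier R. B = ?D T"
    then obtain S T where ST: "S \<subseteq> carrier R" "T \<subseteq> carrier R" "A = ?D S" "B = ?D T"
      by blast
    let ?P = "{s \<otimes>\<^bsub>R\<^esub> t | s t. s \<in> S \<and> t \<in> T}"
    have "(\<not> S \<subseteq> \<pp> \<and> \<not> T \<subseteq> \<pp>) \<longleftrightarrow> \<not> ?P \<subseteq> \<pp>" if "\<pp> \<in> spectrum R" for \<pp>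
    proof -
      interpret primeideal \<pp> R using that by (simp add: spectrum_def)
      show ?thesis
      proof
        assume "\<not> S \<subseteq> \<pp> \<and> \<not> T \<subseteq> \<pp>"
        then obtain s t where st: "s \<in> S" "s \<notin> \<pp>" "t \<in> T" "t \<notin> \<pp>" by blast
        then have "s \<otimes>\<^bsub>R\<^esub> t \<notin> \<pp>" using I_prime[of s t] ST(1,2) by blast
        then show "\<not> ?P \<subseteq> \<pp>" using st(1,3) by blast
      next
        assume "\<not> ?P \<subseteq> \<pp>"
        then obtain s t where st: "s \<in> S" "t \<in> T" "s \<otimes>\<^bsub>R\<^esub> t \<notin> \<pp>" by blast
        then have "s \<notin> \<pp>" "t \<notin> \<pp>"
          using I_r_closed[of s t] I_l_closed[of t s] ST(1,2) by blast+
        then show "\<not> S \<subseteq> \<pp> \<and> \<not> T \<subseteq> \<pp>" using st(1,2) by blast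
      qed
    qed
    then have "A \<inter> B = ?D ?P" using ST(3,4) by blast
    moreover have "?P \<subseteq> carrier R" using ST(1,2) by auto
    ultimately show "\<exists>T\<subseteq>carrier R. A \<inter> B = ?D T" by blast
  next
    fix \<K> assume "\<forall>A\<in>\<K>. \<exists>T\<subseteq>carrier R. A = ?D T"
    then obtain T where T: "\<forall>A\<in>\<K>. T A \<subseteq> carrier R \<and> A = ?D (T A)" by metis
    have "\<Union>\<K> = (\<Union>A\<in>\<K>. ?D (T A))"
      using T by (metis (no_types, lifting) SUP_cong Sup.SUP_id_eq image_ident)
    also have "\<dots> = ?D (\<Union>A\<in>\<K>. T A)" by blast
    finally have "\<Union>\<K> = ?D (\<Union>A\<in>\<K>. T A)" .
    moreover have "(\<Union>A\<in>\<K>. T A) \<subseteq> carrier R" using T by blast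
    ultimately show "\<exists>T\<subseteq>carrier R. \<Union>\<K> = ?D T" by blast
  qed
  then show ?thesis by (simp add: zariski_def topology_inverse')
qed

lemma topspace_zariski:
  assumes "cring R"
  shows "topspace (zariski R) = spectrum R"
proof -
  interpret cring R by fact
  have "\<not> carrier R \<subseteq> \<pp>" if "primeideal \<pp> R" for \<pp>
  proof -
    interpret primeideal \<pp> R by fact
    show ?thesis using I_notcarr a_subset by blast
  qed
  then have "openin (zariski R) (spectrum R)"
    unfolding openin_zariski[OF assms]
    by (intro exI[of _ "carrier R"]) (auto simp: spectrum_def)
  moreover have "topspace (zariski R) \<subseteq> spectrum R"
    unfolding topspace_def openin_zariski[OF assms] by blast
  ultimately show ?thesis using openin_subset by blast
qed


section \<open>Graded quotients of the polynomial ring in n variables\<close>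

text \<open>The variables are indexed by 0, ..., n - 1. The ring S and the space P of polynomials on which
  it acts have the same underlying vector space.\<close>

definition poly_ring :: "nat \<Rightarrow> ((nat, 'k::field) mpoly) ring"
  where "poly_ring n = mpoly_ring {..<n}"

definition homogeneous_part :: "nat \<Rightarrow> nat \<Rightarrow> (nat, 'k::field) mpoly set"
  where "homogeneous_part n d =
    {p \<in> carrier (poly_ring n). \<forall>m\<in>Poly_Mapping.keys p. mdeg m = d}"

text \<open>For a homogeneous ideal J of S, the degree i part of S/J is the image of the degree i part
  of S; its dimension is taken over the image of the field of constants.\<close>

definition hilbert_quotient :: "nat \<Rightarrow> (nat, 'k::field) mpoly set \<Rightarrow> nat \<Rightarrow> nat"
  where "hilbert_quotient n J i =
    ring.dim (poly_ring n Quot J)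
      ((\<lambda>a. J +>\<^bsub>poly_ring n\<^esub> Poly_Mapping.single 0 a) ` UNIV)
      ((\<lambda>p. J +>\<^bsub>poly_ring n\<^esub> p) ` homogeneous_part n i)"

definition quotient_has_hilbert_function ::
    "nat \<Rightarrow> (nat, 'k::field) mpoly set \<Rightarrow> nat list \<Rightarrow> bool"
  where "quotient_has_hilbert_function n J hs \<longleftrightarrow>
    (\<forall>i. hilbert_quotient n J i = (if i < length hs then hs ! i else 0))"


section \<open>Contraction and the small tangent space condition\<close>

definition contract :: "('v, 'k::field) mpoly \<Rightarrow> ('v, 'k) mpoly \<Rightarrow> ('v, 'k) mpoly"
  where "contract s f =
    (\<Sum>b\<in>Poly_Mapping.keys s. \<Sum>a\<in>Poly_Mapping.keys f.
       if \<forall>v. Poly_Mapping.lookup b v \<le> Poly_Mapping.lookup a v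
       then Poly_Mapping.single (a - b) (Poly_Mapping.lookup s b * Poly_Mapping.lookup f a)
       else 0)"

definition Ann :: "nat \<Rightarrow> (nat, 'k::field) mpoly \<Rightarrow> (nat, 'k) mpoly set"
  where "Ann n f = {s \<in> carrier (poly_ring n). contract s f = 0}"

definition small_tangent_space :: "nat \<Rightarrow> (nat, 'k::field) mpoly \<Rightarrow> bool"
  where "small_tangent_space n f \<longleftrightarrow>
    f \<in> homogeneous_part n 3 \<and>
    quotient_has_hilbert_function n (Ann n f) [1, n, n, 1] \<and>
    hilbert_quotient n (Ann n f \<cdot>\<^bsub>poly_ring n\<^esub> Ann n f) 4 = n \<and>
    hilbert_quotient n (Ann n f \<cdot>\<^bsub>poly_ring n\<^esub> Ann n f) 5 = 0"


section \<open>General cubics\<close>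

text \<open>The monomials of degree 3 form a basis of the space of cubics, so the symmetric algebra of the
  dual space is the polynomial ring on the dual basis: its variables are the coefficient
  functionals, indexed by the monomials of degree 3.\<close>

definition cubic_coordinate_ring :: "nat \<Rightarrow> ((nat monomial, 'k::field) mpoly) ring"
  where "cubic_coordinate_ring n =
    mpoly_ring {m. Poly_Mapping.keys m \<subseteq> {..<n} \<and> mdeg m = 3}"

text \<open>The rational point of the spectrum given by a cubic f is the kernel of evaluation at f.\<close>

definition cubic_point ::
    "nat \<Rightarrow> (nat, 'k::field) mpoly \<Rightarrow> (nat monomial, 'k) mpoly set"
  where "cubic_point n f =
    {g \<in> carrier (cubic_coordinate_ring n). eval_mpoly (Poly_Mapping.lookup f) g = 0}"

definition for_general_cubic :: "nat \<Rightarrow> ((nat, 'k::field) mpoly \<Rightarrow> bool) \<Rightarrow> bool"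
  where "for_general_cubic n Q \<longleftrightarrow>
    (let X = zariski (cubic_coordinate_ring n :: ((nat monomial, 'k) mpoly) ring) in
     \<exists>U. openin X U \<and> X closure_of U = topspace X \<and>
         (\<forall>f\<in>homogeneous_part n 3. cubic_point n f \<in> U \<longrightarrow> Q f))"

end

theory Submission
  imports Defs "Jordan_Normal_Form.Determinant"
begin

text \<open>All conditions are open in f: in terms of the coefficients of f they say that finitely many
  families of vectors span, and a right inverse chosen at one cubic turns this into the non-vanishing
  of a determinant. Moreover the functionals dual to the products \<open>x\<^sub>i f\<close> always vanish on
  \<open>Ann(f)\<^sup>2\<close>, so it suffices to find, for each n, one cubic for which a functional on quartics that
  vanishes on \<open>Ann(f)\<^sup>2\<close> and on n suitable monomials is zero; degree 5 then follows by fixing one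
  variable.

  The cubic is a sum of divided power monomials \<open>x\<^sub>a x\<^sub>b x\<^sub>c\<close>, one for each triple of a partial
  triple system, in which a pair of vertices lies in at most one triple. The quadrics in the
  annihilator are then spanned by monomials and differences of two monomials, so that the conditions
  on a functional become combinatorial. The triples are those of a fixed core on 4 or 5 vertices,
  together with the triples qyz, pyy, rzz for any number of blocks \<open>{y, z}\<close>. Monomials that meet
  at least three blocks are handled by a short direct argument, so everything reduces to a core with
  one or two blocks, that is, to finite calculations with 6, 8 and 9 variables.\<close>

text \<open>The annihilator varies with f, so spanning by its elements becomes an open condition
  only once such elements are written with coefficients polynomial in f. Cramer's rule does this: n
  quadratic monomials, one for each variable, are fixed such that the corresponding n by n submatrix
  of the catalecticant matrix is the identity at the base cubic; every quadratic monomial is then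
  corrected by these, with the adjugate in place of the inverse. In degree 4 two bounds meet: the
  functionals dual to the products of f with the variables give dimension at least n, and n further
  monomials that complete the products of the quadrics to a spanning set give at most n. These
  monomials are x_v times a triple that avoids v, which makes their pairing with the functionals the
  identity matrix at the base cubic. A block has two vertices, so the core decides the parity of n
  and two cores occur; the odd one is used with at least two blocks, so that 7 = 5 + 2 is not
  reached.\<close>

lemma eval_mpoly_alt:
  assumes "finite A" "Poly_Mapping.keys p \<subseteq> A"
  shows "eval_mpoly c p = (\<Sum>m\<in>A. Poly_Mapping.lookup p m *
           (\<Prod>v\<in>Poly_Mapping.keys m. c v ^ Poly_Mapping.lookup m v))"
  unfolding eval_mpoly_def using assms
  by (intro sum.mono_neutral_left) (auto simp: in_keys_iff)

lemma eval_mpoly_add: "eval_mpoly c (p + q) = eval_mpoly c p + eval_mpoly c q"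
proof -
  let ?A = "Poly_Mapping.keys p \<union> Poly_Mapping.keys q"
  have "Poly_Mapping.keys (p + q) \<subseteq> ?A" by (rule Poly_Mapping.keys_add)
  then show ?thesis
    by (simp add: eval_mpoly_alt[of ?A] lookup_add distrib_right sum.distrib)
qed

lemma eval_mpoly_single: "eval_mpoly c (Poly_Mapping.single m a) =
    a * (\<Prod>v\<in>Poly_Mapping.keys m. c v ^ Poly_Mapping.lookup m v)"
  by (simp add: eval_mpoly_alt[of "{m}"])

lemma eval_monomial_add:
  fixes c :: "'v \<Rightarrow> 'k::field"
  shows "(\<Prod>v\<in>Poly_Mapping.keys (m + m'). c v ^ Poly_Mapping.lookup (m + m') v) =
    (\<Prod>v\<in>Poly_Mapping.keys m. c v ^ Poly_Mapping.lookup m v) *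
    (\<Prod>v\<in>Poly_Mapping.keys m'. c v ^ Poly_Mapping.lookup m' v)"
proof -
  let ?A = "Poly_Mapping.keys m \<union> Poly_Mapping.keys m'"
  have *: "(\<Prod>v\<in>Poly_Mapping.keys q. c v ^ Poly_Mapping.lookup q v) =
      (\<Prod>v\<in>?A. c v ^ Poly_Mapping.lookup q v)"
    if "Poly_Mapping.keys q \<subseteq> ?A" for q :: "'v monomial"
    using that by (intro prod.mono_neutral_left) (auto simp: in_keys_iff)
  show ?thesis
    unfolding *[OF Poly_Mapping.keys_add] *[OF Un_upper1] *[OF Un_upper2]
    by (simp add: lookup_add power_add prod.distrib)
qed

lemma mpoly_induct [case_names zero single add]:
  fixes p :: "'a \<Rightarrow>\<^sub>0 'b::comm_monoid_add"
  assumes "P 0" "\<And>m a. P (Poly_Mapping.single m a)" "\<And>p q. P p \<Longrightarrow> P q \<Longrightarrow> P (p + q)"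
  shows "P p"
proof -
  have "P (\<Sum>m\<in>A. Poly_Mapping.single m (Poly_Mapping.lookup p m))" if "finite A" for A
    using that by (induction A) (use assms in auto)
  moreover have "p = (\<Sum>m\<in>Poly_Mapping.keys p. Poly_Mapping.single m (Poly_Mapping.lookup p m))"
    by (rule poly_mapping_eqI) (auto simp: lookup_sum lookup_single when_def in_keys_iff)
  ultimately show ?thesis by (metis finite_keys)
qed

lemma eval_mpoly_mult: "eval_mpoly c (p * q) = eval_mpoly c p * eval_mpoly c q"
proof (induction p rule: mpoly_induct)
  case zero
  show ?case by (simp add: eval_mpoly_def)
next
  case (single m a)
  show ?case
  proof (induction q rule: mpoly_induct)
    case zero
    show ?case by (simp add: eval_mpoly_def)
  next
    case (single m' b)
    show ?case by (simp add: mult_single eval_mpoly_single eval_monomial_add)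
  qed (simp add: distrib_left eval_mpoly_add)
qed (simp add: distrib_right eval_mpoly_add)

section \<open>Polynomial functions of the coefficients of a cubic\<close>

text \<open>The argument is a bare coefficient function rather than a polynomial: elements of the
  coordinate ring read only the coefficients at cubic monomials in n variables, so the base cubic
  can be given as a function without a proof of finite support.\<close>

definition polyfun :: "nat \<Rightarrow> ((nat monomial \<Rightarrow> 'k::field) \<Rightarrow> 'k) \<Rightarrow> bool"
  where "polyfun n \<phi> \<longleftrightarrow>
    (\<exists>p\<in>carrier (cubic_coordinate_ring n). \<forall>f. eval_mpoly f p = \<phi> f)"

lemma polyfun_const [simp]: "polyfun n (\<lambda>f. a)"
  unfolding polyfun_def
  by (rule bexI[of _ "Poly_Mapping.single 0 a"])
    (auto simp: eval_mpoly_single cubic_coordinate_ring_def mpoly_ring_def)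

lemma polyfun_coeff:
  assumes "Poly_Mapping.keys m \<subseteq> {..<n}" "mdeg m = 3"
  shows "polyfun n (\<lambda>f. f m)"
  unfolding polyfun_def
  by (rule bexI[of _ "Poly_Mapping.single (Poly_Mapping.single m 1) 1"])
    (use assms in \<open>auto simp: eval_mpoly_single cubic_coordinate_ring_def mpoly_ring_def\<close>)

lemma polyfun_add:
  assumes "polyfun n \<phi>" "polyfun n \<psi>"
  shows "polyfun n (\<lambda>f. \<phi> f + \<psi> f)"
proof -
  obtain p q where pq: "p \<in> carrier (cubic_coordinate_ring n)" "\<forall>f. eval_mpoly f p = \<phi> f"
    "q \<in> carrier (cubic_coordinate_ring n)" "\<forall>f. eval_mpoly f q = \<psi> f"
    using assms unfolding polyfun_def by blast
  have "p + q \<in> carrier (cubic_coordinate_ring n)"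
    using pq Poly_Mapping.keys_add[of p q]
    unfolding cubic_coordinate_ring_def mpoly_ring_def by fastforce
  then show ?thesis
    unfolding polyfun_def by (rule bexI[rotated]) (simp add: pq eval_mpoly_add)
qed

lemma polyfun_mult:
  assumes "polyfun n \<phi>" "polyfun n \<psi>"
  shows "polyfun n (\<lambda>f. \<phi> f * \<psi> f)"
proof -
  obtain p q where pq: "p \<in> carrier (cubic_coordinate_ring n)" "\<forall>f. eval_mpoly f p = \<phi> f"
    "q \<in> carrier (cubic_coordinate_ring n)" "\<forall>f. eval_mpoly f q = \<psi> f"
    using assms unfolding polyfun_def by blast
  interpret cring "cubic_coordinate_ring n :: ((nat monomial, 'a) mpoly) ring"
    unfolding cubic_coordinate_ring_def by (rule cring_mpoly_ring)
  have "p * q \<in> carrier (cubic_coordinate_ring n)"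
    using m_closed[OF pq(1,3)] by (simp add: cubic_coordinate_ring_def mpoly_ring_def)
  then show ?thesis
    unfolding polyfun_def by (rule bexI[rotated]) (simp add: pq eval_mpoly_mult)
qed

lemma polyfun_uminus: "polyfun n \<phi> \<Longrightarrow> polyfun n (\<lambda>f. - \<phi> f)"
  using polyfun_mult[OF polyfun_const[of n "-1"]] by simp

lemma polyfun_diff: "polyfun n \<phi> \<Longrightarrow> polyfun n \<psi> \<Longrightarrow> polyfun n (\<lambda>f. \<phi> f - \<psi> f)"
  using polyfun_add[OF _ polyfun_uminus] by fastforce

lemma polyfun_sum: "(\<And>i. i \<in> A \<Longrightarrow> polyfun n (\<phi> i)) \<Longrightarrow> polyfun n (\<lambda>f. \<Sum>i\<in>A. \<phi> i f)"
  by (induction A rule: infinite_finite_induct) (auto intro: polyfun_add)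

lemma polyfun_prod: "(\<And>i. i \<in> A \<Longrightarrow> polyfun n (\<phi> i)) \<Longrightarrow> polyfun n (\<lambda>f. \<Prod>i\<in>A. \<phi> i f)"
  by (induction A rule: infinite_finite_induct) (auto intro: polyfun_mult)

lemma polyfun_det:
  assumes "\<And>i j. i < N \<Longrightarrow> j < N \<Longrightarrow> polyfun n (\<lambda>f. A f i j)"
  shows "polyfun n (\<lambda>f. det (mat N N (\<lambda>(i, j). A f i j)))"
proof -
  have "det (mat N N (\<lambda>(i, j). A f i j)) = (\<Sum>p\<in>{p. p permutes {0..<N}}. signof p * (\<Prod>i = 0..<N. A f i (p i)))"
    for f
    unfolding det_def'[OF mat_carrier]
    by (intro sum.cong arg_cong2[of _ _ _ _ "(*)"] prod.cong refl)
      (auto simp: permutes_in_image)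
  then show ?thesis
    by (auto intro!: polyfun_sum polyfun_mult polyfun_prod assms simp: permutes_in_image)
qed

text \<open>The coordinate ring is a domain, so the zero ideal is a prime, and it lies in every
  non-empty open set. The polynomial \<open>p\<close> behind \<open>\<phi>\<close> is non-zero, as
  its value at \<open>f0\<close> shows, so its principal open set is dense. A cubic gives a point of
  this set exactly if \<open>\<phi>\<close> does not vanish at its coefficients.\<close>

lemma for_general_cubicI:
  fixes \<phi> :: "(nat monomial \<Rightarrow> 'k::field) \<Rightarrow> 'k"
  assumes \<phi>: "polyfun n \<phi>" and f0: "\<phi> f0 \<noteq> 0"
    and Q: "\<And>f. f \<in> homogeneous_part n 3 \<Longrightarrow> \<phi> (Poly_Mapping.lookup f) \<noteq> 0 \<Longrightarrow> Q f"
  shows "for_general_cubic n Q"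
proof -
  let ?R = "cubic_coordinate_ring n :: ((nat monomial, 'k) mpoly) ring"
  let ?X = "zariski ?R"
  have cr: "cring ?R" unfolding cubic_coordinate_ring_def by (rule cring_mpoly_ring)
  interpret cring ?R by (rule cr)
  obtain p where p: "p \<in> carrier ?R" "\<And>f. eval_mpoly f p = \<phi> f"
    using \<phi> unfolding polyfun_def by blast
  have ops: "x \<otimes>\<^bsub>?R\<^esub> y = x * y" "\<zero>\<^bsub>?R\<^esub> = 0" "\<one>\<^bsub>?R\<^esub> = 1" for x y
    by (simp_all add: cubic_coordinate_ring_def mpoly_ring_def)
  have "p \<noteq> 0" using p(2)[of f0] f0 by (auto simp: eval_mpoly_def)
  have "domain ?R"
    by (rule domain.intro[OF cr], unfold_locales) (auto simp: ops)
  then have gen: "{0} \<in> spectrum ?R"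
    using domain.zeroprimeideal[of ?R] by (simp add: spectrum_def ops)
  let ?U = "{\<pp> \<in> spectrum ?R. \<not> {p} \<subseteq> \<pp>}"
  have op: "openin ?X ?U"
    unfolding openin_zariski[OF cr] using p by blast
  moreover have "?X closure_of ?U = topspace ?X"
  proof -
    have "\<pp> \<in> ?X closure_of ?U" if "\<pp> \<in> spectrum ?R" for \<pp>
    proof -
      have "\<exists>y. y \<in> ?U \<and> y \<in> T" if T: "\<pp> \<in> T" "openin ?X T" for T
      proof -
        obtain S where S: "S \<subseteq> carrier ?R" "T = {\<pp> \<in> spectrum ?R. \<not> S \<subseteq> \<pp>}"
          using T unfolding openin_zariski[OF cr] by blast
        interpret \<pp>: primeideal \<pp> ?R using \<open>\<pp> \<in> spectrum ?R\<close> by (simp add: spectrum_def)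
        have "0 \<in> \<pp>" using \<pp>.zero_closed by (simp add: ops)
        then have "\<not> S \<subseteq> {0}" using S T by auto
        then have "{0} \<in> T" "{0} \<in> ?U" using S gen \<open>p \<noteq> 0\<close> by auto
        then show ?thesis by blast
      qed
      then show ?thesis
        unfolding in_closure_of topspace_zariski[OF cr] using \<open>\<pp> \<in> spectrum ?R\<close> by blast
    qed
    then show ?thesis
      using closure_of_subset_topspace[of ?X ?U] unfolding topspace_zariski[OF cr] by blast
  qed
  moreover have "Q f" if "f \<in> homogeneous_part n 3" "cubic_point n f \<in> ?U" for f
    using that p Q unfolding cubic_point_def by auto
  ultimately show ?thesis
    unfolding for_general_cubic_def Let_def by blast
qed

section \<open>Linear algebra with polynomial entries\<close>

text \<open>The induction runs over the generators, with \<open>v\<close> arbitrary. If the new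
  vector lies in the span of the others, a functional that kills those kills it as well. Otherwise a
  functional \<open>\<phi>\<close> separates it from them; \<open>v\<close> is replaced by its
  projection \<open>v - e * a x\<close> to the kernel of \<open>\<phi>\<close>, and a functional
  \<open>\<psi>\<close> found for this projection is corrected to
  \<open>\<psi> - b * \<phi>\<close>, which kills \<open>a x\<close>.\<close>

lemma span_or_functional:
  fixes a :: "'i \<Rightarrow> 'r \<Rightarrow> 'k::field"
  assumes "finite I" "finite R"
  shows "(\<exists>c. \<forall>r\<in>R. v r = (\<Sum>i\<in>I. c i * a i r)) \<or>
    (\<exists>\<phi>. (\<forall>i\<in>I. (\<Sum>r\<in>R. \<phi> r * a i r) = 0) \<and> (\<Sum>r\<in>R. \<phi> r * v r) = 1)"
  using assms(1)
proof (induction I arbitrary: v)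
  case empty
  show ?case
  proof (cases "\<forall>r\<in>R. v r = 0")
    case False
    then obtain s where s: "s \<in> R" "v s \<noteq> 0" by blast
    have "(\<Sum>r\<in>R. (if r = s then 1 / v s else 0) * v r) = (\<Sum>r\<in>R. if r = s then 1 else 0)"
      using s by (intro sum.cong) auto
    also have "\<dots> = 1" using s assms(2) by simp
    finally show ?thesis by (intro disjI2 exI[of _ "\<lambda>r. if r = s then 1 / v s else 0"]) simp
  qed simp
next
  case (insert x I)
  from insert.IH[of "a x"] show ?case
  proof
    assume "\<exists>c. \<forall>r\<in>R. a x r = (\<Sum>i\<in>I. c i * a i r)"
    then obtain c where c: "\<forall>r\<in>R. a x r = (\<Sum>i\<in>I. c i * a i r)" by blast
    from insert.IH[of v] show ?thesis
    proof
      assume "\<exists>d. \<forall>r\<in>R. v r = (\<Sum>i\<in>I. d i * a i r)"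
      then obtain d where d: "\<forall>r\<in>R. v r = (\<Sum>i\<in>I. d i * a i r)" by blast
      have "(\<Sum>i\<in>insert x I. (if i = x then 0 else d i) * a i r) = (\<Sum>i\<in>I. d i * a i r)" for r
        using insert.hyps by (auto intro: sum.cong)
      then show ?thesis using d by (intro disjI1 exI[of _ "\<lambda>i. if i = x then 0 else d i"]) simp
    next
      assume "\<exists>\<phi>. (\<forall>i\<in>I. (\<Sum>r\<in>R. \<phi> r * a i r) = 0) \<and> (\<Sum>r\<in>R. \<phi> r * v r) = 1"
      then obtain \<phi> where \<phi>: "\<forall>i\<in>I. (\<Sum>r\<in>R. \<phi> r * a i r) = 0" "(\<Sum>r\<in>R. \<phi> r * v r) = 1" by blast
      have "(\<Sum>r\<in>R. \<phi> r * a x r) = (\<Sum>r\<in>R. \<Sum>i\<in>I. c i * (\<phi> r * a i r))"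
        using c by (intro sum.cong) (auto simp: sum_distrib_left algebra_simps)
      also have "\<dots> = (\<Sum>i\<in>I. c i * (\<Sum>r\<in>R. \<phi> r * a i r))"
        by (subst sum.swap) (simp add: sum_distrib_left)
      also have "\<dots> = 0" using \<phi> by simp
      finally show ?thesis using \<phi> by (intro disjI2 exI[of _ \<phi>]) simp
    qed
  next
    assume "\<exists>\<phi>. (\<forall>i\<in>I. (\<Sum>r\<in>R. \<phi> r * a i r) = 0) \<and> (\<Sum>r\<in>R. \<phi> r * a x r) = 1"
    then obtain \<phi> where \<phi>: "\<forall>i\<in>I. (\<Sum>r\<in>R. \<phi> r * a i r) = 0" "(\<Sum>r\<in>R. \<phi> r * a x r) = 1" by blast
    define e where "e = (\<Sum>r\<in>R. \<phi> r * v r)"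
    from insert.IH[of "\<lambda>r. v r - e * a x r"] show ?thesis
    proof
      assume "\<exists>d. \<forall>r\<in>R. v r - e * a x r = (\<Sum>i\<in>I. d i * a i r)"
      then obtain d where d: "\<forall>r\<in>R. v r - e * a x r = (\<Sum>i\<in>I. d i * a i r)" by blast
      have "(\<Sum>i\<in>insert x I. (if i = x then e else d i) * a i r) = e * a x r + (\<Sum>i\<in>I. d i * a i r)" for r
        using insert.hyps by (auto intro: sum.cong)
      then show ?thesis using d
        by (intro disjI1 exI[of _ "\<lambda>i. if i = x then e else d i"]) (auto simp: algebra_simps)
    next
      assume "\<exists>\<psi>. (\<forall>i\<in>I. (\<Sum>r\<in>R. \<psi> r * a i r) = 0) \<and> (\<Sum>r\<in>R. \<psi> r * (v r - e * a x r)) = 1"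
      then obtain \<psi> where \<psi>: "\<forall>i\<in>I. (\<Sum>r\<in>R. \<psi> r * a i r) = 0"
        "(\<Sum>r\<in>R. \<psi> r * (v r - e * a x r)) = 1" by blast
      define b where "b = (\<Sum>r\<in>R. \<psi> r * a x r)"
      have lin: "(\<Sum>r\<in>R. (\<psi> r - b * \<phi> r) * w r) = (\<Sum>r\<in>R. \<psi> r * w r) - b * (\<Sum>r\<in>R. \<phi> r * w r)" for w
        by (simp add: sum_subtractf sum_distrib_left algebra_simps)
      have "(\<Sum>r\<in>R. \<psi> r * v r) - e * b = 1"
        using \<psi>(2) by (simp add: b_def sum_subtractf sum_distrib_left algebra_simps)
      then have "(\<Sum>r\<in>R. \<psi> r * v r) - b * e = 1" by (simp add: mult.commute)
      then have "(\<Sum>r\<in>R. (\<psi> r - b * \<phi> r) * v r) = 1" unfolding lin e_def .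
      moreover have "(\<Sum>r\<in>R. (\<psi> r - b * \<phi> r) * a i r) = 0" if "i \<in> insert x I" for i
        using that \<phi> \<psi>(1) unfolding lin by (auto simp: b_def)
      ultimately show ?thesis
        by (intro disjI2 exI[of _ "\<lambda>r. \<psi> r - b * \<phi> r"]) simp
    qed
  qed
qed

lemma span_of_no_functional:
  fixes a :: "'i \<Rightarrow> 'r \<Rightarrow> 'k::field"
  assumes "finite I" "finite R"
    and "\<And>\<phi>. \<forall>i\<in>I. (\<Sum>r\<in>R. \<phi> r * a i r) = 0 \<Longrightarrow> \<forall>r\<in>R. \<phi> r = 0"
  shows "\<exists>c. \<forall>r\<in>R. v r = (\<Sum>i\<in>I. c i * a i r)"
proof -
  from span_or_functional[OF assms(1,2), where v = v and a = a] show ?thesis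
  proof
    assume "\<exists>\<phi>. (\<forall>i\<in>I. (\<Sum>r\<in>R. \<phi> r * a i r) = 0) \<and> (\<Sum>r\<in>R. \<phi> r * v r) = 1"
    then obtain \<phi> where \<phi>: "\<forall>i\<in>I. (\<Sum>r\<in>R. \<phi> r * a i r) = 0" "(\<Sum>r\<in>R. \<phi> r * v r) = 1"
      by blast
    then show ?thesis using assms(3)[OF \<phi>(1)] by simp
  qed
qed

text \<open>\<open>d\<close> is the determinant and \<open>B\<close> the adjugate matrix, so that
  inverting \<open>A f\<close> needs no division and all entries stay polynomial in f.\<close>

lemma polyfun_adjugate:
  fixes A :: "(nat monomial \<Rightarrow> 'k::field) \<Rightarrow> nat \<Rightarrow> nat \<Rightarrow> 'k"
  assumes A: "\<And>i j. i < N \<Longrightarrow> j < N \<Longrightarrow> polyfun n (\<lambda>f. A f i j)"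
    and f0: "\<And>i j. i < N \<Longrightarrow> j < N \<Longrightarrow> A f0 i j = (if i = j then 1 else 0)"
  shows "\<exists>d B. polyfun n d \<and> d f0 = 1 \<and> (\<forall>i<N. \<forall>j<N. polyfun n (\<lambda>f. B f i j)) \<and>
    (\<forall>f. \<forall>i<N. \<forall>j<N. (\<Sum>k<N. A f i k * B f k j) = (if i = j then d f else 0)) \<and>
    (\<forall>f. \<forall>i<N. \<forall>j<N. (\<Sum>k<N. B f i k * A f k j) = (if i = j then d f else 0))"
proof -
  define M where "M = (\<lambda>f. mat N N (\<lambda>(i, j). A f i j))"
  have M: "M f \<in> carrier_mat N N" for f by (simp add: M_def)
  show ?thesis
  proof (intro exI[of _ "\<lambda>f. det (M f)"] exI[of _ "\<lambda>f i j. adj_mat (M f) $$ (i, j)"] conjI allI impI)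
    show "polyfun n (\<lambda>f. det (M f))"
      unfolding M_def by (rule polyfun_det) (rule A)
    have "M f0 = 1\<^sub>m N" by (rule eq_matI) (auto simp: M_def f0)
    then show "det (M f0) = 1" by simp
  next
    fix i j assume ij: "i < N" "j < N"
    have "mat_delete (M f) j i = mat (N - 1) (N - 1) (\<lambda>(i', j').
        A f (if i' < j then i' else Suc i') (if j' < i then j' else Suc j'))" for f
      using ij by (intro eq_matI) (auto simp: mat_delete_def M_def)
    then have *: "adj_mat (M f) $$ (i, j) = (-1)^(j+i) * det (mat (N - 1) (N - 1) (\<lambda>(i', j').
        A f (if i' < j then i' else Suc i') (if j' < i then j' else Suc j')))" for f
      using ij M[of f] by (auto simp: adj_mat_def cofactor_def)
    show "polyfun n (\<lambda>f. adj_mat (M f) $$ (i, j))"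
      unfolding * by (intro polyfun_mult polyfun_const polyfun_det A) (use ij in auto)
  next
    fix f i j assume ij: "i < N" "j < N"
    have "(M f * adj_mat (M f)) $$ (i, j) = (\<Sum>k<N. A f i k * adj_mat (M f) $$ (k, j))"
      "(adj_mat (M f) * M f) $$ (i, j) = (\<Sum>k<N. adj_mat (M f) $$ (i, k) * A f k j)"
      using ij M[of f] adj_mat(1)[OF M[of f]]
      by (auto simp: scalar_prod_def M_def lessThan_atLeast0 intro!: sum.cong)
    then show "(\<Sum>k<N. A f i k * adj_mat (M f) $$ (k, j)) = (if i = j then det (M f) else 0)"
      "(\<Sum>k<N. adj_mat (M f) $$ (i, k) * A f k j) = (if i = j then det (M f) else 0)"
      unfolding adj_mat[OF M] using ij by auto
  qed
qed

text \<open>At \<open>f0\<close> the unit vectors are combinations of the \<open>a f0 i\<close>,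
  with coefficients \<open>c\<close>. The same constant coefficients applied to the
  \<open>a f i\<close> give a square matrix \<open>A f\<close>, polynomial in f and equal to the
  identity at \<open>f0\<close>. Wherever its determinant is non-zero its rows span, and they are
  combinations of the \<open>a f i\<close>.\<close>

lemma spanning_is_open:
  fixes a :: "(nat monomial \<Rightarrow> 'k::field) \<Rightarrow> 'i \<Rightarrow> 'r \<Rightarrow> 'k"
  assumes I: "finite I" and R: "finite R"
    and a: "\<And>i r. i \<in> I \<Longrightarrow> r \<in> R \<Longrightarrow> polyfun n (\<lambda>f. a f i r)"
    and f0: "\<And>\<phi>. \<forall>i\<in>I. (\<Sum>r\<in>R. \<phi> r * a f0 i r) = 0 \<Longrightarrow> \<forall>r\<in>R. \<phi> r = 0"
  obtains d where "polyfun n d" "d f0 \<noteq> 0"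
    "\<And>f v. d f \<noteq> 0 \<Longrightarrow> \<exists>c. \<forall>r\<in>R. v r = (\<Sum>i\<in>I. c i * a f i r)"
proof -
  define N where "N = card R"
  obtain e where e: "bij_betw e {..<N} R"
    using ex_bij_betw_nat_finite[OF R] unfolding N_def lessThan_atLeast0 by blast
  have eR: "e k \<in> R" if "k < N" for k using e that by (auto simp: bij_betw_def)
  have e_inj: "e k = e l \<longleftrightarrow> k = l" if "k < N" "l < N" for k l
    using e that by (auto simp: bij_betw_def inj_on_def)
  have "\<forall>s. \<exists>c. \<forall>r\<in>R. (if r = s then 1 else 0) = (\<Sum>i\<in>I. c i * a f0 i r)"
    by (intro allI span_of_no_functional[OF I R]) (rule f0)
  from choice[OF this] obtain c where
    "\<forall>s. \<forall>r\<in>R. (if r = s then 1 else 0) = (\<Sum>i\<in>I. c s i * a f0 i r)" ..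
  then have c: "(\<Sum>i\<in>I. c s i * a f0 i r) = (if r = s then 1 else 0)" if "r \<in> R" for r s
    using that by simp
  define A where "A = (\<lambda>f k l. \<Sum>i\<in>I. c (e k) i * a f i (e l))"
  have A: "polyfun n (\<lambda>f. A f i j)" if "i < N" "j < N" for i j
    unfolding A_def by (intro polyfun_sum polyfun_mult polyfun_const a) (auto simp: eR that)
  have A0: "A f0 i j = (if i = j then 1 else 0)" if "i < N" "j < N" for i j
    using that by (auto simp: A_def c eR e_inj)
  have "\<exists>d B. polyfun n d \<and> d f0 = 1 \<and> (\<forall>i<N. \<forall>j<N. polyfun n (\<lambda>f. B f i j)) \<and>
    (\<forall>f. \<forall>i<N. \<forall>j<N. (\<Sum>k<N. A f i k * B f k j) = (if i = j then d f else 0)) \<and>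
    (\<forall>f. \<forall>i<N. \<forall>j<N. (\<Sum>k<N. B f i k * A f k j) = (if i = j then d f else 0))"
    by (rule polyfun_adjugate) (rule A A0; assumption)+
  then obtain d B where dB: "polyfun n d" "d f0 = 1"
    "\<forall>f. \<forall>i<N. \<forall>j<N. (\<Sum>k<N. B f i k * A f k j) = (if i = j then d f else 0)"
    by blast
  show ?thesis
  proof (rule that[OF dB(1)])
    fix f and v :: "'r \<Rightarrow> 'k" assume df: "d f \<noteq> 0"
    \<comment> \<open>The row vector \<open>v\<close> times the inverse \<open>B f / d f\<close> of
      \<open>A f\<close>, times the coefficients \<open>c\<close>.\<close>
    define w where "w = (\<lambda>i. \<Sum>j<N. \<Sum>k<N. v (e j) / d f * B f j k * c (e k) i)"
    have "(\<Sum>i\<in>I. w i * a f i (e l)) = v (e l)" if l: "l < N" for l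
    proof -
      have "(\<Sum>i\<in>I. w i * a f i (e l)) =
          (\<Sum>i\<in>I. \<Sum>j<N. \<Sum>k<N. v (e j) / d f * (B f j k * (c (e k) i * a f i (e l))))"
        by (simp add: w_def sum_distrib_right mult.assoc)
      also have "\<dots> = (\<Sum>j<N. \<Sum>k<N. \<Sum>i\<in>I. v (e j) / d f * (B f j k * (c (e k) i * a f i (e l))))"
        by (subst sum.swap, rule sum.cong[OF refl], rule sum.swap)
      also have "\<dots> = (\<Sum>j<N. v (e j) / d f * (\<Sum>k<N. B f j k * A f k l))"
        by (simp add: A_def sum_distrib_left)
      also have "\<dots> = (\<Sum>j<N. if j = l then v (e l) else 0)"
        using l df by (intro sum.cong) (auto simp: dB(3))
      also have "\<dots> = v (e l)" using l by simp
      finally show ?thesis .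
    qed
    then show "\<exists>c. \<forall>r\<in>R. v r = (\<Sum>i\<in>I. c i * a f i r)"
      using e by (intro exI[of _ w]) (auto simp: bij_betw_def)
  qed (simp add: dB)
qed

section \<open>Hilbert functions by linear functionals\<close>

lemma poly_ring_simps:
  "x \<oplus>\<^bsub>poly_ring n\<^esub> y = x + y" "x \<otimes>\<^bsub>poly_ring n\<^esub> y = x * y"
  "\<zero>\<^bsub>poly_ring n\<^esub> = 0" "\<one>\<^bsub>poly_ring n\<^esub> = 1"
  by (simp_all add: poly_ring_def mpoly_ring_def)

lemma cring_poly_ring: "cring (poly_ring n :: ((nat, 'k::field) mpoly) ring)"
  unfolding poly_ring_def by (rule cring_mpoly_ring)

lemma poly_ring_carrier_iff: "p \<in> carrier (poly_ring n) \<longleftrightarrow> (\<forall>m\<in>Poly_Mapping.keys p. Poly_Mapping.keys m \<subseteq> {..<n})"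
  by (simp add: poly_ring_def mpoly_ring_def)

lemma poly_ring_closed:
  fixes p q :: "(nat, 'k::field) mpoly"
  assumes "p \<in> carrier (poly_ring n)" "q \<in> carrier (poly_ring n)"
  shows "p + q \<in> carrier (poly_ring n)" "p * q \<in> carrier (poly_ring n)"
proof -
  interpret cring "poly_ring n :: ((nat, 'k) mpoly) ring" by (rule cring_poly_ring)
  show "p + q \<in> carrier (poly_ring n)" "p * q \<in> carrier (poly_ring n)"
    using a_closed[OF assms] m_closed[OF assms] by (simp_all add: poly_ring_simps)
qed

lemma keys_const_mult: "Poly_Mapping.keys (Poly_Mapping.single 0 a * p) \<subseteq> Poly_Mapping.keys p"
  for p :: "('v, 'k::field) mpoly"
  using keys_mult[of "Poly_Mapping.single 0 a" p] by (auto split: if_splits)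

lemma homogeneous_part_add:
  assumes "p \<in> homogeneous_part n d" "q \<in> homogeneous_part n d"
  shows "p + q \<in> homogeneous_part n d"
  using assms Poly_Mapping.keys_add[of p q] poly_ring_closed(1)[of p n q]
  unfolding homogeneous_part_def by blast

lemma homogeneous_part_const_mult:
  assumes "p \<in> homogeneous_part n d"
  shows "Poly_Mapping.single 0 a * p \<in> homogeneous_part n d"
  using assms keys_const_mult[of a p]
  unfolding homogeneous_part_def poly_ring_carrier_iff by blast

lemma homogeneous_part_uminus: "p \<in> homogeneous_part k d \<Longrightarrow> - p \<in> homogeneous_part k d"
  for p :: "(nat, 'k::field) mpoly"
  using homogeneous_part_const_mult[of p k d "-1"] by (simp add: single_uminus)

lemma homogeneous_part_diff:
  "p \<in> homogeneous_part k d \<Longrightarrow> q \<in> homogeneous_part k d \<Longrightarrow> p - q \<in> homogeneous_part k d"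
  for p q :: "(nat, 'k::field) mpoly"
  using homogeneous_part_add[OF _ homogeneous_part_uminus, of p k d q] by simp

lemma homogeneous_part_zero [simp]: "0 \<in> homogeneous_part n d"
  by (simp add: homogeneous_part_def poly_ring_carrier_iff)

lemma homogeneous_part_carrier: "p \<in> homogeneous_part n d \<Longrightarrow> p \<in> carrier (poly_ring n)"
  by (simp add: homogeneous_part_def)

section \<open>Linear functionals given by weights on monomials\<close>

definition pairing :: "('v monomial \<Rightarrow> 'k) \<Rightarrow> ('v, 'k::field) mpoly \<Rightarrow> 'k"
  where "pairing w p = (\<Sum>m\<in>Poly_Mapping.keys p. Poly_Mapping.lookup p m * w m)"

lemma pairing_superset:
  assumes "finite A" "Poly_Mapping.keys p \<subseteq> A"
  shows "pairing w p = (\<Sum>m\<in>A. Poly_Mapping.lookup p m * w m)"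
  unfolding pairing_def using assms
  by (intro sum.mono_neutral_left) (auto simp: in_keys_iff)

lemma pairing_zero [simp]: "pairing w 0 = 0"
  by (simp add: pairing_def)

lemma pairing_add: "pairing w (p + q) = pairing w p + pairing w q"
proof -
  let ?A = "Poly_Mapping.keys p \<union> Poly_Mapping.keys q"
  have "Poly_Mapping.keys (p + q) \<subseteq> ?A" by (rule Poly_Mapping.keys_add)
  then show ?thesis
    by (simp add: pairing_superset[of ?A] lookup_add distrib_right sum.distrib)
qed

lemma pairing_single [simp]: "pairing w (Poly_Mapping.single m a) = a * w m"
  by (simp add: pairing_superset[of "{m}"])

lemma pairing_const_mult: "pairing w (Poly_Mapping.single 0 a * p) = a * pairing w p"
  by (induction p rule: mpoly_induct) (simp_all add: distrib_left pairing_add mult_single)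

lemma pairing_uminus: "pairing w (- p) = - pairing w p"
  using pairing_const_mult[of w "-1" p] by (simp add: single_uminus)

lemma pairing_diff: "pairing w (p - q) = pairing w p - pairing w q"
  using pairing_add[of w p "-q"] by (simp add: pairing_uminus)

lemma pairing_sum: "pairing w (sum h A) = (\<Sum>i\<in>A. pairing w (h i))"
  by (induction A rule: infinite_finite_induct) (simp_all add: pairing_add)

text \<open>A flag climbs from 0 to the whole graded piece, the form dual to \<open>w j\<close>
  adding one line at step j, in accordance with the inductive definition of dimension. That 1 is not
  in J makes the constants embed as a field in the quotient.\<close>

lemma hilbert_quotientI:
  fixes J :: "(nat, 'k::field) mpoly set"
  assumes J: "ideal J (poly_ring n)" and one: "1 \<notin> J"
    and ker: "\<And>p. p \<in> homogeneous_part n i \<Longrightarrow> p \<in> J \<longleftrightarrow> (\<forall>j<r. pairing (w j) p = 0)"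
    and surj: "\<And>j. j < r \<Longrightarrow> \<exists>p\<in>homogeneous_part n i. \<forall>k<r. pairing (w k) p = (if k = j then 1 else 0)"
  shows "hilbert_quotient n J i = r"
proof -
  let ?R = "poly_ring n :: ((nat, 'k) mpoly) ring"
  let ?Q = "?R Quot J"
  let ?c = "\<lambda>a::'k. Poly_Mapping.single 0 a :: (nat, 'k) mpoly"
  let ?h = "\<lambda>p. J +>\<^bsub>?R\<^esub> p"
  interpret cring ?R by (rule cring_poly_ring)
  interpret J: ideal J ?R by (rule J)
  interpret Q: cring ?Q by (rule J.quotient_is_cring) (rule cring_axioms)
  interpret h: ring_hom_ring ?R ?Q ?h by (rule J.rcos_ring_hom_ring)
  have c_carr: "?c a \<in> carrier ?R" for a by (simp add: poly_ring_carrier_iff)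
  have eq_iff: "?h p = ?h q \<longleftrightarrow> p - q \<in> J" if "p \<in> carrier ?R" "q \<in> carrier ?R" for p q
  proof -
    have "- q \<in> carrier ?R" using that by (simp add: poly_ring_carrier_iff in_keys_iff)
    then have "\<ominus>\<^bsub>?R\<^esub> q = - q"
      using that minus_equality[of "- q" q] by (simp add: poly_ring_simps)
    then have "p \<ominus>\<^bsub>?R\<^esub> q = p - q" by (simp add: a_minus_def poly_ring_simps)
    then show ?thesis using quotient_eq_iff_same_a_r_cos[OF J that] by simp
  qed
  have h0: "?h p = \<zero>\<^bsub>?Q\<^esub> \<longleftrightarrow> p \<in> J" if "p \<in> carrier ?R" for p
    using eq_iff[OF that, of 0] h.hom_zero zero_closed by (simp add: poly_ring_simps)
  have "subfield (range ?c) ?R"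
  proof (rule subfieldI)
    have "subring (range ?c) ?R"
    proof (rule subringI)
      fix h assume "h \<in> range ?c"
      then obtain a where a: "h = ?c a" by blast
      have "\<ominus>\<^bsub>?R\<^esub> h = ?c (- a)"
        using minus_equality[OF _ c_carr[of a] c_carr[of "- a"]]
        by (simp add: a poly_ring_simps flip: single_add)
      then show "\<ominus>\<^bsub>?R\<^esub> h \<in> range ?c" by blast
    qed (auto simp: c_carr poly_ring_simps mult_single simp flip: single_add single_one)
    then show "subcring (range ?c) ?R" by (rule subcringI')
    show "Units (?R\<lparr>carrier := range ?c\<rparr>) = range ?c - {\<zero>\<^bsub>?R\<^esub>}"
    proof
      show "Units (?R\<lparr>carrier := range ?c\<rparr>) \<subseteq> range ?c - {\<zero>\<^bsub>?R\<^esub>}"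
        by (auto simp: Units_def poly_ring_simps)
      show "range ?c - {\<zero>\<^bsub>?R\<^esub>} \<subseteq> Units (?R\<lparr>carrier := range ?c\<rparr>)"
      proof
        fix x assume "x \<in> range ?c - {\<zero>\<^bsub>?R\<^esub>}"
        then obtain a where a: "x = ?c a" "a \<noteq> 0"
          by (metis DiffE imageE insertI1 poly_ring_simps(3) single_zero)
        then have inv: "?c (inverse a) * x = 1" "x * ?c (inverse a) = 1" by (simp_all add: mult_single)
        then show "x \<in> Units (?R\<lparr>carrier := range ?c\<rparr>)"
          using inv a(1) unfolding Units_def mem_Collect_eq
          by (intro conjI bexI[of _ "?c (inverse a)"]) (simp_all add: poly_ring_simps)
      qed
    qed
  qed
  moreover have "\<one>\<^bsub>?Q\<^esub> \<noteq> \<zero>\<^bsub>?Q\<^esub>"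
    using h0[OF one_closed] h.hom_one one by (simp only: poly_ring_simps) simp
  ultimately have K: "subfield (?h ` range ?c) ?Q"
    by (rule h.img_is_subfield(2))
  \<comment> \<open>\<open>E j\<close> holds the classes of forms on which the functionals of index
    at least j vanish: \<open>E 0\<close> is zero by \<open>ker\<close>, and \<open>E r\<close>
    carries no condition.\<close>
  define E where "E = (\<lambda>j. ?h ` {p \<in> homogeneous_part n i. \<forall>k<r. j \<le> k \<longrightarrow> pairing (w k) p = 0})"
  have "Q.dimension j (?h ` range ?c) (E j)" if "j \<le> r" for j
    using that
  proof (induction j)
    case 0
    have "E 0 = {\<zero>\<^bsub>?Q\<^esub>}"
    proof
      show "E 0 \<subseteq> {\<zero>\<^bsub>?Q\<^esub>}"
      proof
        fix x assume "x \<in> E 0"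
        then obtain p where "p \<in> homogeneous_part n i" "\<forall>k<r. pairing (w k) p = 0" "x = ?h p"
          unfolding E_def by auto
        then show "x \<in> {\<zero>\<^bsub>?Q\<^esub>}"
          using ker[of p] h0[OF homogeneous_part_carrier] by simp
      qed
      show "{\<zero>\<^bsub>?Q\<^esub>} \<subseteq> E 0"
        unfolding E_def using h.hom_zero by (intro subsetI image_eqI[of _ _ 0]) (simp_all add: poly_ring_simps)
    qed
    then show ?case by simp
  next
    case (Suc j)
    obtain e where e: "e \<in> homogeneous_part n i" "\<forall>k<r. pairing (w k) e = (if k = j then 1 else 0)"
      using surj[of j] Suc.prems by auto
    have ec: "e \<in> carrier ?R" using e homogeneous_part_carrier by blast
    have "?h e \<notin> E j"
    proof
      assume "?h e \<in> E j"
      then obtain p where p: "p \<in> homogeneous_part n i" "\<forall>k<r. j \<le> k \<longrightarrow> pairing (w k) p = 0" "?h e = ?h p"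
        unfolding E_def by blast
      have "e - p \<in> J" using p eq_iff[OF ec] homogeneous_part_carrier by blast
      moreover have "e - p \<in> homogeneous_part n i"
        using homogeneous_part_add[OF e(1) homogeneous_part_const_mult[OF p(1), of "-1"]]
        by (simp add: single_uminus)
      ultimately have "pairing (w j) (e - p) = 0" using ker Suc.prems by auto
      then show False using e p Suc.prems by (auto simp: pairing_diff)
    qed
    moreover have "E (Suc j) = Q.line_extension (?h ` range ?c) (?h e) (E j)"
    proof (intro equalityI subsetI)
      fix u assume "u \<in> E (Suc j)"
      then obtain p where p: "p \<in> homogeneous_part n i" "\<forall>k<r. Suc j \<le> k \<longrightarrow> pairing (w k) p = 0" "u = ?h p"
        unfolding E_def by blast
      define a where "a = pairing (w j) p"
      define q where "q = p - ?c a * e"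
      have q: "q \<in> homogeneous_part n i"
        using homogeneous_part_add[OF p(1) homogeneous_part_const_mult[OF e(1), of "-a"]]
        by (simp add: q_def single_uminus)
      have "pairing (w k) q = 0" if "k < r" "j \<le> k" for k
        using that p(2) e(2) by (cases "k = j") (auto simp: q_def pairing_diff pairing_const_mult a_def)
      then have "?h q \<in> E j" using q unfolding E_def by blast
      moreover have "p = ?c a * e + q" by (simp add: q_def)
      then have "u = ?h (?c a) \<otimes>\<^bsub>?Q\<^esub> ?h e \<oplus>\<^bsub>?Q\<^esub> ?h q"
        using p(3) q ec c_carr[of a] homogeneous_part_carrier[OF q] m_closed[OF c_carr[of a] ec]
        by (simp add: poly_ring_simps flip: h.hom_mult h.hom_add)
      ultimately show "u \<in> Q.line_extension (?h ` range ?c) (?h e) (E j)"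
        unfolding Q.line_extension_mem_iff by blast
    next
      fix u assume "u \<in> Q.line_extension (?h ` range ?c) (?h e) (E j)"
      then obtain a v where av: "v \<in> E j" "u = ?h (?c a) \<otimes>\<^bsub>?Q\<^esub> ?h e \<oplus>\<^bsub>?Q\<^esub> v"
        unfolding Q.line_extension_mem_iff by blast
      then obtain q where q: "q \<in> homogeneous_part n i" "\<forall>k<r. j \<le> k \<longrightarrow> pairing (w k) q = 0" "v = ?h q"
        unfolding E_def by blast
      have "u = ?h (?c a * e + q)"
        using av(2) q(3) ec c_carr[of a] homogeneous_part_carrier[OF q(1)] m_closed[OF c_carr[of a] ec]
        by (simp add: poly_ring_simps flip: h.hom_mult h.hom_add)
      moreover have "?c a * e + q \<in> homogeneous_part n i"
        by (intro homogeneous_part_add homogeneous_part_const_mult e q)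
      moreover have "pairing (w k) (?c a * e + q) = 0" if "k < r" "Suc j \<le> k" for k
        using that q(2) e(2) by (auto simp: pairing_add pairing_const_mult)
      ultimately show "u \<in> E (Suc j)" unfolding E_def by blast
    qed
    ultimately show ?case
      using Q.Suc_dim[of "?h e" "E j" j] Suc h.hom_closed[OF ec] by simp
  qed
  then have "Q.dimension r (?h ` range ?c) (E r)" by simp
  moreover have "E r = ?h ` homogeneous_part n i" by (simp add: E_def)
  ultimately have "Q.dim (?h ` range ?c) (?h ` homogeneous_part n i) = r"
    using Q.dimI[OF K] by (simp add: over_def)
  then show ?thesis by (simp add: hilbert_quotient_def image_image)
qed

section \<open>Monomials as multisets\<close>

text \<open>Multisets stand for monomials because the combinatorics of triples is one of multisets:
  products are sums, completing a pair to a triple is \<open>add_mset\<close>, and relabelling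
  vertices is \<open>image_mset\<close>.\<close>

definition monom_of :: "nat multiset \<Rightarrow> nat monomial"
  where "monom_of M = (\<Sum>a\<in>#M. Poly_Mapping.single a 1)"

definition msets :: "nat \<Rightarrow> nat \<Rightarrow> nat multiset set"
  where "msets n d = {M. set_mset M \<subseteq> {..<n} \<and> size M = d}"

lemma lookup_monom_of [simp]: "Poly_Mapping.lookup (monom_of M) = count M"
proof
  show "Poly_Mapping.lookup (monom_of M) a = count M a" for a
    by (induction M) (auto simp: monom_of_def lookup_add lookup_single when_def)
qed

lemma monom_of_eq_iff [simp]: "monom_of M = monom_of N \<longleftrightarrow> M = N"
  by (metis lookup_monom_of multiset_eqI)

lemma monom_of_add: "monom_of (M + N) = monom_of M + monom_of N"
  by (simp add: monom_of_def)

lemma monom_of_empty [simp]: "monom_of {#} = 0"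
  by (simp add: monom_of_def)

lemma keys_monom_of [simp]: "Poly_Mapping.keys (monom_of M) = set_mset M"
  by (auto simp: in_keys_iff)

lemma mdeg_monom_of [simp]: "mdeg (monom_of M) = size M"
  by (simp add: mdeg_def size_multiset_overloaded_eq)

lemma ex_monom_of: "\<exists>M. m = monom_of M"
proof -
  have "{x. 0 < Poly_Mapping.lookup m x} = Poly_Mapping.keys m" by (auto simp: in_keys_iff)
  then have "finite {x. 0 < Poly_Mapping.lookup m x}" by simp
  then have "count (Abs_multiset (Poly_Mapping.lookup m)) = Poly_Mapping.lookup m" by simp
  then have "m = monom_of (Abs_multiset (Poly_Mapping.lookup m))" by (intro poly_mapping_eqI) simp
  then show ?thesis ..
qed

lemma finite_msets [simp]: "finite (msets n d)"
proof -
  have "msets n d = {M. set_mset M \<subseteq> {..<n} \<and> size M = d}" by (simp add: msets_def)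
  moreover have "finite {M. set_mset M \<subseteq> {..<n} \<and> size M = d}"
  proof (rule finite_subset)
    show "{M. set_mset M \<subseteq> {..<n} \<and> size M = d} \<subseteq> mset ` {xs. set xs \<subseteq> {..<n} \<and> length xs = d}"
    proof
      fix M assume M: "M \<in> {M. set_mset M \<subseteq> {..<n} \<and> size M = d}"
      obtain xs where "M = mset xs" by (metis ex_mset)
      then show "M \<in> mset ` {xs. set xs \<subseteq> {..<n} \<and> length xs = d}" using M by auto
    qed
    show "finite (mset ` {xs. set xs \<subseteq> {..<n} \<and> length xs = d})"
      by (intro finite_imageI finite_lists_length_eq) simp
  qed
  ultimately show ?thesis by simp
qed

lemma msets_add: "M \<in> msets n d \<Longrightarrow> N \<in> msets n e \<Longrightarrow> M + N \<in> msets n (d + e)"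
  by (auto simp: msets_def)

lemma homogeneous_part_keys:
  assumes "p \<in> homogeneous_part n d"
  shows "Poly_Mapping.keys p \<subseteq> monom_of ` msets n d"
proof
  fix m assume m: "m \<in> Poly_Mapping.keys p"
  obtain M where "m = monom_of M" using ex_monom_of by blast
  then show "m \<in> monom_of ` msets n d"
    using m assms by (force simp: homogeneous_part_def poly_ring_carrier_iff msets_def)
qed

lemma homogeneous_part_iff: "p \<in> homogeneous_part n d \<longleftrightarrow> Poly_Mapping.keys p \<subseteq> monom_of ` msets n d"
  using homogeneous_part_keys[of p n d]
  by (fastforce simp: homogeneous_part_def poly_ring_carrier_iff msets_def)

lemma pairing_homogeneous:
  assumes "p \<in> homogeneous_part n d"
  shows "pairing w p = (\<Sum>M\<in>msets n d. Poly_Mapping.lookup p (monom_of M) * w (monom_of M))"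
  using pairing_superset[OF _ homogeneous_part_keys[OF assms], of w]
  by (simp add: sum.reindex inj_on_def)

lemma homogeneous_part_eq_sum:
  assumes "p \<in> homogeneous_part n d"
  shows "p = (\<Sum>M\<in>msets n d. Poly_Mapping.single (monom_of M) (Poly_Mapping.lookup p (monom_of M)))"
proof (rule poly_mapping_eqI)
  fix m
  obtain N where N: "m = monom_of N" using ex_monom_of by blast
  have "Poly_Mapping.lookup p m = 0" if "N \<notin> msets n d"
    using homogeneous_part_keys[OF assms] that N by (auto simp: in_keys_iff)
  then show "Poly_Mapping.lookup p m = Poly_Mapping.lookup (\<Sum>M\<in>msets n d.
      Poly_Mapping.single (monom_of M) (Poly_Mapping.lookup p (monom_of M))) m"
    by (auto simp: N lookup_sum lookup_single when_def)
qed

lemma single_homogeneous: "M \<in> msets n d \<Longrightarrow> Poly_Mapping.single (monom_of M) a \<in> homogeneous_part n d"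
  by (auto simp: homogeneous_part_iff)

lemma homogeneous_part_sum:
  "(\<And>i. i \<in> A \<Longrightarrow> h i \<in> homogeneous_part n d) \<Longrightarrow> sum h A \<in> homogeneous_part n d"
  by (induction A rule: infinite_finite_induct) (auto intro: homogeneous_part_add)

lemma homogeneous_part_mult:
  assumes "p \<in> homogeneous_part n d" "q \<in> homogeneous_part n e"
  shows "p * q \<in> homogeneous_part n (d + e)"
proof -
  have "Poly_Mapping.keys (p * q) \<subseteq> monom_of ` msets n (d + e)"
  proof
    fix m assume "m \<in> Poly_Mapping.keys (p * q)"
    then obtain a b where ab: "m = a + b" "a \<in> Poly_Mapping.keys p" "b \<in> Poly_Mapping.keys q"
      using keys_mult[of p q] by blast
    then obtain A B where "A \<in> msets n d" "B \<in> msets n e" "a = monom_of A" "b = monom_of B"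
      using assms homogeneous_part_keys by blast
    then show "m \<in> monom_of ` msets n (d + e)" using ab(1) msets_add
      by (metis imageI monom_of_add)
  qed
  then show ?thesis by (simp add: homogeneous_part_iff)
qed

section \<open>Contraction\<close>

lemma pairing_mult: "pairing w (p * q) = pairing (\<lambda>m. pairing (\<lambda>m'. w (m + m')) q) p"
proof (induction p rule: mpoly_induct)
  case (single m a)
  show ?case by (induction q rule: mpoly_induct) (simp_all add: mult_single distrib_left pairing_add)
qed (simp_all add: distrib_right pairing_add)

lemma pairing_swap: "pairing (\<lambda>m. pairing (\<lambda>m'. g m m') q) p = pairing (\<lambda>m'. pairing (\<lambda>m. g m m') p) q"
  unfolding pairing_def
  by (simp add: sum_distrib_left) (subst sum.swap, simp add: algebra_simps)

lemma pairing_eq_zero: "(\<And>m. w m = 0) \<Longrightarrow> pairing w p = 0"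
  by (simp add: pairing_def)

lemma pairing_weight_add: "pairing (\<lambda>m. v m + w m) p = pairing v p + pairing w p"
  by (simp add: pairing_def distrib_left sum.distrib)

lemma pairing_weight_mult: "pairing (\<lambda>m. a * w m) p = a * pairing w p"
  by (simp add: pairing_def sum_distrib_left algebra_simps)

text \<open>A monomial \<open>a\<close> of f contributes to the coefficient at \<open>c\<close>
  exactly when \<open>a = b + c\<close>. So every coefficient of the contraction is a linear
  functional of s, and membership in the annihilator becomes the vanishing of pairings.\<close>

lemma lookup_contract:
  "Poly_Mapping.lookup (contract s f) c = pairing (\<lambda>b. Poly_Mapping.lookup f (b + c)) s"
proof -
  have *: "Poly_Mapping.lookup (if \<forall>v. Poly_Mapping.lookup b v \<le> Poly_Mapping.lookup a v
       then Poly_Mapping.single (a - b) (Poly_Mapping.lookup s b * Poly_Mapping.lookup f a)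
       else 0) c = (if a = b + c then Poly_Mapping.lookup s b * Poly_Mapping.lookup f a else 0)" for a b
  proof -
    have "(\<forall>v. Poly_Mapping.lookup b v \<le> Poly_Mapping.lookup a v) \<and> a - b = c \<longleftrightarrow> a = b + c"
      by (auto simp: poly_mapping_eq_iff fun_eq_iff lookup_add lookup_minus) (metis le_add_diff_inverse)
    then show ?thesis by (auto simp: lookup_single when_def)
  qed
  show ?thesis
    unfolding contract_def lookup_sum * pairing_def
    by (intro sum.cong refl) (auto simp: in_keys_iff)
qed

lemma Ann_iff: "s \<in> Ann n f \<longleftrightarrow> s \<in> carrier (poly_ring n) \<and>
    (\<forall>c. pairing (\<lambda>b. Poly_Mapping.lookup f (b + c)) s = 0)"
  by (auto simp: Ann_def poly_mapping_eq_iff fun_eq_iff lookup_contract)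

lemma ideal_Ann: "ideal (Ann n f) (poly_ring n)"
  for f :: "(nat, 'a::field) mpoly"
proof -
  interpret cring "poly_ring n :: ((nat, 'a) mpoly) ring" by (rule cring_poly_ring)
  have mult: "x * a \<in> Ann n f" if "a \<in> Ann n f" "x \<in> carrier (poly_ring n)" for a x
  proof -
    have "pairing (\<lambda>b. Poly_Mapping.lookup f (b + c)) (x * a) = 0" for c
      unfolding pairing_mult
    proof (rule pairing_eq_zero)
      fix m
      have "pairing (\<lambda>m'. Poly_Mapping.lookup f (m' + (m + c))) a = 0"
        using that(1) Ann_iff by blast
      then show "pairing (\<lambda>m'. Poly_Mapping.lookup f (m + m' + c)) a = 0"
        by (simp add: algebra_simps)
    qed
    then show ?thesis using that poly_ring_closed(2)[of x n a] by (simp add: Ann_iff)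
  qed
  show ?thesis
  proof (rule idealI[OF ring_axioms])
    show "subgroup (Ann n f) (add_monoid (poly_ring n))"
    proof (rule add.subgroupI)
      show "Ann n f \<subseteq> carrier (poly_ring n)" by (auto simp: Ann_iff)
      show "Ann n f \<noteq> {}"
        using zero_closed by (intro ex_in_conv[THEN iffD1] exI[of _ 0]) (simp add: Ann_iff poly_ring_simps)
    next
      fix a assume a: "a \<in> Ann n f"
      have c: "- a \<in> carrier (poly_ring n)" "a \<in> carrier (poly_ring n)"
        using a by (simp_all add: Ann_iff poly_ring_carrier_iff in_keys_iff)
      then have "\<ominus>\<^bsub>poly_ring n\<^esub> a = - a"
        by (intro minus_equality) (simp_all add: poly_ring_simps)
      then show "\<ominus>\<^bsub>poly_ring n\<^esub> a \<in> Ann n f"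
        using a c by (simp add: Ann_iff pairing_uminus)
    next
      fix a b assume "a \<in> Ann n f" "b \<in> Ann n f"
      then show "a \<oplus>\<^bsub>poly_ring n\<^esub> b \<in> Ann n f"
        by (simp add: Ann_iff poly_ring_simps pairing_add poly_ring_closed)
    qed
  next
    fix a x :: "(nat, 'a) mpoly"
    assume ax: "a \<in> Ann n f" "x \<in> carrier (poly_ring n)"
    then show "x \<otimes>\<^bsub>poly_ring n\<^esub> a \<in> Ann n f" "a \<otimes>\<^bsub>poly_ring n\<^esub> x \<in> Ann n f"
      using mult[OF ax] by (simp_all add: poly_ring_simps mult.commute)
  qed
qed

text \<open>The functional dual to the product \<open>x\<^sub>i f\<close> in the divided power ring; Leibniz' rule makes it
  vanish on the square of the annihilator.\<close>

definition prolongation :: "(nat monomial \<Rightarrow> 'k::field) \<Rightarrow> nat \<Rightarrow> nat monomial \<Rightarrow> 'k"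
  where "prolongation f i m = of_nat (Poly_Mapping.lookup m i) *
    f (m - Poly_Mapping.single i 1)"

lemma prolongation_Ann_square:
  assumes "p \<in> Ann n f \<cdot>\<^bsub>poly_ring n\<^esub> Ann n f"
  shows "pairing (prolongation (Poly_Mapping.lookup f) i) p = 0"
  using assms
proof (induction rule: ideal_prod.induct)
  case (prod a b)
  \<comment> \<open>\<open>g m m'\<close> is the summand of Leibniz' rule in which the derivative
    falls on \<open>m\<close>. For fixed \<open>m\<close> it is a multiple of a coefficient
    functional that vanishes on the annihilator; if the variable does not occur in \<open>m\<close>
    the factor is 0, so the truncated subtraction does no harm.\<close>
  define g where "g = (\<lambda>m m'. of_nat (Poly_Mapping.lookup m i) *
    Poly_Mapping.lookup f (m + m' - Poly_Mapping.single i 1))"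
  have *: "pairing (g m) c = 0" if "c \<in> Ann n f" for m c
  proof (cases "Poly_Mapping.lookup m i = 0")
    case False
    have "m + m' - Poly_Mapping.single i 1 = m' + (m - Poly_Mapping.single i 1)" for m'
      using False by (auto simp: poly_mapping_eq_iff fun_eq_iff lookup_add lookup_minus lookup_single when_def)
    then show ?thesis
      using that by (simp add: g_def pairing_weight_mult Ann_iff)
  qed (simp add: g_def pairing_def)
  have "prolongation (Poly_Mapping.lookup f) i (m + m') = g m m' + g m' m" for m m'
    by (simp add: prolongation_def g_def lookup_add algebra_simps)
  then have "pairing (prolongation (Poly_Mapping.lookup f) i) (a * b) =
      pairing (\<lambda>m. pairing (g m) b) a + pairing (\<lambda>m. pairing (\<lambda>m'. g m' m) b) a"
    by (simp add: pairing_mult pairing_weight_add)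
  also have "pairing (\<lambda>m. pairing (\<lambda>m'. g m' m) b) a = pairing (\<lambda>m'. pairing (g m') a) b"
    by (rule pairing_swap)
  also have "pairing (\<lambda>m. pairing (g m) b) a + \<dots> = 0"
    using prod by (simp add: * pairing_eq_zero)
  finally show ?case by (simp add: poly_ring_simps)
qed (simp add: poly_ring_simps pairing_add)

lemma pairing_homogeneous_zero:
  assumes "p \<in> homogeneous_part n d" "\<And>M. M \<in> msets n d \<Longrightarrow> w (monom_of M) = 0"
  shows "pairing w p = 0"
  by (simp add: pairing_homogeneous[OF assms(1)] assms(2))

lemma lookup_homogeneous_zero:
  assumes "p \<in> homogeneous_part n d" "M \<notin> msets n d"
  shows "Poly_Mapping.lookup p (monom_of M) = 0"
  using homogeneous_part_keys[OF assms(1)] assms(2) by (auto simp: in_keys_iff)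

lemma homogeneous_part_eqI:
  assumes "p \<in> homogeneous_part n d" "q \<in> homogeneous_part n d"
    and "\<And>M. M \<in> msets n d \<Longrightarrow> Poly_Mapping.lookup p (monom_of M) = Poly_Mapping.lookup q (monom_of M)"
  shows "p = q"
  using homogeneous_part_eq_sum[OF assms(1)] homogeneous_part_eq_sum[OF assms(2)] assms(3)
  by (metis (no_types, lifting) sum.cong)

text \<open>A form of degree d contracts F to a form of degree 3 - d in n variables. The condition
  is written additively, so that it is empty for d > 3, where every form annihilates F.\<close>

lemma Ann_homogeneous:
  assumes F: "F \<in> homogeneous_part n 3" and p: "p \<in> homogeneous_part n d"
  shows "p \<in> Ann n F \<longleftrightarrow>
    (\<forall>C. d + size C = 3 \<longrightarrow> set_mset C \<subseteq> {..<n} \<longrightarrow>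
      pairing (\<lambda>b. Poly_Mapping.lookup F (b + monom_of C)) p = 0)"
proof -
  have "pairing (\<lambda>b. Poly_Mapping.lookup F (b + monom_of C)) p = 0"
    if "\<not> (d + size C = 3 \<and> set_mset C \<subseteq> {..<n})" for C
  proof (rule pairing_homogeneous_zero[OF p])
    fix M assume "M \<in> msets n d"
    then have "M + C \<notin> msets n 3" using that by (auto simp: msets_def)
    then show "Poly_Mapping.lookup F (monom_of M + monom_of C) = 0"
      using lookup_homogeneous_zero[OF F] by (simp flip: monom_of_add)
  qed
  then show ?thesis
    using homogeneous_part_carrier[OF p] unfolding Ann_iff by (metis ex_monom_of)
qed

lemma Ann_square_subset: "Ann n f \<cdot>\<^bsub>poly_ring n\<^esub> Ann n f \<subseteq> Ann n f"
  for f :: "(nat, 'k::field) mpoly"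
proof
  interpret ideal "Ann n f" "poly_ring n" by (rule ideal_Ann)
  show "p \<in> Ann n f" if "p \<in> Ann n f \<cdot>\<^bsub>poly_ring n\<^esub> Ann n f" for p
    using that by (induction rule: ideal_prod.induct) (auto intro: I_l_closed Icarr)
qed

lemma ideal_Ann_square: "ideal (Ann n f \<cdot>\<^bsub>poly_ring n\<^esub> Ann n f) (poly_ring n)"
  for f :: "(nat, 'k::field) mpoly"
proof -
  interpret cring "poly_ring n :: ((nat, 'k) mpoly) ring" by (rule cring_poly_ring)
  show ?thesis by (rule ideal_prod_is_ideal) (rule ideal_Ann)+
qed

lemma Ann_const_mult:
  assumes "p \<in> Ann n f" shows "Poly_Mapping.single 0 a * p \<in> Ann n f"
proof -
  interpret ideal "Ann n f" "poly_ring n" by (rule ideal_Ann)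
  have "Poly_Mapping.single 0 a \<in> carrier (poly_ring n)" by (simp add: poly_ring_carrier_iff)
  then show ?thesis using I_l_closed[OF assms] by (simp add: poly_ring_simps)
qed

lemma Ann_square_sum:
  assumes "\<And>i. i \<in> A \<Longrightarrow> p i \<in> Ann n f" "\<And>i. i \<in> A \<Longrightarrow> q i \<in> Ann n f"
  shows "(\<Sum>i\<in>A. Poly_Mapping.single 0 (c i) * (p i * q i)) \<in> Ann n f \<cdot>\<^bsub>poly_ring n\<^esub> Ann n f"
  using assms
proof (induction A rule: infinite_finite_induct)
  case (insert i A)
  have "(Poly_Mapping.single 0 (c i) * p i) \<otimes>\<^bsub>poly_ring n\<^esub> q i \<in> Ann n f \<cdot>\<^bsub>poly_ring n\<^esub> Ann n f"
    using insert.prems by (intro ideal_prod.prod Ann_const_mult) auto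
  from ideal_prod.sum[OF this insert.IH] insert.prems insert.hyps show ?case
    by (simp add: poly_ring_simps mult.assoc)
next
  case (infinite A)
  have "0 \<in> Ann n f \<cdot>\<^bsub>poly_ring n\<^esub> Ann n f"
    using additive_subgroup.zero_closed[OF ideal.axioms(1)[OF ideal_Ann_square]]
    by (simp add: poly_ring_simps)
  then show ?case using infinite by simp
next
  case empty
  have "0 \<in> Ann n f \<cdot>\<^bsub>poly_ring n\<^esub> Ann n f"
    using additive_subgroup.zero_closed[OF ideal.axioms(1)[OF ideal_Ann_square]]
    by (simp add: poly_ring_simps)
  then show ?case by simp
qed

lemma polyfun_lookup_mult:
  assumes p: "\<And>f. p f \<in> homogeneous_part n d" "\<And>m. polyfun k (\<lambda>f. Poly_Mapping.lookup (p f) m)"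
    and q: "\<And>f. q f \<in> homogeneous_part n e" "\<And>m. polyfun k (\<lambda>f. Poly_Mapping.lookup (q f) m)"
  shows "polyfun k (\<lambda>f. Poly_Mapping.lookup (p f * q f) m)"
proof -
  have "p f * q f = (\<Sum>M\<in>msets n d. \<Sum>N\<in>msets n e. Poly_Mapping.single (monom_of M + monom_of N)
      (Poly_Mapping.lookup (p f) (monom_of M) * Poly_Mapping.lookup (q f) (monom_of N)))" for f
    by (subst homogeneous_part_eq_sum[OF p(1)[of f]], subst homogeneous_part_eq_sum[OF q(1)[of f]])
      (simp add: sum_product mult_single)
  then have "Poly_Mapping.lookup (p f * q f) m = (\<Sum>M\<in>msets n d. \<Sum>N\<in>msets n e.
      (if monom_of M + monom_of N = m then 1 else 0) *
      (Poly_Mapping.lookup (p f) (monom_of M) * Poly_Mapping.lookup (q f) (monom_of N)))" for f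
    unfolding lookup_sum by (simp add: lookup_sum lookup_single when_def)
      (intro sum.cong refl; simp)
  then show ?thesis
    by (simp only:) (intro polyfun_sum polyfun_mult polyfun_const p q)
qed

lemma polyfun_lookup_single:
  "polyfun k c \<Longrightarrow> polyfun k (\<lambda>f. Poly_Mapping.lookup (Poly_Mapping.single m' (c f)) m)"
  using polyfun_mult[OF polyfun_const[of k "if m' = m then 1 else 0"], of c]
  by (cases "m' = m") (simp_all add: lookup_single)

lemma polyfun_coeff_mset: "M \<in> msets n 3 \<Longrightarrow> polyfun n (\<lambda>f. f (monom_of M))"
  by (rule polyfun_coeff) (auto simp: msets_def)

section \<open>Cubics supported on a partial triple system\<close>

definition uncovered :: "nat \<Rightarrow> nat multiset set \<Rightarrow> nat multiset \<Rightarrow> bool"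
  where "uncovered n T P \<longleftrightarrow> P \<in> msets n 2 \<and> (\<forall>v. add_mset v P \<notin> T)"

text \<open>For the cubic that is the sum of the divided power monomials in T, the quadrics annihilating it
  are spanned by the uncovered pairs and by the differences of pairs with the same third vertex. The
  following conditions say that a functional on quartics vanishes on the products of two of them.\<close>

definition kills_square :: "nat \<Rightarrow> nat multiset set \<Rightarrow> (nat multiset \<Rightarrow> 'k::field) \<Rightarrow> bool"
  where "kills_square n T \<phi> \<longleftrightarrow>
    (\<forall>P Q. uncovered n T P \<longrightarrow> uncovered n T Q \<longrightarrow> \<phi> (P + Q) = 0) \<and>
    (\<forall>P Q Q' v. uncovered n T P \<longrightarrow> add_mset v Q \<in> T \<longrightarrow> add_mset v Q' \<in> T \<longrightarrow>
      \<phi> (P + Q) = \<phi> (P + Q')) \<and>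
    (\<forall>P P' Q Q' v w. add_mset v P \<in> T \<longrightarrow> add_mset v P' \<in> T \<longrightarrow> add_mset w Q \<in> T \<longrightarrow>
      add_mset w Q' \<in> T \<longrightarrow> \<phi> (P + Q) + \<phi> (P' + Q') = \<phi> (P + Q') + \<phi> (P' + Q))"

text \<open>The pairs \<open>\<beta> v\<close>, with third vertex v, represent the degree 2 part of
  the apolar algebra, and the monomials \<open>s v\<close> the degree 4 part modulo the square of
  the annihilator. \<open>s_dual\<close> says that the coefficient of \<open>s v\<close> in the
  divided power product of x_i and the cubic is 1 for i = v and 0 otherwise. \<open>s_split\<close>
  writes \<open>s v\<close> times any variable as an annihilating quadric times an annihilating
  cubic, which the passage to degree 5 uses. \<open>quartics\<close> is the combinatorial statement
  to be proved for a given design.\<close>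

locale triple_design =
  fixes n :: nat and T :: "nat multiset set" and \<beta> s :: "nat \<Rightarrow> nat multiset"
    and f0 :: "nat monomial \<Rightarrow> 'k::field"
  assumes n_pos: "0 < n"
    and T_sub: "T \<subseteq> msets n 3"
    and T_unique: "add_mset v P \<in> T \<Longrightarrow> add_mset w P \<in> T \<Longrightarrow> v = w"
    and T_third: "v < n \<Longrightarrow> add_mset v (\<beta> v) \<in> T"
    and s_in: "v < n \<Longrightarrow> s v \<in> msets n 4"
    and s_dual: "i < n \<Longrightarrow> v < n \<Longrightarrow>
      (if i \<in># s v \<and> s v - {#i#} \<in> T then count (s v) i else 0) = (if i = v then 1 else 0)"
    and s_split: "i < n \<Longrightarrow> v < n \<Longrightarrow>
      \<exists>P N. add_mset i (s v) = P + N \<and> uncovered n T P \<and> N \<in> msets n 3 \<and> N \<notin> T"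
    and f0: "f0 (monom_of M) = (if M \<in> T then 1 else 0)"
    and quartics: "\<And>\<phi> :: nat multiset \<Rightarrow> 'k. kills_square n T \<phi> \<Longrightarrow> \<forall>v<n. \<phi> (s v) = 0 \<Longrightarrow>
      \<forall>M\<in>msets n 4. \<phi> M = 0"
begin

lemma covered_in: "add_mset v P \<in> T \<Longrightarrow> P \<in> msets n 2 \<and> v < n"
proof -
  assume "add_mset v P \<in> T"
  then have "add_mset v P \<in> msets n 3" using T_sub by blast
  then show ?thesis by (auto simp: msets_def)
qed

text \<open>The assumptions 1 to 4 say that \<open>\<phi>\<close> vanishes on products of an
  annihilating quadric with an annihilating cubic, the cubics being spanned by non-triples and
  differences of triples. Since x_i times an annihilating quadric is such a cubic, multiplying the
  argument by x_i turns \<open>\<phi>\<close> into a functional that satisfies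
  \<open>kills_square\<close>; its values at the \<open>s v\<close> are zero by
  \<open>s_split\<close>.\<close>

lemma quintics:
  fixes \<phi> :: "nat multiset \<Rightarrow> 'k"
  assumes 1: "\<And>P N. uncovered n T P \<Longrightarrow> N \<in> msets n 3 - T \<Longrightarrow> \<phi> (P + N) = 0"
    and 2: "\<And>P N N'. uncovered n T P \<Longrightarrow> N \<in> T \<Longrightarrow> N' \<in> T \<Longrightarrow> \<phi> (P + N) = \<phi> (P + N')"
    and 3: "\<And>v P P' N. add_mset v P \<in> T \<Longrightarrow> add_mset v P' \<in> T \<Longrightarrow> N \<in> msets n 3 - T \<Longrightarrow>
      \<phi> (P + N) = \<phi> (P' + N)"
    and 4: "\<And>v P P' N N'. add_mset v P \<in> T \<Longrightarrow> add_mset v P' \<in> T \<Longrightarrow> N \<in> T \<Longrightarrow> N' \<in> T \<Longrightarrow>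
      \<phi> (P + N) + \<phi> (P' + N') = \<phi> (P + N') + \<phi> (P' + N)"
    and M: "M \<in> msets n 5"
  shows "\<phi> M = 0"
proof -
  have in3: "add_mset i Q \<in> msets n 3" if "i < n" "Q \<in> msets n 2" for i Q
    using that by (auto simp: msets_def)
  have *: "\<phi> (add_mset i N) = 0" if i: "i < n" and N: "N \<in> msets n 4" for i N
  proof -
    let ?\<psi> = "\<lambda>N. \<phi> (add_mset i N)"
    have move: "?\<psi> (P + Q) = \<phi> (P + add_mset i Q)" for P Q by simp
    have "kills_square n T ?\<psi>"
      unfolding kills_square_def
    proof (intro conjI allI impI)
      fix P Q assume "uncovered n T P" "uncovered n T Q"
      then show "?\<psi> (P + Q) = 0"
        unfolding move by (intro 1) (auto simp: uncovered_def in3 i)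
    next
      fix P Q Q' v assume *: "uncovered n T P" "add_mset v Q \<in> T" "add_mset v Q' \<in> T"
      show "?\<psi> (P + Q) = ?\<psi> (P + Q')"
      \<comment> \<open>By \<open>T_unique\<close> the vertex i completes Q to a triple only if i =
        v. In that case both products are triples and assumption 2 applies; otherwise neither is a
        triple and both sides are zero by assumption 1.\<close>
      proof (cases "i = v")
        case True
        then show ?thesis unfolding move using * by (intro 2) auto
      next
        case False
        then have "add_mset i Q \<in> msets n 3 - T" "add_mset i Q' \<in> msets n 3 - T"
          using * T_unique covered_in in3[OF i] by blast+
        then show ?thesis
          unfolding move using 1[OF *(1), of "add_mset i Q"] 1[OF *(1), of "add_mset i Q'"] by simp
      qed
    next
      fix P P' Q Q' v w
      assume *: "add_mset v P \<in> T" "add_mset v P' \<in> T" "add_mset w Q \<in> T" "add_mset w Q' \<in> T"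
      show "?\<psi> (P + Q) + ?\<psi> (P' + Q') = ?\<psi> (P + Q') + ?\<psi> (P' + Q)"
      proof (cases "i = w")
        case True
        then show ?thesis unfolding move using * by (intro 4) auto
      next
        case False
        then have "add_mset i Q \<in> msets n 3 - T" "add_mset i Q' \<in> msets n 3 - T"
          using * T_unique covered_in in3[OF i] by blast+
        then have "?\<psi> (P + Q) = ?\<psi> (P' + Q)" "?\<psi> (P + Q') = ?\<psi> (P' + Q')"
          unfolding move using 3[OF *(1,2)] by blast+
        then show ?thesis by simp
      qed
    qed
    moreover have "\<forall>v<n. ?\<psi> (s v) = 0"
    proof (intro allI impI)
      fix v assume "v < n"
      then obtain P N where "add_mset i (s v) = P + N" "uncovered n T P" "N \<in> msets n 3" "N \<notin> T"
        using s_split[OF i] by blast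
      then show "?\<psi> (s v) = 0" using 1 by simp
    qed
    ultimately show ?thesis using quartics N by blast
  qed
  have "M \<noteq> {#}" using M by (auto simp: msets_def)
  then obtain i N where "M = add_mset i N" by (metis multiset_cases)
  then show ?thesis using M * by (auto simp: msets_def)
qed

section \<open>Elements of the annihilator with coefficients polynomial in f\<close>

definition catalecticant :: "(nat monomial \<Rightarrow> 'k) \<Rightarrow> nat \<Rightarrow> nat \<Rightarrow> 'k"
  where "catalecticant f v w = f (monom_of (add_mset w (\<beta> v)))"

text \<open>Cramer's rule: the monomial P is reduced to the pairs \<open>\<beta> v\<close>, after
  multiplication by the determinant \<open>d\<close> so that no denominators occur. With
  \<open>B\<close> the adjugate of the matrix \<open>catalecticant f\<close> the result annihilates
  f.\<close>

definition quadric :: "'k \<Rightarrow> (nat \<Rightarrow> nat \<Rightarrow> 'k) \<Rightarrow> (nat monomial \<Rightarrow> 'k) \<Rightarrow> nat multiset \<Rightarrow> (nat, 'k) mpoly"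
  where "quadric d B f P = Poly_Mapping.single (monom_of P) d -
    (\<Sum>v<n. Poly_Mapping.single (monom_of (\<beta> v)) (\<Sum>w<n. f (monom_of (add_mset w P)) * B w v))"

definition base_triple :: "nat multiset"
  where "base_triple = add_mset 0 (\<beta> 0)"

text \<open>In degree 3 the annihilator is the hyperplane orthogonal to f; its elements are obtained
  by cross multiplication with the coefficient at one fixed triple, which is 1 at the base
  cubic.\<close>

definition cubic :: "(nat monomial \<Rightarrow> 'k) \<Rightarrow> nat multiset \<Rightarrow> (nat, 'k) mpoly"
  where "cubic f N = Poly_Mapping.single (monom_of N) (f (monom_of base_triple)) -
    Poly_Mapping.single (monom_of base_triple) (f (monom_of N))"

lemma \<beta>_in: "v < n \<Longrightarrow> \<beta> v \<in> msets n 2"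
  using T_third covered_in by blast

lemma in_msets_3: "w < n \<Longrightarrow> P \<in> msets n 2 \<Longrightarrow> add_mset w P \<in> msets n 3"
  by (auto simp: msets_def)

lemma base_triple_in: "base_triple \<in> T" "base_triple \<in> msets n 3"
  using T_third[OF n_pos] T_sub by (auto simp: base_triple_def)

lemma quadric_homogeneous: "P \<in> msets n 2 \<Longrightarrow> quadric d B f P \<in> homogeneous_part n 2"
  unfolding quadric_def
  by (intro homogeneous_part_diff homogeneous_part_sum single_homogeneous \<beta>_in) auto

lemma cubic_homogeneous: "N \<in> msets n 3 \<Longrightarrow> cubic f N \<in> homogeneous_part n 3"
  unfolding cubic_def by (intro homogeneous_part_diff single_homogeneous base_triple_in) auto

lemma polyfun_lookup_quadric:
  assumes "polyfun n d" "\<And>i j. i < n \<Longrightarrow> j < n \<Longrightarrow> polyfun n (\<lambda>f. B f i j)" "P \<in> msets n 2"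
  shows "polyfun n (\<lambda>f. Poly_Mapping.lookup (quadric (d f) (B f) f P) m)"
proof -
  have "polyfun n (\<lambda>f. \<Sum>w<n. f (monom_of (add_mset w P)) * B f w v)" if "v < n" for v
    by (intro polyfun_sum polyfun_mult[OF polyfun_coeff_mset[OF in_msets_3[OF _ assms(3)]] assms(2)] that)
      auto
  then show ?thesis
    unfolding quadric_def lookup_minus lookup_sum
    by (intro polyfun_diff[OF polyfun_lookup_single[OF assms(1)] polyfun_sum[OF polyfun_lookup_single]]) auto
qed

lemma polyfun_lookup_cubic:
  "N \<in> msets n 3 \<Longrightarrow> polyfun n (\<lambda>f. Poly_Mapping.lookup (cubic f N) m)"
  unfolding cubic_def lookup_minus
  by (intro polyfun_diff polyfun_lookup_single polyfun_coeff_mset base_triple_in) auto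

text \<open>With \<open>B\<close> the identity the corrections are the values of \<open>f0\<close>
  themselves; by \<open>T_unique\<close> at most the third vertex of P contributes to the
  sum.\<close>

lemma quadric_f0:
  assumes B: "\<And>i j. i < n \<Longrightarrow> j < n \<Longrightarrow> B i j = (if i = j then 1 else 0)"
  shows "uncovered n T P \<Longrightarrow> quadric 1 B f0 P = Poly_Mapping.single (monom_of P) 1"
    and "add_mset v P \<in> T \<Longrightarrow>
      quadric 1 B f0 P = Poly_Mapping.single (monom_of P) 1 - Poly_Mapping.single (monom_of (\<beta> v)) 1"
proof -
  have *: "(\<Sum>w<n. f0 (monom_of (add_mset w P)) * B w v) = (if add_mset v P \<in> T then 1 else 0)"
    if "v < n" for v
  proof -
    have "(\<Sum>w<n. f0 (monom_of (add_mset w P)) * B w v) =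
        (\<Sum>w<n. if w = v then (if add_mset v P \<in> T then 1 else 0) else 0)"
      using that by (intro sum.cong) (auto simp: B f0)
    then show ?thesis using that by simp
  qed
  have **: "quadric 1 B f0 P = Poly_Mapping.single (monom_of P) 1 -
      (\<Sum>v<n. if add_mset v P \<in> T then Poly_Mapping.single (monom_of (\<beta> v)) 1 else 0)"
    unfolding quadric_def by (intro arg_cong2[of _ _ _ _ minus] sum.cong refl) (auto simp: *)
  show "quadric 1 B f0 P = Poly_Mapping.single (monom_of P) 1" if "uncovered n T P"
    using that by (simp add: ** uncovered_def)
  show "quadric 1 B f0 P = Poly_Mapping.single (monom_of P) 1 - Poly_Mapping.single (monom_of (\<beta> v)) 1"
    if v: "add_mset v P \<in> T"
  proof -
    have "(\<Sum>u<n. if add_mset u P \<in> T then Poly_Mapping.single (monom_of (\<beta> u)) 1 else 0) =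
        (\<Sum>u<n. if u = v then Poly_Mapping.single (monom_of (\<beta> v)) (1::'k) else 0)"
    proof (intro sum.cong refl)
      fix u
      have "add_mset u P \<in> T \<longleftrightarrow> u = v" using T_unique v by blast
      then show "(if add_mset u P \<in> T then Poly_Mapping.single (monom_of (\<beta> u)) 1 else 0) =
          (if u = v then Poly_Mapping.single (monom_of (\<beta> v)) (1::'k) else 0)" by simp
    qed
    then show ?thesis using covered_in[OF v] by (simp add: **)
  qed
qed

lemma cubic_f0:
  "cubic f0 N = (if N \<in> T then Poly_Mapping.single (monom_of N) 1 - Poly_Mapping.single (monom_of base_triple) 1
    else Poly_Mapping.single (monom_of N) 1)"
  by (simp add: cubic_def f0 base_triple_in)

lemma sum_msets_eq_pairing:
  assumes "p \<in> homogeneous_part n d"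
  shows "(\<Sum>M\<in>msets n d. \<phi> M * Poly_Mapping.lookup p (monom_of M)) =
    pairing (\<lambda>m. \<phi> (the_inv monom_of m)) p"
proof -
  have "the_inv monom_of (monom_of M) = M" for M
    by (rule the_inv_f_f) (simp add: inj_def)
  then show ?thesis
    by (simp add: pairing_homogeneous[OF assms] mult.commute)
qed

lemma quartics_span_f0:
  fixes \<phi> :: "nat multiset \<Rightarrow> 'k"
  assumes B: "\<And>i j. i < n \<Longrightarrow> j < n \<Longrightarrow> B i j = (if i = j then 1 else 0)"
    and q: "\<And>P Q. P \<in> msets n 2 \<Longrightarrow> Q \<in> msets n 2 \<Longrightarrow>
      (\<Sum>M\<in>msets n 4. \<phi> M * Poly_Mapping.lookup (quadric 1 B f0 P * quadric 1 B f0 Q) (monom_of M)) = 0"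
    and s: "\<And>v. v < n \<Longrightarrow> \<phi> (s v) = 0"
  shows "\<forall>M\<in>msets n 4. \<phi> M = 0"
proof -
  let ?w = "\<lambda>m. \<phi> (the_inv monom_of m)"
  have w: "?w (monom_of M + monom_of N) = \<phi> (M + N)" for M N
    using the_inv_f_f[of monom_of "M + N"] by (simp add: inj_def monom_of_add)
  have qq: "pairing ?w (quadric 1 B f0 P * quadric 1 B f0 Q) = 0"
    if "P \<in> msets n 2" "Q \<in> msets n 2" for P Q
    using sum_msets_eq_pairing[OF homogeneous_part_mult[OF quadric_homogeneous quadric_homogeneous], OF that, of \<phi>]
      q[OF that] by simp
  note simps = mult_single pairing_diff pairing_add left_diff_distrib right_diff_distrib w
  have un: "P \<in> msets n 2" if "uncovered n T P" for P using that by (simp add: uncovered_def)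
  have UU: "\<phi> (P + Q) = 0" if "uncovered n T P" "uncovered n T Q" for P Q
    using qq[OF un un, OF that] by (simp add: quadric_f0[OF B] that simps)
  have UC: "\<phi> (P + Q) = \<phi> (P + \<beta> v)" if "uncovered n T P" "add_mset v Q \<in> T" for P Q v
    using qq[OF un[OF that(1)], of Q] covered_in[OF that(2)]
    by (simp add: quadric_f0(1)[OF B that(1)] quadric_f0(2)[OF B that(2)] simps)
  have CC: "\<phi> (P + Q) - \<phi> (P + \<beta> w) - \<phi> (\<beta> v + Q) + \<phi> (\<beta> v + \<beta> w) = 0"
    if "add_mset v P \<in> T" "add_mset w Q \<in> T" for P Q v w
    using qq[of P Q] covered_in[OF that(1)] covered_in[OF that(2)]
    by (simp add: quadric_f0(2)[OF B that(1)] quadric_f0(2)[OF B that(2)] simps algebra_simps)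
  \<comment> \<open>The quadrics at \<open>f0\<close> compare a pair only with its representative.
    In the alternating sum of the relations \<open>CC\<close> for the four products of P, P' with Q,
    Q', all terms that contain a representative cancel.\<close>
  have alg: "a + a' = b + b'" if "a - c - e + d = 0" "a' - c' - e' + d = 0" "b - c - e' + d = 0"
    "b' - c' - e + d = 0" for a a' b b' c c' d e e' :: 'k
  proof -
    have "a + a' - (b + b') = (a - c - e + d) + (a' - c' - e' + d) - (b - c - e' + d) - (b' - c' - e + d)"
      by (simp add: algebra_simps)
    then show ?thesis using that by simp
  qed
  have "kills_square n T \<phi>"
    unfolding kills_square_def
  proof (intro conjI allI impI)
    fix P P' Q Q' v w
    assume a: "add_mset v P \<in> T" "add_mset v P' \<in> T" "add_mset w Q \<in> T" "add_mset w Q' \<in> T"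
    show "\<phi> (P + Q) + \<phi> (P' + Q') = \<phi> (P + Q') + \<phi> (P' + Q)"
      by (rule alg[OF CC[OF a(1,3)] CC[OF a(2,4)] CC[OF a(1,4)] CC[OF a(2,3)]])
  next
    fix P Q Q' v assume "uncovered n T P" "add_mset v Q \<in> T" "add_mset v Q' \<in> T"
    then show "\<phi> (P + Q) = \<phi> (P + Q')" using UC[of P v Q] UC[of P v Q'] by simp
  qed (rule UU)
  then show ?thesis using quartics s by blast
qed

lemma quintics_span_f0:
  fixes \<phi> :: "nat multiset \<Rightarrow> 'k"
  assumes B: "\<And>i j. i < n \<Longrightarrow> j < n \<Longrightarrow> B i j = (if i = j then 1 else 0)"
    and q: "\<And>P N. P \<in> msets n 2 \<Longrightarrow> N \<in> msets n 3 \<Longrightarrow>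
      (\<Sum>M\<in>msets n 5. \<phi> M * Poly_Mapping.lookup (quadric 1 B f0 P * cubic f0 N) (monom_of M)) = 0"
  shows "\<forall>M\<in>msets n 5. \<phi> M = 0"
proof
  fix M assume M: "M \<in> msets n 5"
  let ?w = "\<lambda>m. \<phi> (the_inv monom_of m)"
  have w: "?w (monom_of M + monom_of N) = \<phi> (M + N)" for M N
    using the_inv_f_f[of monom_of "M + N"] by (simp add: inj_def monom_of_add)
  have qq: "pairing ?w (quadric 1 B f0 P * cubic f0 N) = 0"
    if "P \<in> msets n 2" "N \<in> msets n 3" for P N
    using sum_msets_eq_pairing[OF homogeneous_part_mult[OF quadric_homogeneous cubic_homogeneous], OF that, of \<phi>]
      q[OF that] by simp
  note simps = mult_single pairing_diff pairing_add left_diff_distrib right_diff_distrib w cubic_f0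
  have un: "P \<in> msets n 2" if "uncovered n T P" for P using that by (simp add: uncovered_def)
  have U: "\<phi> (P + N) = (if N \<in> T then \<phi> (P + base_triple) else 0)"
    if "uncovered n T P" "N \<in> msets n 3" for P N
    using qq[OF un, OF that] by (simp add: quadric_f0[OF B] that simps split: if_splits)
  have C: "\<phi> (P + N) - \<phi> (\<beta> v + N) = (if N \<in> T then \<phi> (P + base_triple) - \<phi> (\<beta> v + base_triple) else 0)"
    if "add_mset v P \<in> T" "N \<in> msets n 3" for P N v
    using qq[of P N] that(2) covered_in[OF that(1)]
    by (auto simp: quadric_f0(2)[OF B that(1)] simps algebra_simps split: if_splits)
  show "\<phi> M = 0"
  proof (rule quintics[OF _ _ _ _ M])
    fix v P P' N assume a: "add_mset v P \<in> T" "add_mset v P' \<in> T" "N \<in> msets n 3 - T"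
    then show "\<phi> (P + N) = \<phi> (P' + N)"
      using C[OF a(1), of N] C[OF a(2), of N] by simp
  next
    fix v P P' N N' assume a: "add_mset v P \<in> T" "add_mset v P' \<in> T" "N \<in> T" "N' \<in> T"
    then have "N \<in> msets n 3" "N' \<in> msets n 3" using T_sub by auto
    then have "\<phi> (P + N) - \<phi> (\<beta> v + N) = \<phi> (P + base_triple) - \<phi> (\<beta> v + base_triple)"
      "\<phi> (P + N') - \<phi> (\<beta> v + N') = \<phi> (P + base_triple) - \<phi> (\<beta> v + base_triple)"
      "\<phi> (P' + N) - \<phi> (\<beta> v + N) = \<phi> (P' + base_triple) - \<phi> (\<beta> v + base_triple)"
      "\<phi> (P' + N') - \<phi> (\<beta> v + N') = \<phi> (P' + base_triple) - \<phi> (\<beta> v + base_triple)"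
      using C a by auto
    then show "\<phi> (P + N) + \<phi> (P' + N') = \<phi> (P + N') + \<phi> (P' + N)"
      by (simp add: diff_eq_eq)
  next
    fix P N N' assume a: "uncovered n T P" "N \<in> T" "N' \<in> T"
    then have "N \<in> msets n 3" "N' \<in> msets n 3" using T_sub by auto
    then show "\<phi> (P + N) = \<phi> (P + N')" using U a by simp
  qed (use U in auto)
qed

end

lemma pairing_one [simp]: "pairing w 1 = w 0"
  using pairing_single[of w 0 1] by simp

lemma lookup_const_mult: "Poly_Mapping.lookup (Poly_Mapping.single 0 a * p) m = a * Poly_Mapping.lookup p m"
  for p :: "('v, 'k::field) mpoly"
  by (induction p rule: mpoly_induct)
    (simp_all add: distrib_left lookup_add mult_single lookup_single when_def)

section \<open>The open set of good cubics and the Hilbert functions on it\<close>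

context triple_design
begin

text \<open>The pairings of the functionals dual to x_i f with the monomials \<open>s v\<close>.
  Where this matrix is invertible, the n functionals are independent already on the span of these
  monomials.\<close>

definition dual_matrix :: "(nat monomial \<Rightarrow> 'k) \<Rightarrow> nat \<Rightarrow> nat \<Rightarrow> 'k"
  where "dual_matrix f i v = prolongation f i (monom_of (s v))"

lemma dual_matrix_eq:
  "dual_matrix f i v = (if i \<in># s v then of_nat (count (s v) i) * f (monom_of (s v - {#i#})) else 0)"
proof -
  have "monom_of (s v) - Poly_Mapping.single i 1 = monom_of (s v - {#i#})" if "i \<in># s v"
    using that by (auto simp: poly_mapping_eq_iff fun_eq_iff lookup_minus lookup_single when_def)
  then show ?thesis
    by (auto simp: dual_matrix_def prolongation_def not_in_iff)
qed

lemma polyfun_dual_matrix: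
  assumes "v < n" shows "polyfun n (\<lambda>f. dual_matrix f i v)"
proof (cases "i \<in># s v")
  case True
  then have "s v - {#i#} \<in> msets n 3"
    using s_in[OF assms] by (auto simp: msets_def size_Diff_singleton dest: in_diffD)
  then show ?thesis
    using True by (simp add: dual_matrix_eq polyfun_mult polyfun_coeff_mset)
qed (simp add: dual_matrix_eq)

lemma dual_matrix_f0:
  assumes "i < n" "v < n" shows "dual_matrix f0 i v = (if i = v then 1 else 0)"
proof -
  have "dual_matrix f0 i v = of_nat (if i \<in># s v \<and> s v - {#i#} \<in> T then count (s v) i else 0)"
    by (simp add: dual_matrix_eq f0)
  then show ?thesis unfolding s_dual[OF assms] by simp
qed

lemma catalecticant_f0:
  assumes "v < n" "w < n" shows "catalecticant f0 v w = (if v = w then 1 else 0)"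
  using T_unique[of w "\<beta> v" v] T_third[OF assms(1)] by (auto simp: catalecticant_def f0)

lemma inverse_at_f0:
  assumes "\<And>i j. i < n \<Longrightarrow> j < n \<Longrightarrow> A i j = (if i = j then 1 else (0::'k))"
    and "\<And>i j. i < n \<Longrightarrow> j < n \<Longrightarrow> (\<Sum>k<n. A i k * B k j) = (if i = j then 1 else 0)"
    and "i < n" "j < n"
  shows "B i j = (if i = j then 1 else 0)"
proof -
  have "(\<Sum>k<n. A i k * B k j) = (\<Sum>k<n. if k = i then B i j else 0)"
    using assms(1,3) by (intro sum.cong) auto
  then show ?thesis using assms(2)[OF assms(3,4)] assms(3) by simp
qed

text \<open>Contracting by the quadric and reading the coefficient at x_w gives a double sum in
  which \<open>B\<close> times the catalecticant matrix collapses to d times the identity.\<close>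

lemma quadric_in_Ann:
  assumes F: "F \<in> homogeneous_part n 3" "f = Poly_Mapping.lookup F" and P: "P \<in> msets n 2"
    and B: "\<And>i j. i < n \<Longrightarrow> j < n \<Longrightarrow> (\<Sum>k<n. B i k * catalecticant f k j) = (if i = j then d else 0)"
  shows "quadric d B f P \<in> Ann n F"
  unfolding Ann_homogeneous[OF F(1) quadric_homogeneous[OF P]]
proof (intro allI impI)
  fix C assume C: "2 + size C = 3" "set_mset C \<subseteq> {..<n}"
  then have "size C = 1" by simp
  then obtain w where w: "C = {#w#}" by (metis size_1_singleton_mset)
  have wn: "w < n" using C w by simp
  have m: "monom_of Q + monom_of C = monom_of (add_mset w Q)" for Q
    by (simp add: w flip: monom_of_add)
  have "pairing (\<lambda>b. f (b + monom_of C)) (quadric d B f P) = d * f (monom_of (add_mset w P)) -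
      (\<Sum>v<n. (\<Sum>u<n. f (monom_of (add_mset u P)) * B u v) * catalecticant f v w)"
    by (simp add: quadric_def pairing_diff pairing_sum m catalecticant_def)
  also have "(\<Sum>v<n. (\<Sum>u<n. f (monom_of (add_mset u P)) * B u v) * catalecticant f v w) =
      (\<Sum>u<n. f (monom_of (add_mset u P)) * (\<Sum>v<n. B u v * catalecticant f v w))"
    unfolding sum_distrib_right sum_distrib_left by (subst sum.swap) (simp add: mult.assoc)
  also have "\<dots> = (\<Sum>u<n. if u = w then f (monom_of (add_mset w P)) * d else 0)"
    using wn by (intro sum.cong) (auto simp: B)
  also have "\<dots> = d * f (monom_of (add_mset w P))" using wn by simp
  finally show "pairing (\<lambda>b. Poly_Mapping.lookup F (b + monom_of C)) (quadric d B f P) = 0"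
    using F(2) by simp
qed

lemma cubic_in_Ann:
  assumes F: "F \<in> homogeneous_part n 3" "f = Poly_Mapping.lookup F" and N: "N \<in> msets n 3"
  shows "cubic f N \<in> Ann n F"
  unfolding Ann_homogeneous[OF F(1) cubic_homogeneous[OF N]]
  by (auto simp: cubic_def pairing_diff F(2))

text \<open>Degrees 1 and 2 are governed by the same invertible matrix: no linear form annihilates
  F, and the n contractions of quadrics to coefficients at the variables are independent on the
  pairs \<open>\<beta> v\<close>. Degrees 0 and 3 use one non-zero coefficient of f, at the base
  triple.\<close>

lemma Ann_Hilbert_function:
  assumes F: "F \<in> homogeneous_part n 3" "f = Poly_Mapping.lookup F"
    and d: "d \<noteq> 0" and t: "f (monom_of base_triple) \<noteq> 0"
    and AB: "\<And>i j. i < n \<Longrightarrow> j < n \<Longrightarrow> (\<Sum>k<n. catalecticant f i k * B k j) = (if i = j then d else 0)"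
    and BA: "\<And>i j. i < n \<Longrightarrow> j < n \<Longrightarrow> (\<Sum>k<n. B i k * catalecticant f k j) = (if i = j then d else 0)"
  shows "1 \<notin> Ann n F" "quotient_has_hilbert_function n (Ann n F) [1, n, n, 1]"
proof -
  have one: "Poly_Mapping.single (monom_of {#}) 1 \<in> homogeneous_part n 0"
    by (intro single_homogeneous) (simp add: msets_def)
  have bt: "size base_triple = 3" "set_mset base_triple \<subseteq> {..<n}"
    using base_triple_in(2) by (auto simp: msets_def)
  have "pairing (\<lambda>b. Poly_Mapping.lookup F (b + monom_of base_triple)) (Poly_Mapping.single (monom_of {#}) 1) \<noteq> 0"
    using t F(2) by simp
  then have "Poly_Mapping.single (monom_of {#}) 1 \<notin> Ann n F"
    using bt by (subst Ann_homogeneous[OF F(1) one]) auto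
  then show 1: "1 \<notin> Ann n F" by simp
  note HQ = hilbert_quotientI[OF ideal_Ann 1]
  have "hilbert_quotient n (Ann n F) 0 = 1"
  proof (rule HQ[where w = "\<lambda>j m. 1"])
    fix p :: "(nat, 'k) mpoly" assume p: "p \<in> homogeneous_part n 0"
    have "msets n 0 = {{#}}" by (auto simp: msets_def)
    then have "p = Poly_Mapping.single 0 (Poly_Mapping.lookup p 0)"
      using homogeneous_part_eq_sum[OF p] by simp
    then obtain a where a: "p = Poly_Mapping.single 0 a" by blast
    have "p \<in> Ann n F \<longleftrightarrow> a = 0"
    proof
      assume "p \<in> Ann n F"
      then have "pairing (\<lambda>b. Poly_Mapping.lookup F (b + monom_of base_triple)) p = 0"
        by (simp add: Ann_iff)
      then show "a = 0" using t F(2) by (simp add: a)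
    next
      assume "a = 0" then show "p \<in> Ann n F" by (simp add: a Ann_iff poly_ring_carrier_iff)
    qed
    then show "p \<in> Ann n F \<longleftrightarrow> (\<forall>j<1::nat. pairing (\<lambda>m. 1) p = 0)" by (simp add: a)
  next
    show "\<exists>p\<in>homogeneous_part n 0. \<forall>k<1::nat. pairing (\<lambda>m. 1) p = (if k = j then 1 else (0::'k))" if "j < 1" for j :: nat
      using that one by (intro bexI[of _ "Poly_Mapping.single (monom_of {#}) 1"]) auto
  qed
  moreover have "hilbert_quotient n (Ann n F) 1 = n"
  proof (rule HQ[where w = "\<lambda>j m. if m = monom_of {#j#} then 1 else 0"])
    have ms1: "msets n 1 = (\<lambda>j. {#j#}) ` {..<n}"
    proof (intro equalityI subsetI)
      fix M assume M: "M \<in> msets n 1"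
      then obtain j where "M = {#j#}" using size_1_singleton_mset[of M] unfolding msets_def by blast
      then show "M \<in> (\<lambda>j. {#j#}) ` {..<n}" using M by (simp add: msets_def)
    qed (auto simp: msets_def)
    fix p :: "(nat, 'k) mpoly" assume p: "p \<in> homogeneous_part n 1"
    have pair: "pairing w p = (\<Sum>v<n. Poly_Mapping.lookup p (monom_of {#v#}) * w (monom_of {#v#}))" for w
      unfolding pairing_homogeneous[OF p] ms1 by (simp add: sum.reindex inj_on_def)
    have coord: "pairing (\<lambda>m. if m = monom_of {#j#} then 1 else 0) p = Poly_Mapping.lookup p (monom_of {#j#})"
      if "j < n" for j
    proof -
      have "pairing (\<lambda>m. if m = monom_of {#j#} then 1 else 0) p =
          (\<Sum>v<n. if v = j then Poly_Mapping.lookup p (monom_of {#j#}) else 0)"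
        unfolding pair by (intro sum.cong) auto
      then show ?thesis using that by simp
    qed
    show "p \<in> Ann n F \<longleftrightarrow> (\<forall>j<n. pairing (\<lambda>m. if m = monom_of {#j#} then 1 else 0) p = 0)"
    proof
      assume A: "p \<in> Ann n F"
      have "Poly_Mapping.lookup p (monom_of {#j#}) = 0" if j: "j < n" for j
      proof -
        let ?p = "\<lambda>v. Poly_Mapping.lookup p (monom_of {#v#})"
        have z: "(\<Sum>v<n. ?p v * catalecticant f w v) = 0" if "w < n" for w
        proof -
          have "pairing (\<lambda>b. Poly_Mapping.lookup F (b + monom_of (\<beta> w))) p = 0"
            using A by (simp add: Ann_iff)
          then show ?thesis
            by (simp add: pair catalecticant_def F(2) flip: monom_of_add)
        qed
        \<comment> \<open>The catalecticant matrix kills the coefficient vector of p; multiplying by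
          the adjugate from the left leaves d times that vector.\<close>
        have "d * ?p j = (\<Sum>v<n. if v = j then ?p j * d else 0)" using j by simp
        also have "\<dots> = (\<Sum>v<n. ?p v * (\<Sum>w<n. B j w * catalecticant f w v))"
          using j by (intro sum.cong) (auto simp: BA)
        also have "\<dots> = (\<Sum>w<n. B j w * (\<Sum>v<n. ?p v * catalecticant f w v))"
          unfolding sum_distrib_left by (subst sum.swap) (simp add: algebra_simps)
        also have "\<dots> = 0" by (simp add: z)
        finally show ?thesis using d by simp
      qed
      then show "\<forall>j<n. pairing (\<lambda>m. if m = monom_of {#j#} then 1 else 0) p = 0" using coord by simp
    next
      assume "\<forall>j<n. pairing (\<lambda>m. if m = monom_of {#j#} then 1 else 0) p = 0"
      then have z: "Poly_Mapping.lookup p (monom_of {#j#}) = 0" if "j < n" for j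
        using coord[OF that] that by simp
      have "p = 0"
      proof (rule homogeneous_part_eqI[OF p homogeneous_part_zero])
        fix M assume "M \<in> msets n 1"
        then obtain j where "M = {#j#}" "j < n" unfolding ms1 by blast
        then show "Poly_Mapping.lookup p (monom_of M) = Poly_Mapping.lookup 0 (monom_of M)"
          using z by simp
      qed
      then show "p \<in> Ann n F" by (simp add: Ann_iff poly_ring_carrier_iff)
    qed
  next
    show "\<exists>p\<in>homogeneous_part n 1. \<forall>k<n. pairing (\<lambda>m. if m = monom_of {#k#} then 1 else 0) p =
        (if k = j then 1 else (0::'k))" if "j < n" for j
      using that by (intro bexI[of _ "Poly_Mapping.single (monom_of {#j#}) 1"] single_homogeneous)
        (auto simp: msets_def)
  qed
  moreover have "hilbert_quotient n (Ann n F) 2 = n"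
  proof (rule HQ[where w = "\<lambda>j m. f (m + monom_of {#j#})"])
    fix p :: "(nat, 'k) mpoly" assume p: "p \<in> homogeneous_part n 2"
    show "p \<in> Ann n F \<longleftrightarrow> (\<forall>j<n. pairing (\<lambda>m. f (m + monom_of {#j#})) p = 0)"
      unfolding Ann_homogeneous[OF F(1) p] F(2)
    proof (intro iffI allI impI)
      fix j assume "\<forall>C. 2 + size C = 3 \<longrightarrow> set_mset C \<subseteq> {..<n} \<longrightarrow>
        pairing (\<lambda>b. Poly_Mapping.lookup F (b + monom_of C)) p = 0" "j < n"
      then show "pairing (\<lambda>m. Poly_Mapping.lookup F (m + monom_of {#j#})) p = 0" by simp
    next
      fix C assume a: "\<forall>j<n. pairing (\<lambda>m. Poly_Mapping.lookup F (m + monom_of {#j#})) p = 0"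
        "2 + size C = 3" "set_mset C \<subseteq> {..<n}"
      then have "size C = 1" by simp
      then obtain w where "C = {#w#}" using size_1_singleton_mset by blast
      then show "pairing (\<lambda>b. Poly_Mapping.lookup F (b + monom_of C)) p = 0" using a by simp
    qed
  next
    fix j assume j: "j < n"
    \<comment> \<open>Row j of the inverse matrix \<open>B / d\<close>, taken as coefficients on the
      pairs \<open>\<beta> v\<close>.\<close>
    let ?p = "\<Sum>v<n. Poly_Mapping.single (monom_of (\<beta> v)) (B j v / d)"
    have "pairing (\<lambda>m. f (m + monom_of {#k#})) ?p = (if k = j then 1 else 0)" if "k < n" for k
    proof -
      have "pairing (\<lambda>m. f (m + monom_of {#k#})) ?p = (\<Sum>v<n. B j v * catalecticant f v k) / d"
        by (simp add: pairing_sum catalecticant_def sum_divide_distrib flip: monom_of_add)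
      then show ?thesis using BA[OF j that] d by simp
    qed
    moreover have "?p \<in> homogeneous_part n 2"
      by (intro homogeneous_part_sum single_homogeneous \<beta>_in) auto
    ultimately show "\<exists>p\<in>homogeneous_part n 2. \<forall>k<n. pairing (\<lambda>m. f (m + monom_of {#k#})) p = (if k = j then 1 else 0)"
      by blast
  qed
  moreover have "hilbert_quotient n (Ann n F) 3 = 1"
  proof (rule HQ[where w = "\<lambda>j. f"])
    fix p :: "(nat, 'k) mpoly" assume p: "p \<in> homogeneous_part n 3"
    show "p \<in> Ann n F \<longleftrightarrow> (\<forall>j<1::nat. pairing f p = 0)"
      unfolding Ann_homogeneous[OF F(1) p] F(2) by auto
  next
    show "\<exists>p\<in>homogeneous_part n 3. \<forall>k<1::nat. pairing f p = (if k = j then 1 else 0)" if "j < 1" for j :: nat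
      using that t base_triple_in(2)
      by (intro bexI[of _ "Poly_Mapping.single (monom_of base_triple) (1 / f (monom_of base_triple))"]
          single_homogeneous) auto
  qed
  \<comment> \<open>Here r = 0: all forms of degree at least 4 annihilate F, because
    \<open>i + size C = 3\<close> has no solution.\<close>
  moreover have "hilbert_quotient n (Ann n F) i = 0" if "i \<ge> 4" for i
    using that by (intro HQ) (auto simp: Ann_homogeneous[OF F(1)])
  ultimately show "quotient_has_hilbert_function n (Ann n F) [1, n, n, 1]"
    unfolding quotient_has_hilbert_function_def
    by (auto simp: less_Suc_eq nth_Cons' numeral_eq_Suc)
qed

theorem for_general_cubic_small_tangent_space:
  "for_general_cubic n (small_tangent_space n :: (nat, 'k) mpoly \<Rightarrow> bool)"
proof -
  have "polyfun n (\<lambda>f. catalecticant f i j)" if "i < n" "j < n" for i j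
    unfolding catalecticant_def using that by (intro polyfun_coeff_mset in_msets_3 \<beta>_in)
  from polyfun_adjugate[where A = catalecticant and ?f0.0 = f0, OF this catalecticant_f0]
  obtain d B where dB: "polyfun n d" "d f0 = 1" "\<forall>i<n. \<forall>j<n. polyfun n (\<lambda>f. B f i j)"
    "\<forall>f. \<forall>i<n. \<forall>j<n. (\<Sum>k<n. catalecticant f i k * B f k j) = (if i = j then d f else 0)"
    "\<forall>f. \<forall>i<n. \<forall>j<n. (\<Sum>k<n. B f i k * catalecticant f k j) = (if i = j then d f else 0)"
    by blast
  have B0: "B f0 i j = (if i = j then 1 else 0)" if "i < n" "j < n" for i j
    using inverse_at_f0[of "catalecticant f0" "B f0", OF catalecticant_f0 _ that] dB(2,4) by simp
  from polyfun_adjugate[where A = dual_matrix and ?f0.0 = f0, OF polyfun_dual_matrix dual_matrix_f0]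
  obtain e E where eE: "polyfun n e" "e f0 = 1"
    "\<forall>f. \<forall>i<n. \<forall>j<n. (\<Sum>k<n. dual_matrix f i k * E f k j) = (if i = j then e f else 0)"
    "\<forall>f. \<forall>i<n. \<forall>j<n. (\<Sum>k<n. E f i k * dual_matrix f k j) = (if i = j then e f else 0)"
    by blast
  define q where "q = (\<lambda>f. quadric (d f) (B f) f)"
  have qhom: "q f P \<in> homogeneous_part n 2" if "P \<in> msets n 2" for f P
    unfolding q_def by (rule quadric_homogeneous[OF that])
  have q_poly: "polyfun n (\<lambda>f. Poly_Mapping.lookup (q f P) m)" if "P \<in> msets n 2" for P m
    unfolding q_def by (intro polyfun_lookup_quadric dB(1) that) (use dB(3) in auto)
  have q0: "q f0 = quadric 1 (B f0) f0" by (simp add: q_def dB(2))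
  \<comment> \<open>\<open>Inl\<close> indexes the products of two annihilating quadrics,
    \<open>Inr\<close> the n complementary monomials \<open>s v\<close>.\<close>
  define a4 where "a4 = (\<lambda>f i M. case i of
      Inl (P, Q) \<Rightarrow> Poly_Mapping.lookup (q f P * q f Q) (monom_of M)
    | Inr v \<Rightarrow> if M = s v then 1 else 0)"
  let ?I4 = "(msets n 2 \<times> msets n 2) <+> {..<n}"
  obtain g4 where g4: "polyfun n g4" "g4 f0 \<noteq> 0"
    "\<And>f v. g4 f \<noteq> 0 \<Longrightarrow> \<exists>c. \<forall>M\<in>msets n 4. v M = (\<Sum>i\<in>?I4. c i * a4 f i M)"
  proof (rule spanning_is_open[where I = ?I4 and R = "msets n 4" and a = a4 and ?f0.0 = f0])
    fix i M assume "i \<in> ?I4"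
    then show "polyfun n (\<lambda>f. a4 f i M)"
      unfolding a4_def
      by (auto intro!: polyfun_lookup_mult[where n = n and d = 2 and e = 2] qhom q_poly)
  next
    fix \<phi> :: "nat multiset \<Rightarrow> 'k"
    assume \<phi>: "\<forall>i\<in>?I4. (\<Sum>M\<in>msets n 4. \<phi> M * a4 f0 i M) = 0"
    show "\<forall>M\<in>msets n 4. \<phi> M = 0"
    proof (rule quartics_span_f0[OF B0])
      fix P Q assume "P \<in> msets n 2" "Q \<in> msets n 2"
      then have "Inl (P, Q) \<in> ?I4" by blast
      from bspec[OF \<phi> this] show "(\<Sum>M\<in>msets n 4. \<phi> M * Poly_Mapping.lookup (quadric 1 (B f0) f0 P * quadric 1 (B f0) f0 Q)
          (monom_of M)) = 0"
        by (simp add: a4_def q0)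
    next
      fix v assume v: "v < n"
      then have "Inr v \<in> ?I4" by blast
      from bspec[OF \<phi> this] have "(\<Sum>M\<in>msets n 4. \<phi> M * (if M = s v then 1 else 0)) = 0"
        by (simp add: a4_def)
      moreover have "(\<Sum>M\<in>msets n 4. \<phi> M * (if M = s v then 1 else 0)) =
          (\<Sum>M\<in>msets n 4. if M = s v then \<phi> (s v) else 0)"
        by (intro sum.cong) auto
      ultimately show "\<phi> (s v) = 0" using s_in[OF v] by simp
    qed
  qed auto
  define a5 where "a5 = (\<lambda>f (P, N) M. Poly_Mapping.lookup (q f P * cubic f N) (monom_of M))"
  let ?I5 = "msets n 2 \<times> msets n 3"
  obtain g5 where g5: "polyfun n g5" "g5 f0 \<noteq> 0"
    "\<And>f v. g5 f \<noteq> 0 \<Longrightarrow> \<exists>c. \<forall>M\<in>msets n 5. v M = (\<Sum>i\<in>?I5. c i * a5 f i M)"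
  proof (rule spanning_is_open[where I = ?I5 and R = "msets n 5" and a = a5 and ?f0.0 = f0])
    fix i M assume "i \<in> ?I5"
    then show "polyfun n (\<lambda>f. a5 f i M)"
      unfolding a5_def
      by (auto intro!: polyfun_lookup_mult[where n = n and d = 2 and e = 3] qhom q_poly
          cubic_homogeneous polyfun_lookup_cubic)
  next
    fix \<phi> :: "nat multiset \<Rightarrow> 'k"
    assume \<phi>: "\<forall>i\<in>?I5. (\<Sum>M\<in>msets n 5. \<phi> M * a5 f0 i M) = 0"
    show "\<forall>M\<in>msets n 5. \<phi> M = 0"
    proof (rule quintics_span_f0[OF B0])
      fix P N assume "P \<in> msets n 2" "N \<in> msets n 3"
      then have "(P, N) \<in> ?I5" by blast
      from bspec[OF \<phi> this] show "(\<Sum>M\<in>msets n 5. \<phi> M * Poly_Mapping.lookup (quadric 1 (B f0) f0 P * cubic f0 N)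
          (monom_of M)) = 0"
        by (simp add: a5_def q0)
    qed
  qed auto
  \<comment> \<open>One factor for each condition: catalecticant matrix invertible, coefficient at
    the base triple non-zero, dual matrix invertible, spanning in degree 4, spanning in degree
    5.\<close>
  let ?g = "\<lambda>f. d f * f (monom_of base_triple) * e f * g4 f * g5 f"
  show ?thesis
  proof (rule for_general_cubicI[where \<phi> = ?g and ?f0.0 = f0])
    show "polyfun n ?g"
      by (intro polyfun_mult dB eE g4 g5 polyfun_coeff_mset base_triple_in)
    show "?g f0 \<noteq> 0" using dB(2) eE(2) g4(2) g5(2) by (simp add: f0 base_triple_in)
  next
    fix F :: "(nat, 'k) mpoly"
    assume F: "F \<in> homogeneous_part n 3" and "?g (Poly_Mapping.lookup F) \<noteq> 0"
    define f where "f = Poly_Mapping.lookup F"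
    have nz: "d f \<noteq> 0" "f (monom_of base_triple) \<noteq> 0" "e f \<noteq> 0" "g4 f \<noteq> 0" "g5 f \<noteq> 0"
      using \<open>?g (Poly_Mapping.lookup F) \<noteq> 0\<close> by (auto simp: f_def)
    let ?J = "Ann n F \<cdot>\<^bsub>poly_ring n\<^esub> Ann n F"
    have H: "1 \<notin> Ann n F" "quotient_has_hilbert_function n (Ann n F) [1, n, n, 1]"
      by (rule Ann_Hilbert_function[OF F f_def nz(1,2), of "B f"]; use dB in simp)+
    then have J1: "1 \<notin> ?J" using Ann_square_subset by blast
    have qA: "q f P \<in> Ann n F" if "P \<in> msets n 2" for P
      unfolding q_def by (rule quadric_in_Ann[OF F f_def that]) (use dB in simp)
    have H4: "hilbert_quotient n ?J 4 = n"
    proof (rule hilbert_quotientI[OF ideal_Ann_square J1, where w = "prolongation f"])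
      fix p :: "(nat, 'k) mpoly" assume p: "p \<in> homogeneous_part n 4"
      show "p \<in> ?J \<longleftrightarrow> (\<forall>j<n. pairing (prolongation f j) p = 0)"
      proof
        assume "p \<in> ?J"
        then show "\<forall>j<n. pairing (prolongation f j) p = 0"
          unfolding f_def using prolongation_Ann_square by blast
      next
        assume z: "\<forall>j<n. pairing (prolongation f j) p = 0"
        obtain c where c: "\<forall>M\<in>msets n 4. Poly_Mapping.lookup p (monom_of M) = (\<Sum>i\<in>?I4. c i * a4 f i M)"
          using g4(3)[OF nz(4), of "\<lambda>M. Poly_Mapping.lookup p (monom_of M)"] by blast
        \<comment> \<open>p is split into u, which lies in the square of the annihilator, and a
          combination t of the \<open>s v\<close>. The functionals vanish on p and u, hence on t,
          and as their pairing with the \<open>s v\<close> is invertible, t = 0.\<close>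
        define u where "u = (\<Sum>i\<in>msets n 2 \<times> msets n 2.
          Poly_Mapping.single 0 (c (Inl i)) * (q f (fst i) * q f (snd i)))"
        define t where "t = (\<Sum>v<n. Poly_Mapping.single (monom_of (s v)) (c (Inr v)))"
        have uJ: "u \<in> ?J"
          unfolding u_def by (intro Ann_square_sum qA) auto
        have hom: "u \<in> homogeneous_part n 4" "t \<in> homogeneous_part n 4"
          unfolding u_def t_def
          using homogeneous_part_mult[OF qhom qhom]
          by (auto intro!: homogeneous_part_sum homogeneous_part_const_mult single_homogeneous s_in)
        have pu: "p = u + t"
        proof (rule homogeneous_part_eqI[OF p homogeneous_part_add[OF hom]])
          fix M assume "M \<in> msets n 4"
          then have "Poly_Mapping.lookup p (monom_of M) = (\<Sum>i\<in>?I4. c i * a4 f i M)" using c by blast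
          also have "\<dots> = (\<Sum>i\<in>msets n 2 \<times> msets n 2. c (Inl i) * a4 f (Inl i) M) +
              (\<Sum>v<n. c (Inr v) * a4 f (Inr v) M)"
            by (simp add: sum.Plus)
          also have "(\<Sum>i\<in>msets n 2 \<times> msets n 2. c (Inl i) * a4 f (Inl i) M) = Poly_Mapping.lookup u (monom_of M)"
            unfolding u_def lookup_sum
            by (intro sum.cong refl) (auto simp: a4_def lookup_const_mult)
          also have "(\<Sum>v<n. c (Inr v) * a4 f (Inr v) M) = Poly_Mapping.lookup t (monom_of M)"
            unfolding t_def lookup_sum
            by (intro sum.cong refl) (auto simp: a4_def lookup_single)
          finally show "Poly_Mapping.lookup p (monom_of M) = Poly_Mapping.lookup (u + t) (monom_of M)"
            by (simp add: lookup_add)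
        qed
        have zt: "(\<Sum>v<n. c (Inr v) * dual_matrix f j v) = 0" if "j < n" for j
        proof -
          have "pairing (prolongation f j) u = 0"
            unfolding f_def by (rule prolongation_Ann_square[OF uJ])
          moreover have "pairing (prolongation f j) u + pairing (prolongation f j) t = 0"
            using z that by (simp add: pu pairing_add)
          ultimately have "pairing (prolongation f j) t = 0" by simp
          then show ?thesis by (simp add: t_def pairing_sum dual_matrix_def)
        qed
        have "c (Inr v) = 0" if v: "v < n" for v
        proof -
          have "e f * c (Inr v) = (\<Sum>w<n. if w = v then c (Inr v) * e f else 0)" using v by simp
          also have "\<dots> = (\<Sum>w<n. c (Inr w) * (\<Sum>j<n. E f v j * dual_matrix f j w))"
            using v eE(4) by (intro sum.cong) auto
          also have "\<dots> = (\<Sum>j<n. E f v j * (\<Sum>w<n. c (Inr w) * dual_matrix f j w))"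
            unfolding sum_distrib_left by (subst sum.swap) (simp add: algebra_simps)
          also have "\<dots> = 0" by (simp add: zt)
          finally show ?thesis using nz by simp
        qed
        then have "t = 0" by (simp add: t_def)
        then show "p \<in> ?J" using pu uJ by simp
      qed
    next
      fix j assume j: "j < n"
      \<comment> \<open>Column j of the inverse \<open>E f / e f\<close> of the dual matrix.\<close>
      let ?p = "\<Sum>v<n. Poly_Mapping.single (monom_of (s v)) (E f v j / e f)"
      have "pairing (prolongation f k) ?p = (if k = j then 1 else 0)" if "k < n" for k
      proof -
        have "pairing (prolongation f k) ?p = (\<Sum>v<n. dual_matrix f k v * E f v j) / e f"
          by (simp add: pairing_sum dual_matrix_def sum_divide_distrib mult.commute)
        then show ?thesis using eE(3) j that nz by simp
      qed
      moreover have "?p \<in> homogeneous_part n 4"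
        by (intro homogeneous_part_sum single_homogeneous s_in) auto
      ultimately show "\<exists>p\<in>homogeneous_part n 4. \<forall>k<n. pairing (prolongation f k) p = (if k = j then 1 else 0)"
        by blast
    qed
    \<comment> \<open>With r = 0 the claim is that every quintic form is a combination of products
      of annihilating quadrics and cubics.\<close>
    have H5: "hilbert_quotient n ?J 5 = 0"
    proof (rule hilbert_quotientI[OF ideal_Ann_square J1])
      fix p :: "(nat, 'k) mpoly" assume p: "p \<in> homogeneous_part n 5"
      obtain c where c: "\<forall>M\<in>msets n 5. Poly_Mapping.lookup p (monom_of M) = (\<Sum>i\<in>?I5. c i * a5 f i M)"
        using g5(3)[OF nz(5), of "\<lambda>M. Poly_Mapping.lookup p (monom_of M)"] by blast
      define u where "u = (\<Sum>i\<in>?I5. Poly_Mapping.single 0 (c i) * (q f (fst i) * cubic f (snd i)))"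
      have "u \<in> ?J"
        unfolding u_def by (intro Ann_square_sum qA cubic_in_Ann[OF F f_def]) auto
      moreover have "u \<in> homogeneous_part n 5"
        unfolding u_def using homogeneous_part_mult[OF qhom cubic_homogeneous]
        by (auto intro!: homogeneous_part_sum homogeneous_part_const_mult)
      then have "p = u"
      proof (rule homogeneous_part_eqI[OF p])
        fix M assume "M \<in> msets n 5"
        then show "Poly_Mapping.lookup p (monom_of M) = Poly_Mapping.lookup u (monom_of M)"
          using c unfolding u_def lookup_sum
          by (simp add: a5_def lookup_const_mult split_def)
      qed
      ultimately show "p \<in> ?J \<longleftrightarrow> (\<forall>j<0::nat. pairing (w j) p = 0)" for w by simp
    qed simp
    show "small_tangent_space n F"
      unfolding small_tangent_space_def using F H H4 H5 by blast
  qed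
qed

end

section \<open>A core with attached blocks\<close>

lemma mset_pair_eq: "{#a, b#} = {#c, d#} \<longleftrightarrow> a = c \<and> b = d \<or> a = d \<and> b = c"
  by (auto simp: add_eq_conv_ex)

lemma mset_two_of_three:
  "add_mset w P = {#a, b, c#} \<Longrightarrow> w = a \<and> P = {#b, c#} \<or> w = b \<and> P = {#a, c#} \<or> w = c \<and> P = {#a, b#}"
  by (auto simp: add_eq_conv_ex)

lemma mset_pair_add: "{#a, b#} + {#c, d#} = {#a, b, c, d#}"
  by (simp add: add_mset_commute)

lemma kills_square_UU: "kills_square n T \<phi> \<Longrightarrow> uncovered n T {#a, b#} \<Longrightarrow> uncovered n T {#c, d#} \<Longrightarrow>
    \<phi> {#a, b, c, d#} = 0"
  unfolding kills_square_def mset_pair_add[symmetric] by blast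

lemma kills_square_UC: "kills_square n T \<phi> \<Longrightarrow> uncovered n T {#a, b#} \<Longrightarrow> {#v, c, d#} \<in> T \<Longrightarrow> {#v, c', d'#} \<in> T \<Longrightarrow>
    \<phi> {#a, b, c, d#} = \<phi> {#a, b, c', d'#}"
  unfolding kills_square_def mset_pair_add[symmetric] by blast

text \<open>In each block the three inner pairs yz, yy, zz get the distinct third vertices q, p, r.
  Hence a core vertex other than p and q forms an uncovered pair with every y, one other than q and
  r with every z, and two vertices of different blocks are always uncovered.\<close>

locale block_design =
  fixes c :: nat and C :: "nat multiset set" and p q r :: nat
  assumes pqr: "p < c" "q < c" "r < c" "p \<noteq> q" "p \<noteq> r" "q \<noteq> r"
    and C_sub: "C \<subseteq> msets c 3"
    and C_unique: "add_mset v P \<in> C \<Longrightarrow> add_mset w P \<in> C \<Longrightarrow> v = w"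
begin

definition y :: "nat \<Rightarrow> nat" where "y j = c + 2 * j"
definition z :: "nat \<Rightarrow> nat" where "z j = c + 2 * j + 1"

definition block :: "nat \<Rightarrow> nat multiset set"
  where "block j = {{#q, y j, z j#}, {#p, y j, y j#}, {#r, z j, z j#}}"

definition T :: "nat \<Rightarrow> nat multiset set"
  where "T m = C \<union> (\<Union>j<m. block j)"

lemma yz_simps [simp]:
  "y i = y j \<longleftrightarrow> i = j" "z i = z j \<longleftrightarrow> i = j" "y i \<noteq> z j" "z j \<noteq> y i"
  "\<not> y j < c" "\<not> z j < c" "y j < c + 2 * m \<longleftrightarrow> j < m" "z j < c + 2 * m \<longleftrightarrow> j < m"
  unfolding y_def z_def by (auto; presburger)+

lemma core_neq [simp]: "v < c \<Longrightarrow> v \<noteq> y j" "v < c \<Longrightarrow> v \<noteq> z j" "v < c \<Longrightarrow> y j \<noteq> v" "v < c \<Longrightarrow> z j \<noteq> v"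
  using yz_simps(5,6) by metis+

lemma vertex_cases:
  assumes "v < c + 2 * m"
  obtains "v < c" | j where "j < m" "v = y j" | j where "j < m" "v = z j"
proof (cases "v < c")
  case False
  then have "v = y ((v - c) div 2) \<or> v = z ((v - c) div 2)" "(v - c) div 2 < m"
    using assms unfolding y_def z_def by presburger+
  then show ?thesis using that by blast
qed (use that in blast)

lemma C_core: "M \<in> C \<Longrightarrow> v \<in># M \<Longrightarrow> v < c"
  using C_sub by (auto simp: msets_def)

lemma T_blocks [simp]:
  "j < m \<Longrightarrow> {#q, y j, z j#} \<in> T m" "j < m \<Longrightarrow> {#p, y j, y j#} \<in> T m" "j < m \<Longrightarrow> {#r, z j, z j#} \<in> T m"
  by (auto simp: T_def block_def)

lemma T_cases:
  assumes "M \<in> T m"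
  obtains "M \<in> C" | j where "j < m" "M = {#q, y j, z j#}" | j where "j < m" "M = {#p, y j, y j#}"
    | j where "j < m" "M = {#r, z j, z j#}"
  using assms unfolding T_def block_def by blast

lemma T_sub: "T m \<subseteq> msets (c + 2 * m) 3"
proof
  fix M assume "M \<in> T m"
  then show "M \<in> msets (c + 2 * m) 3"
  proof (cases rule: T_cases)
    case 1
    then have "M \<in> msets c 3" using C_sub by blast
    then show ?thesis by (auto simp: msets_def)
  qed (use pqr in \<open>auto simp: msets_def\<close>)
qed

lemma uncovered_blocks:
  assumes "i < m" "j < m" "i \<noteq> j" "a \<in> {y i, z i}" "b \<in> {y j, z j}"
  shows "uncovered (c + 2 * m) (T m) {#a, b#}"
  unfolding uncovered_def
proof (intro conjI allI notI)
  show "{#a, b#} \<in> msets (c + 2 * m) 2" using assms by (auto simp: msets_def)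
  fix v assume "add_mset v {#a, b#} \<in> T m"
  then show False
  proof (cases rule: T_cases)
    case 1
    then have "a < c" by (rule C_core) simp
    then show False using assms by auto
  qed (use assms pqr in \<open>auto dest!: mset_two_of_three simp: mset_pair_eq\<close>)
qed

lemma uncovered_y:
  assumes "j < m" "v < c" "v \<noteq> p" "v \<noteq> q"
  shows "uncovered (c + 2 * m) (T m) {#v, y j#}"
  unfolding uncovered_def
proof (intro conjI allI notI)
  show "{#v, y j#} \<in> msets (c + 2 * m) 2" using assms by (auto simp: msets_def)
  fix w assume "add_mset w {#v, y j#} \<in> T m"
  then show False
  proof (cases rule: T_cases)
    case 1
    then have "y j < c" by (rule C_core) simp
    then show False by simp
  qed (use assms pqr in \<open>auto dest!: mset_two_of_three simp: mset_pair_eq\<close>)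
qed

lemma uncovered_z:
  assumes "j < m" "v < c" "v \<noteq> q" "v \<noteq> r"
  shows "uncovered (c + 2 * m) (T m) {#v, z j#}"
  unfolding uncovered_def
proof (intro conjI allI notI)
  show "{#v, z j#} \<in> msets (c + 2 * m) 2" using assms by (auto simp: msets_def)
  fix w assume "add_mset w {#v, z j#} \<in> T m"
  then show False
  proof (cases rule: T_cases)
    case 1
    then have "z j < c" by (rule C_core) simp
    then show False by simp
  qed (use assms pqr in \<open>auto dest!: mset_two_of_three simp: mset_pair_eq\<close>)
qed

text \<open>A block triple has two vertices in its block, counted with multiplicity, so one of them
  survives the removal of any vertex. Pairs inside the core are therefore completed by core triples
  only, and a pair that is completed by a block triple reveals the block.\<close>

lemma block_third: "add_mset w N \<in> block j \<Longrightarrow> y j \<in># N \<or> z j \<in># N"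
  by (auto simp: block_def dest!: mset_two_of_three)

lemma T_unique:
  assumes "add_mset v P \<in> T m" "add_mset w P \<in> T m"
  shows "v = w"
proof -
  have core: "add_mset w P \<in> C" if "add_mset v P \<in> C" "add_mset w P \<in> T m" for v w
  proof -
    have "x < c" if "x \<in># P" for x
      using C_core[OF \<open>add_mset v P \<in> C\<close>, of x] that by simp
    then have "\<not> (y j \<in># P \<or> z j \<in># P)" for j using yz_simps(5,6) by blast
    then have "add_mset w P \<notin> block j" for j using block_third by blast
    then show ?thesis using that(2) by (auto simp: T_def)
  qed
  from assms(1) show ?thesis
  proof (cases rule: T_cases)
    case 1
    then show ?thesis using core[OF 1 assms(2)] C_unique by blast
  next
    case 2
    from assms(2) show ?thesis
    proof (cases rule: T_cases)
      case 1
      then show ?thesis using core[OF 1 assms(1)] C_unique by blast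
    qed (use 2 pqr in \<open>auto dest!: mset_two_of_three simp: mset_pair_eq\<close>)
  next
    case 3
    from assms(2) show ?thesis
    proof (cases rule: T_cases)
      case 1
      then show ?thesis using core[OF 1 assms(1)] C_unique by blast
    qed (use 3 pqr in \<open>auto dest!: mset_two_of_three simp: mset_pair_eq\<close>)
  next
    case 4
    from assms(2) show ?thesis
    proof (cases rule: T_cases)
      case 1
      then show ?thesis using core[OF 1 assms(1)] C_unique by blast
    qed (use 4 pqr in \<open>auto dest!: mset_two_of_three simp: mset_pair_eq\<close>)
  qed
qed

subsection \<open>Restriction to a few blocks\<close>

text \<open>The relabelling that fixes the core and moves block i to block \<open>b i\<close>. For
  injective b it makes the design with k blocks a subdesign of a larger one, along which functionals
  are restricted.\<close>

definition emb :: "(nat \<Rightarrow> nat) \<Rightarrow> nat \<Rightarrow> nat"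
  where "emb b v = (if v < c then v else c + 2 * b ((v - c) div 2) + (v - c) mod 2)"

lemma emb_simps [simp]: "v < c \<Longrightarrow> emb b v = v" "emb b (y i) = y (b i)" "emb b (z i) = z (b i)"
  by (auto simp: emb_def y_def z_def)

lemma emb_less:
  assumes "\<And>i. i < k \<Longrightarrow> b i < m" "v < c + 2 * k"
  shows "emb b v < c + 2 * m"
  using assms(2) by (cases rule: vertex_cases) (use assms(1) in auto)

lemma emb_core: "emb b v < c \<longleftrightarrow> v < c"
  by (auto simp: emb_def)

lemma emb_inj:
  assumes "inj_on b {..<k}" "v < c + 2 * k" "w < c + 2 * k" "emb b v = emb b w"
  shows "v = w"
proof -
  have "v < c \<longleftrightarrow> w < c" using emb_core assms(4) by metis
  from assms(2) show ?thesis
  proof (cases rule: vertex_cases)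
    case 1
    then show ?thesis using assms(4) \<open>v < c \<longleftrightarrow> w < c\<close> by simp
  next
    case (2 i)
    from assms(3) show ?thesis
      by (cases rule: vertex_cases) (use assms(4) 2 inj_onD[OF assms(1), of i] in \<open>simp; metis lessThan_iff\<close>)+
  next
    case (3 i)
    from assms(3) show ?thesis
      by (cases rule: vertex_cases) (use assms(4) 3 inj_onD[OF assms(1), of i] in \<open>simp; metis lessThan_iff\<close>)+
  qed
qed

lemma image_emb_inj:
  assumes "inj_on b {..<k}" "M \<in> msets (c + 2 * k) d" "N \<in> msets (c + 2 * k) e"
    "image_mset (emb b) M = image_mset (emb b) N"
  shows "M = N"
proof (rule multiset.inj_map_strong[OF _ assms(4)])
  fix v w assume "v \<in># M" "w \<in># N" "emb b v = emb b w"
  moreover have "v < c + 2 * k" "w < c + 2 * k" using calculation assms(2,3) by (auto simp: msets_def)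
  ultimately show "v = w" using emb_inj[OF assms(1)] by blast
qed

lemma image_emb_core: "set_mset M \<subseteq> {..<c} \<Longrightarrow> image_mset (emb b) M = M"
  by (induction M) auto

lemma emb_T:
  assumes "\<And>i. i < k \<Longrightarrow> b i < m" "M \<in> T k"
  shows "image_mset (emb b) M \<in> T m"
  using assms(2)
proof (cases rule: T_cases)
  case 1
  then have "image_mset (emb b) M = M" by (intro image_emb_core) (use C_core in auto)
  then show ?thesis using 1 by (simp add: T_def)
qed (use assms(1) pqr in auto)

text \<open>Needed so that uncovered pairs stay uncovered in the larger design. A triple that
  completes the image of P lies in the core or, by \<open>block_third\<close>, in a block in the
  range of b. Either way it is the image of a triple, and injectivity identifies what is left of
  that triple with P.\<close>

lemma emb_T_back:
  assumes b: "inj_on b {..<k}" and P: "P \<in> msets (c + 2 * k) 2"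
    and w: "add_mset w (image_mset (emb b) P) \<in> T m"
  shows "\<exists>v. add_mset v P \<in> T k"
proof -
  let ?N = "add_mset w (image_mset (emb b) P)"
  have blk: "\<exists>i<k. j = b i" if "y j \<in># image_mset (emb b) P \<or> z j \<in># image_mset (emb b) P" for j
  proof -
    from that obtain x where x: "x \<in># P" "y j = emb b x \<or> z j = emb b x" by auto
    then have "x < c + 2 * k" using P by (auto simp: msets_def)
    then show ?thesis by (cases rule: vertex_cases) (use x in auto)
  qed
  have "\<exists>M\<in>T k. image_mset (emb b) M = ?N"
    using w
  proof (cases rule: T_cases)
    case 1
    then have "image_mset (emb b) ?N = ?N" by (intro image_emb_core) (use C_core in blast)
    then show ?thesis using 1 by (intro bexI[of _ ?N]) (auto simp: T_def)
  next
    case (2 j)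
    then have "?N \<in> block j" by (simp add: block_def)
    from blk[OF block_third[OF this]] have "\<exists>i<k. j = b i" .
    then obtain i where "i < k" "j = b i" by blast
    then show ?thesis using 2 pqr by (intro bexI[of _ "{#q, y i, z i#}"]) auto
  next
    case (3 j)
    then have "?N \<in> block j" by (simp add: block_def)
    from blk[OF block_third[OF this]] have "\<exists>i<k. j = b i" .
    then obtain i where "i < k" "j = b i" by blast
    then show ?thesis using 3 pqr by (intro bexI[of _ "{#p, y i, y i#}"]) auto
  next
    case (4 j)
    then have "?N \<in> block j" by (simp add: block_def)
    from blk[OF block_third[OF this]] have "\<exists>i<k. j = b i" .
    then obtain i where "i < k" "j = b i" by blast
    then show ?thesis using 4 pqr by (intro bexI[of _ "{#r, z i, z i#}"]) auto
  qed
  then obtain M where M: "M \<in> T k" "image_mset (emb b) M = ?N" by blast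
  from msed_map_invR[OF M(2)] obtain v M1 where
    M1: "M = add_mset v M1" "image_mset (emb b) M1 = image_mset (emb b) P" by blast
  have "M \<in> msets (c + 2 * k) 3" using M(1) T_sub by blast
  then have "M1 \<in> msets (c + 2 * k) 2" using M1(1) by (auto simp: msets_def)
  then have "M1 = P" using image_emb_inj[OF b _ P M1(2)] by blast
  then show ?thesis using M(1) M1(1) by blast
qed

lemma emb_uncovered:
  assumes b: "inj_on b {..<k}" "\<And>i. i < k \<Longrightarrow> b i < m" and P: "uncovered (c + 2 * k) (T k) P"
  shows "uncovered (c + 2 * m) (T m) (image_mset (emb b) P)"
  using P emb_T_back[OF b(1), of P _ m] emb_less[OF b(2)]
  unfolding uncovered_def by (auto simp: msets_def)

lemma emb_kills_square:
  assumes b: "inj_on b {..<k}" "\<And>i. i < k \<Longrightarrow> b i < m" and \<phi>: "kills_square (c + 2 * m) (T m) \<phi>"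
  shows "kills_square (c + 2 * k) (T k) (\<lambda>M. \<phi> (image_mset (emb b) M))"
proof -
  have T: "add_mset (emb b v) (image_mset (emb b) P) \<in> T m" if "add_mset v P \<in> T k" for v P
    using emb_T[OF b(2) that] by simp
  show ?thesis
    using \<phi> emb_uncovered[OF b] T unfolding kills_square_def image_mset_union by meson
qed

end

section \<open>Quartic monomials that meet three blocks\<close>

context block_design
begin

lemma T_blocks_rotated:
  assumes "j < m"
  shows "{#z j, y j, q#} \<in> T m" "{#y j, z j, q#} \<in> T m" "{#y j, y j, p#} \<in> T m" "{#z j, z j, r#} \<in> T m"
proof -
  have "{#z j, y j, q#} = {#q, y j, z j#}" "{#y j, z j, q#} = {#q, y j, z j#}"
    "{#y j, y j, p#} = {#p, y j, y j#}" "{#z j, z j, r#} = {#r, z j, z j#}"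
    by (simp_all add: add_mset_commute)
  then show "{#z j, y j, q#} \<in> T m" "{#y j, z j, q#} \<in> T m" "{#y j, y j, p#} \<in> T m" "{#z j, z j, r#} \<in> T m"
    using T_blocks[OF assms] by (simp_all only:)
qed

context
  fixes m :: nat and \<phi> :: "nat multiset \<Rightarrow> 'k::field" and i j k :: nat
  assumes \<phi>: "kills_square (c + 2 * m) (T m) \<phi>" and ijk: "i < m" "j < m" "k < m" "i \<noteq> j" "i \<noteq> k" "j \<noteq> k"
begin

text \<open>Two trades: y_k p and z_k q have the same third vertex y_k, and y_j q and z_j r the same
  third vertex z_j, while the other factor is each time an uncovered pair from two blocks. The
  result r y_i z_j z_k is a product of two uncovered pairs. Exchanging y with z and p with r gives
  \<open>three_z\<close>.\<close>

lemma three_y: "\<phi> {#y i, y j, y k, p#} = 0"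
proof -
  have "\<phi> {#y i, y j, y k, p#} = \<phi> {#y i, y j, z k, q#}"
    by (rule kills_square_UC[OF \<phi> uncovered_blocks T_blocks_rotated(3,2)]) (use ijk in auto)
  also have "\<dots> = \<phi> {#y i, z k, y j, q#}" by (simp add: add_mset_commute)
  also have "\<dots> = \<phi> {#y i, z k, z j, r#}"
    by (rule kills_square_UC[OF \<phi> uncovered_blocks T_blocks_rotated(1,4)]) (use ijk in auto)
  also have "\<dots> = \<phi> {#r, y i, z j, z k#}" by (simp add: add_mset_commute)
  also have "\<dots> = 0"
    by (rule kills_square_UU[OF \<phi> uncovered_y uncovered_blocks]) (use ijk pqr in auto)
  finally show ?thesis .
qed

lemma three_z: "\<phi> {#z i, z j, z k, r#} = 0"
proof -
  have "\<phi> {#z i, z j, z k, r#} = \<phi> {#z i, z j, y k, q#}"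
    by (rule kills_square_UC[OF \<phi> uncovered_blocks T_blocks_rotated(4,1)]) (use ijk in auto)
  also have "\<dots> = \<phi> {#z i, y k, z j, q#}" by (simp add: add_mset_commute)
  also have "\<dots> = \<phi> {#z i, y k, y j, p#}"
    by (rule kills_square_UC[OF \<phi> uncovered_blocks T_blocks_rotated(2,3)]) (use ijk in auto)
  also have "\<dots> = \<phi> {#p, z i, y j, y k#}" by (simp add: add_mset_commute)
  also have "\<dots> = 0"
    by (rule kills_square_UU[OF \<phi> uncovered_z uncovered_blocks]) (use ijk pqr in auto)
  finally show ?thesis .
qed

text \<open>The two of a, b, d that are not paired with x lie in different blocks, so they form an
  uncovered pair too.\<close>

lemma three_blocks_uncovered:
  assumes "a \<in> {y i, z i}" "b \<in> {y j, z j}" "d \<in> {y k, z k}"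
    and "uncovered (c + 2 * m) (T m) {#x, a#} \<or> uncovered (c + 2 * m) (T m) {#x, b#} \<or>
      uncovered (c + 2 * m) (T m) {#x, d#}"
  shows "\<phi> {#a, b, d, x#} = 0"
  using assms(4)
proof (elim disjE)
  assume "uncovered (c + 2 * m) (T m) {#x, a#}"
  then have "\<phi> {#x, a, b, d#} = 0"
    by (rule kills_square_UU[OF \<phi> _ uncovered_blocks[of j m k]]) (use ijk assms in auto)
  then show ?thesis by (simp add: add_mset_commute)
next
  assume "uncovered (c + 2 * m) (T m) {#x, b#}"
  then have "\<phi> {#x, b, a, d#} = 0"
    by (rule kills_square_UU[OF \<phi> _ uncovered_blocks[of i m k]]) (use ijk assms in auto)
  then show ?thesis by (simp add: add_mset_commute)
next
  assume "uncovered (c + 2 * m) (T m) {#x, d#}"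
  then have "\<phi> {#x, d, a, b#} = 0"
    by (rule kills_square_UU[OF \<phi> _ uncovered_blocks[of i m j]]) (use ijk assms in auto)
  then show ?thesis by (simp add: add_mset_commute)
qed

text \<open>A block vertex x is uncovered with a or with b, as these lie in different blocks, and a
  core vertex other than p, q, r is uncovered with a. For r only the case of three z is left, for p
  that of three y; q is traded away.\<close>

lemma three_blocks:
  assumes ab: "a \<in> {y i, z i}" "b \<in> {y j, z j}" "d \<in> {y k, z k}" and x: "x < c + 2 * m"
  shows "\<phi> {#a, b, d, x#} = 0"
  using x
proof (cases rule: vertex_cases)
  case (2 l)
  have "uncovered (c + 2 * m) (T m) {#x, a#} \<or> uncovered (c + 2 * m) (T m) {#x, b#}"
    by (cases "l = i") (use 2 ab ijk uncovered_blocks[of l m i x a] uncovered_blocks[of l m j x b] in auto)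
  then show ?thesis using three_blocks_uncovered[OF ab] by blast
next
  case (3 l)
  have "uncovered (c + 2 * m) (T m) {#x, a#} \<or> uncovered (c + 2 * m) (T m) {#x, b#}"
    by (cases "l = i") (use 3 ab ijk uncovered_blocks[of l m i x a] uncovered_blocks[of l m j x b] in auto)
  then show ?thesis using three_blocks_uncovered[OF ab] by blast
next
  case 1
  note uy = uncovered_y[OF _ 1] and uz = uncovered_z[OF _ 1]
  have R: "\<phi> {#a, b, d, r#} = 0" if ab: "a \<in> {y i, z i}" "b \<in> {y j, z j}" "d \<in> {y k, z k}" for a b d
  proof (cases "a = z i \<and> b = z j \<and> d = z k")
    case False
    then have "a = y i \<or> b = y j \<or> d = y k" using ab by auto
    then show ?thesis
      by (intro three_blocks_uncovered[OF ab]) (use uncovered_y[of _ m r] pqr ijk in auto)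
  qed (use three_z in simp)
  have P: "\<phi> {#a, b, d, p#} = 0" if ab: "a \<in> {y i, z i}" "b \<in> {y j, z j}" "d \<in> {y k, z k}" for a b d
  proof (cases "a = y i \<and> b = y j \<and> d = y k")
    case False
    then have "a = z i \<or> b = z j \<or> d = z k" using ab by auto
    then show ?thesis
      by (intro three_blocks_uncovered[OF ab]) (use uncovered_z[of _ m p] pqr ijk in auto)
  qed (use three_y in simp)
  \<comment> \<open>The pair y_k q is traded for z_k r, with third vertex z_k, and the pair z_k q
    for y_k p, with third vertex y_k; so q reduces to r or p.\<close>
  have Q: "\<phi> {#a, b, d, q#} = 0"
  proof (cases "d = y k")
    case True
    have "\<phi> {#a, b, y k, q#} = \<phi> {#a, b, z k, r#}"
      by (rule kills_square_UC[OF \<phi> uncovered_blocks T_blocks_rotated(1,4)]) (use ab ijk in auto)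
    then show ?thesis using R[OF ab(1,2), of "z k"] True by simp
  next
    case False
    then have d: "d = z k" using ab by simp
    have "\<phi> {#a, b, z k, q#} = \<phi> {#a, b, y k, p#}"
      by (rule kills_square_UC[OF \<phi> uncovered_blocks T_blocks_rotated(2,3)]) (use ab ijk in auto)
    then show ?thesis using P[OF ab(1,2), of "y k"] d by simp
  qed
  show ?thesis
  proof (cases "x \<in> {p, q, r}")
    case False
    then have "uncovered (c + 2 * m) (T m) {#x, a#}"
      using ab(1) uy[OF ijk(1)] uz[OF ijk(1)] by auto
    then show ?thesis using three_blocks_uncovered[OF ab] by blast
  qed (use P[OF ab] Q R[OF ab] in auto)
qed

end

section \<open>Reduction to at most two blocks\<close>

lemma emb_preimage:
  assumes "set_mset M \<subseteq> emb b ` {..<c + 2 * k}" "size M = d"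
  shows "\<exists>N\<in>msets (c + 2 * k) d. image_mset (emb b) N = M"
proof -
  let ?g = "inv_into {..<c + 2 * k} (emb b)"
  have "image_mset (emb b) (image_mset ?g M) = image_mset (\<lambda>v. emb b (?g v)) M"
    by (simp add: multiset.map_comp o_def)
  also have "\<dots> = image_mset (\<lambda>v. v) M"
    using assms(1) by (intro image_mset_cong f_inv_into_f) blast
  finally have "image_mset (emb b) (image_mset ?g M) = M" by simp
  moreover have "?g v \<in> {..<c + 2 * k}" if "v \<in># M" for v
    using assms(1) that by (intro inv_into_into) auto
  then have "image_mset ?g M \<in> msets (c + 2 * k) d" using assms(2) by (auto simp: msets_def)
  ultimately show ?thesis by auto
qed

text \<open>The restriction of \<open>\<phi>\<close> along an embedding must again vanish at the
  normalising monomials, but for a core vertex v the triple \<open>t v\<close> may use block 0, and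
  an embedding may move it elsewhere. So embeddings that fix block 0 come first; they give all
  monomials that meet at most one block. After any embedding the normalising monomials meet at most
  one block, which then settles arbitrary embeddings.\<close>

lemma quartics_from_two_blocks:
  fixes \<phi> :: "nat multiset \<Rightarrow> 'k::field"
  assumes m: "1 \<le> m" and k: "k = min m 2"
    and \<phi>: "kills_square (c + 2 * m) (T m) \<phi>"
    and base: "\<And>\<psi> :: nat multiset \<Rightarrow> 'k. kills_square (c + 2 * k) (T k) \<psi> \<Longrightarrow>
      \<forall>v<c + 2 * k. \<psi> (add_mset v (t v)) = 0 \<Longrightarrow> \<forall>M\<in>msets (c + 2 * k) 4. \<psi> M = 0"
    and t: "\<And>v. v < c \<Longrightarrow> t v \<in> T 1" "\<And>v. c \<le> v \<Longrightarrow> t v = t0" "t0 \<in> C"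
    and s: "\<forall>v<c + 2 * m. \<phi> (add_mset v (t v)) = 0"
  shows "\<forall>M\<in>msets (c + 2 * m) 4. \<phi> M = 0"
proof -
  have t0_core: "image_mset (emb b) t0 = t0" for b
    by (intro image_emb_core) (use C_core[OF t(3)] in auto)
  have step1: "\<phi> M = 0"
    if b: "inj_on b {..<k}" "\<And>i. i < k \<Longrightarrow> b i < m"
      and norm: "\<And>v. v < c + 2 * k \<Longrightarrow> \<phi> (image_mset (emb b) (add_mset v (t v))) = 0"
      and M: "set_mset M \<subseteq> emb b ` {..<c + 2 * k}" "size M = 4" for b :: "nat \<Rightarrow> nat" and M
  proof -
    obtain N where N: "N \<in> msets (c + 2 * k) 4" "image_mset (emb b) N = M"
      using emb_preimage[OF M] by blast
    have "\<forall>N\<in>msets (c + 2 * k) 4. \<phi> (image_mset (emb b) N) = 0"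
      by (rule base[OF emb_kills_square[OF b \<phi>]]) (use norm in blast)+
    then show ?thesis using N by blast
  qed
  have one_block: "\<phi> M = 0" if j: "j < m" and M: "size M = 4" "\<And>v. v \<in># M \<Longrightarrow> v < c \<or> v = y j \<or> v = z j" for j M
  proof -
    \<comment> \<open>Block 0 is fixed so that the \<open>t v\<close> do not move, and any other
      block j is reached from block 1. For j = 0 the value 1 keeps \<open>b\<close>
      injective.\<close>
    define b where "b = (\<lambda>i::nat. if i = 0 then 0 else if j = 0 then 1 else j)"
    have b: "inj_on b {..<k}" "\<And>i. i < k \<Longrightarrow> b i < m"
      using j k by (auto simp: b_def inj_on_def split: if_splits)
    have "\<exists>i<k. b i = j"
    proof (cases "j = 0")
      case True
      then show ?thesis using m k by (intro exI[of _ 0]) (simp add: b_def)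
    next
      case False
      then show ?thesis using j k by (intro exI[of _ 1]) (simp add: b_def)
    qed
    then obtain i where i: "i < k" "b i = j" by blast
    show ?thesis
    proof (rule step1[OF b _ _ M(1)])
      fix v assume "v < c + 2 * k"
      then show "\<phi> (image_mset (emb b) (add_mset v (t v))) = 0"
      proof (cases "v < c")
        case True
        have "image_mset (emb b) (t v) = t v"
          using t(1)[OF True]
        proof (cases rule: T_cases)
          case 1
          then show ?thesis by (intro image_emb_core) (use C_core in auto)
        qed (use pqr in \<open>auto simp: b_def\<close>)
        then show ?thesis using True s by simp
      next
        case False
        then have "c \<le> emb b v" using emb_core[of b v] by simp
        then have t0: "t v = t0" "t (emb b v) = t0" using False t(2) by simp_all
        have "\<phi> (add_mset (emb b v) (t (emb b v))) = 0"
          using s emb_less[where b = b, OF b(2) \<open>v < c + 2 * k\<close>] by blast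
        then show ?thesis by (simp add: t0 t0_core)
      qed
    next
      show "set_mset M \<subseteq> emb b ` {..<c + 2 * k}"
      proof
        fix v assume "v \<in># M"
        then consider "v < c" | "v = emb b (y i)" | "v = emb b (z i)" using M(2) i by auto
        then show "v \<in> emb b ` {..<c + 2 * k}"
        proof cases
          case 1
          then show ?thesis by (intro image_eqI[of _ _ v]) auto
        next
          case 2
          then show ?thesis using i by (intro image_eqI[of _ _ "y i"]) auto
        next
          case 3
          then show ?thesis using i by (intro image_eqI[of _ _ "z i"]) auto
        qed
      qed
    qed
  qed
  have two_blocks: "\<phi> M = 0"
    if b: "inj_on b {..<k}" "\<And>i. i < k \<Longrightarrow> b i < m"
      and M: "size M = 4" "set_mset M \<subseteq> emb b ` {..<c + 2 * k}" for b :: "nat \<Rightarrow> nat" and M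
  proof (rule step1[OF b _ M(2,1)])
    fix v assume v: "v < c + 2 * k"
    have k0: "0 < k" using m k by simp
    from v show "\<phi> (image_mset (emb b) (add_mset v (t v))) = 0"
    proof (cases rule: vertex_cases)
      case 1
      have sz: "size (t v) = 3" using t(1)[OF 1] T_sub by (auto simp: msets_def)
      have "w < c \<or> w = y 0 \<or> w = z 0" if "w \<in># t v" for w
        using t(1)[OF 1]
      proof (cases rule: T_cases)
        case 1
        then show ?thesis using C_core that by blast
      qed (use that pqr in auto)
      then have "emb b w < c \<or> emb b w = y (b 0) \<or> emb b w = z (b 0)" if "w \<in># t v" for w
        using that by (metis emb_simps)
      then show ?thesis
        using 1 sz by (intro one_block[OF b(2)[OF k0]]) auto
    next
      case (2 i)
      have "t v = t0" "size t0 = 3" using t(2,3) 2 C_sub by (auto simp: msets_def y_def)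
      then show ?thesis
        using 2 t0_core[of b] C_core[OF t(3)] by (intro one_block[OF b(2)[OF 2(1)]]) auto
    next
      case (3 i)
      have "t v = t0" "size t0 = 3" using t(2,3) 3 C_sub by (auto simp: msets_def z_def)
      then show ?thesis
        using 3 t0_core[of b] C_core[OF t(3)] by (intro one_block[OF b(2)[OF 3(1)]]) auto
    qed
  qed
  show ?thesis
  proof
    fix M assume M: "M \<in> msets (c + 2 * m) 4"
    then have size: "size M = 4" and Mn: "\<And>v. v \<in># M \<Longrightarrow> v < c + 2 * m" by (auto simp: msets_def)
    define J where "J = {j. y j \<in># M \<or> z j \<in># M}"
    have Jm: "j < m" if "j \<in> J" for j using that Mn[of "y j"] Mn[of "z j"] by (auto simp: J_def)
    \<comment> \<open>\<open>J\<close> is the set of blocks that M meets. Either it fits into the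
      range of an embedding of k blocks, or M meets three blocks.\<close>
    show "\<phi> M = 0"
    proof (cases "\<exists>b. inj_on b {..<k} \<and> (\<forall>i<k. b i < m) \<and> J \<subseteq> b ` {..<k}")
      case True
      then obtain b where b: "inj_on b {..<k}" "\<forall>i<k. b i < m" "J \<subseteq> b ` {..<k}" by blast
      have "v \<in> emb b ` {..<c + 2 * k}" if "v \<in># M" for v
        using Mn[OF that]
      proof (cases rule: vertex_cases)
        case 1
        then show ?thesis by (intro image_eqI[of _ _ v]) auto
      next
        case (2 j)
        then have "j \<in> b ` {..<k}" using b(3) that by (auto simp: J_def)
        then obtain i where "i < k" "j = b i" by blast
        then show ?thesis using 2 by (intro image_eqI[of _ _ "y i"]) auto
      next
        case (3 j)
        then have "j \<in> b ` {..<k}" using b(3) that by (auto simp: J_def)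
        then obtain i where "i < k" "j = b i" by blast
        then show ?thesis using 3 by (intro image_eqI[of _ _ "z i"]) auto
      qed
      then show ?thesis using two_blocks[of b M] b size by blast
    next
      case False
      have "\<exists>i j l. i \<in> J \<and> j \<in> J \<and> l \<in> J \<and> i \<noteq> j \<and> i \<noteq> l \<and> j \<noteq> l"
      proof (rule ccontr)
        assume no: "\<not> ?thesis"
        have "\<exists>b. inj_on b {..<k} \<and> (\<forall>i<k. b i < m) \<and> J \<subseteq> b ` {..<k}"
        proof (cases "m = 1")
          case True
          then show ?thesis using Jm k by (intro exI[of _ "\<lambda>i. 0"]) (auto simp: inj_on_def)
        next
          case False
          then have m2: "2 \<le> m" "k = 2" using m k by auto
          have "0 < m" using m2 by simp
          \<comment> \<open>If \<open>J\<close> has fewer than two elements, a and e are filled up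
            with arbitrary distinct blocks.\<close>
          then obtain a where a: "a < m" "J \<noteq> {} \<longrightarrow> a \<in> J" using Jm by blast
          obtain e where e: "e < m" "e \<noteq> a" "J - {a} \<noteq> {} \<longrightarrow> e \<in> J"
          proof (cases "J - {a} = {}")
            case True
            then show ?thesis using that[of "if a = 0 then 1 else 0"] m2 by auto
          qed (use that Jm in auto)
          have "J \<subseteq> {a, e}" using no a e by blast
          moreover have "{..<2} = {0, 1::nat}" by auto
          ultimately show ?thesis
            using a e m2 by (intro exI[of _ "\<lambda>i. if i = 0 then a else e"]) (auto simp: inj_on_def)
        qed
        then show False using False by blast
      qed
      then obtain i j l where ijl: "i \<in> J" "j \<in> J" "l \<in> J" "i \<noteq> j" "i \<noteq> l" "j \<noteq> l" by blast
      then obtain a b d where abd: "a \<in> {y i, z i}" "b \<in> {y j, z j}" "d \<in> {y l, z l}" "a \<in># M" "b \<in># M" "d \<in># M"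
        unfolding J_def by blast
      have ne: "a \<noteq> b" "a \<noteq> d" "b \<noteq> d" using abd ijl by auto
      obtain M1 where M1: "M = add_mset a M1" using abd(4) by (metis insert_DiffM)
      then have "b \<in># M1" "d \<in># M1" using abd ne by auto
      then obtain M2 where M2: "M1 = add_mset b M2" by (metis insert_DiffM)
      then have "d \<in># M2" using \<open>d \<in># M1\<close> ne by auto
      then obtain M3 where M3: "M2 = add_mset d M3" by (metis insert_DiffM)
      then have "size M3 = 1" using size M1 M2 by simp
      then obtain x where x: "M3 = {#x#}" using size_1_singleton_mset by blast
      have "x < c + 2 * m" using Mn M1 M2 M3 x by auto
      then show ?thesis
        using three_blocks[OF \<phi> Jm Jm Jm, OF ijl abd(1-3)] M1 M2 M3 x by simp
    qed
  qed
qed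

end

section \<open>The design axioms for a core with blocks\<close>

context block_design
begin

text \<open>The triple \<open>t v\<close> offers two different vertices a with va uncovered. Two are
  asked for because \<open>s_split\<close> concerns every variable i: the one different from i is
  split off together with v, and i joined to the rest of \<open>t v\<close> is not a triple, since a
  already completes that rest. The representative pair of a block vertex is q with its partner,
  which is v + 1 for a y and v - 1 for a z.\<close>

lemma triple_design_blocks:
  fixes f0 :: "nat monomial \<Rightarrow> 'k::field"
  assumes m: "1 \<le> m"
    and base: "\<And>\<psi> :: nat multiset \<Rightarrow> 'k. kills_square (c + 2 * min m 2) (T (min m 2)) \<psi> \<Longrightarrow>
      \<forall>v<c + 2 * min m 2. \<psi> (add_mset v (t v)) = 0 \<Longrightarrow> \<forall>M\<in>msets (c + 2 * min m 2) 4. \<psi> M = 0"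
    and t: "\<And>v. v < c \<Longrightarrow> t v \<in> T 1" "\<And>v. c \<le> v \<Longrightarrow> t v = t0" "t0 \<in> C"
    and split_core: "\<And>v. v < c \<Longrightarrow> \<exists>a a'. a \<noteq> a' \<and> a \<in># t v \<and> a' \<in># t v \<and>
      uncovered (c + 2) (T 1) {#v, a#} \<and> uncovered (c + 2) (T 1) {#v, a'#}"
    and split_y: "\<exists>a a'. a \<noteq> a' \<and> a \<in># t0 \<and> a' \<in># t0 \<and> a \<notin> {p, q} \<and> a' \<notin> {p, q}"
    and split_z: "\<exists>a a'. a \<noteq> a' \<and> a \<in># t0 \<and> a' \<in># t0 \<and> a \<notin> {q, r} \<and> a' \<notin> {q, r}"
    and \<beta>: "\<And>v. v < c \<Longrightarrow> add_mset v (\<beta> v) \<in> C"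
    and f0: "\<And>M. f0 (monom_of M) = (if M \<in> T m then 1 else 0)"
  shows "triple_design (c + 2 * m) (T m)
    (\<lambda>v. if v < c then \<beta> v else if even (v - c) then {#q, v + 1#} else {#q, v - 1#})
    (\<lambda>v. add_mset v (t v)) f0"
proof -
  let ?n = "c + 2 * m"
  have T1: "M \<in> T m" if "M \<in> T 1" for M using that m by (auto simp: T_def)
  have tT: "t v \<in> T m" for v
    using T1[OF t(1), of v] t(2,3) by (cases "v < c") (auto simp: T_def)
  have t3: "t v \<in> msets ?n 3" for v using tT T_sub by blast
  have split: "\<exists>a a'. a \<noteq> a' \<and> a \<in># t v \<and> a' \<in># t v \<and> uncovered ?n (T m) {#v, a#} \<and> uncovered ?n (T m) {#v, a'#}"
    if "v < ?n" for v
    using that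
  proof (cases rule: vertex_cases)
    case 1
    obtain a a' where a: "a \<noteq> a'" "a \<in># t v" "a' \<in># t v" "uncovered (c + 2) (T 1) {#v, a#}"
      "uncovered (c + 2) (T 1) {#v, a'#}"
      using split_core[OF 1] by blast
    \<comment> \<open>A triple of \<open>T 1\<close> uses only the core and block 0, which the
      constant map 0 fixes; so uncovered pairs carry over from one block to m blocks.\<close>
    have fixed: "emb (\<lambda>i. 0) x = x" if "x \<in># t v" for x
      using t(1)[OF 1]
    proof (cases rule: T_cases)
      case 1
      then show ?thesis using C_core that by simp
    qed (use that pqr in auto)
    have "uncovered ?n (T m) {#v, x#}" if x: "x \<in># t v" "uncovered (c + 2) (T 1) {#v, x#}" for x
    proof -
      have "uncovered ?n (T m) (image_mset (emb (\<lambda>i. 0)) {#v, x#})"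
        using x(2) m by (intro emb_uncovered[where k = 1]) (auto simp: inj_on_def)
      then show ?thesis using 1 fixed[OF x(1)] by simp
    qed
    then show ?thesis using a by blast
  next
    case (2 j)
    then have "t v = t0" using t(2)[of v] by (simp add: y_def)
    moreover have "uncovered ?n (T m) {#v, a#}" if "a \<in># t0" "a \<notin> {p, q}" for a
      using uncovered_y[OF 2(1), of a] that C_core[OF t(3)] 2 by (simp add: add_mset_commute)
    ultimately show ?thesis using split_y by metis
  next
    case (3 j)
    then have "t v = t0" using t(2)[of v] by (simp add: z_def)
    moreover have "uncovered ?n (T m) {#v, a#}" if "a \<in># t0" "a \<notin> {q, r}" for a
      using uncovered_z[OF 3(1), of a] that C_core[OF t(3)] 3 by (simp add: add_mset_commute)
    ultimately show ?thesis using split_z by metis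
  qed
  have uncov: "add_mset w P \<notin> T m" if "uncovered ?n (T m) P" for w P
    using that by (simp add: uncovered_def)
  \<comment> \<open>If v were in \<open>t v\<close>, that triple would contain v together with some
    a different from v for which va is uncovered.\<close>
  have notin: "v \<notin># t v" if vn: "v < ?n" for v
  proof
    assume v: "v \<in># t v"
    obtain a where a: "a \<noteq> v" "a \<in># t v" "uncovered ?n (T m) {#v, a#}" using split[OF vn] by metis
    obtain R where R: "t v = add_mset v R" using v by (metis insert_DiffM)
    then have "a \<in># R" using a by auto
    then obtain R' where "R = add_mset a R'" by (metis insert_DiffM)
    moreover from this have "size R' = 1" using t3[of v] R by (auto simp: msets_def)
    then obtain w where "R' = {#w#}" using size_1_singleton_mset by blast
    ultimately have "t v = add_mset w {#v, a#}" using R by (simp add: add_mset_commute)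
    then show False using uncov[OF a(3)] tT[of v] by simp
  qed
  show ?thesis
  proof
    show "0 < ?n" using m by simp
    show "T m \<subseteq> msets ?n 3" by (rule T_sub)
    show "f0 (monom_of M) = (if M \<in> T m then 1 else 0)" for M by (rule f0)
  next
    fix v w P assume "add_mset v P \<in> T m" "add_mset w P \<in> T m"
    then show "v = w" by (rule T_unique)
  next
    fix v assume "v < ?n"
    then show "add_mset v (if v < c then \<beta> v else if even (v - c) then {#q, v + 1#} else {#q, v - 1#}) \<in> T m"
    proof (cases rule: vertex_cases)
      case 1
      then show ?thesis using \<beta> by (simp add: T_def)
    next
      case (2 j)
      have "add_mset (y j) {#q, z j#} \<in> T m" using T_blocks(1)[OF 2(1)] by (simp add: add_mset_commute)
      then show ?thesis using 2 by (simp add: y_def z_def)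
    next
      case (3 j)
      have "add_mset (z j) {#q, y j#} = {#q, y j, z j#}" by (simp add: add_mset_commute)
      then have "add_mset (z j) {#q, y j#} \<in> T m" using T_blocks(1)[OF 3(1)] by metis
      then show ?thesis using 3 by (simp add: y_def z_def)
    qed
  next
    fix v assume "v < ?n"
    then show "add_mset v (t v) \<in> msets ?n 4" using t3[of v] by (auto simp: msets_def)
  next
    fix i v assume iv: "i < ?n" "v < ?n"
    show "(if i \<in># add_mset v (t v) \<and> add_mset v (t v) - {#i#} \<in> T m then count (add_mset v (t v)) i else 0) =
        (if i = v then 1 else 0)"
    proof (cases "i = v")
      case True
      then show ?thesis using notin[OF iv(2)] tT[of v] by (simp add: not_in_iff)
    next
      case False
      \<comment> \<open>Replacing i by v in \<open>t v\<close> keeps two vertices that i already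
        completes, so the result is not a triple.\<close>
      have "add_mset v (t v) - {#i#} \<notin> T m" if i: "i \<in># t v"
      proof -
        obtain R where R: "t v = add_mset i R" using multi_member_split[OF i] by blast
        have eq: "add_mset v (t v) = add_mset i (add_mset v R)"
          unfolding R by (rule add_mset_commute)
        have "add_mset v (t v) - {#i#} = add_mset v R" unfolding eq by simp
        moreover have "add_mset v R \<notin> T m" using T_unique[of i R m v] tT[of v] False unfolding R by blast
        ultimately show ?thesis by simp
      qed
      moreover have "i \<in># add_mset v (t v) \<longleftrightarrow> i \<in># t v" using False by simp
      ultimately have "\<not> (i \<in># add_mset v (t v) \<and> add_mset v (t v) - {#i#} \<in> T m)" by blast
      then show ?thesis unfolding if_not_P[OF False] by (rule if_not_P)
    qed
  next
    fix i v assume iv: "i < ?n" "v < ?n"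
    obtain a where a: "a \<noteq> i" "a \<in># t v" "uncovered ?n (T m) {#v, a#}" using split[OF iv(2)] by metis
    obtain R where R: "t v = add_mset a R" using multi_member_split[OF a(2)] by blast
    have "add_mset i (add_mset v (t v)) = {#v, a#} + add_mset i R"
      by (simp add: R)
    moreover have "add_mset i R \<in> msets ?n 3" using t3[of v] R iv by (auto simp: msets_def)
    moreover have "add_mset i R \<notin> T m" using T_unique[of i R m a] tT[of v] a(1) unfolding R by blast
    ultimately show "\<exists>P N. add_mset i (add_mset v (t v)) = P + N \<and> uncovered ?n (T m) P \<and>
        N \<in> msets ?n 3 \<and> N \<notin> T m"
      using a(3) by blast
  next
    fix \<psi> :: "nat multiset \<Rightarrow> 'k"
    assume "kills_square ?n (T m) \<psi>" "\<forall>v<?n. \<psi> (add_mset v (t v)) = 0"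
    then show "\<forall>M\<in>msets ?n 4. \<psi> M = 0"
      by (intro quartics_from_two_blocks[OF m refl _ base t]) auto
  qed
qed

end

section \<open>Propagation of zeros\<close>

text \<open>Conjunctions and disjunctions are written as conditionals so that the simplifier evaluates them
  lazily.\<close>

type_synonym vpair = "nat \<times> nat"

fun member :: "'a \<Rightarrow> 'a list \<Rightarrow> bool" where
  "member x [] = False"
| "member x (y # ys) = (if x = y then True else member x ys)"

text \<open>A link is the list of pairs with a common third vertex; that vertex is not recorded, as
  trades only exchange pairs of one link. The default \<open>[]\<close> encodes that p is
  uncovered.\<close>

fun link_of :: "vpair list list \<Rightarrow> vpair \<Rightarrow> vpair list" where
  "link_of [] p = []"
| "link_of (l # Ls) p = (if member p l then l else link_of Ls p)"

fun insert_sorted :: "nat \<Rightarrow> nat list \<Rightarrow> nat list" where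
  "insert_sorted x [] = [x]"
| "insert_sorted x (y # ys) = (if x \<le> y then x # y # ys else y # insert_sorted x ys)"

text \<open>For ordered pairs the result is sorted, so monomials are compared as lists.\<close>

fun quad :: "vpair \<Rightarrow> vpair \<Rightarrow> nat list" where
  "quad (a, b) (c, d) = insert_sorted a (insert_sorted b [c, d])"

fun splits :: "nat list \<Rightarrow> (vpair \<times> vpair) list" where
  "splits [a, b, c, d] =
    [((a, b), (c, d)), ((c, d), (a, b)), ((a, c), (b, d)), ((b, d), (a, c)), ((a, d), (b, c)), ((b, c), (a, d))]"
| "splits _ = []"

fun any_pair :: "(nat list \<Rightarrow> bool) \<Rightarrow> vpair \<Rightarrow> vpair list \<Rightarrow> bool" where
  "any_pair f p [] = False"
| "any_pair f p (q # qs) = (if f (quad p q) then True else any_pair f p qs)"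

text \<open>\<open>K p = []\<close> says that p is uncovered. A split succeeds if q is uncovered
  too, or if q can be traded within its link for a pair whose product with p passes the test
  f.\<close>

fun any_split :: "(nat list \<Rightarrow> bool) \<Rightarrow> (vpair \<Rightarrow> vpair list) \<Rightarrow> (vpair \<times> vpair) list \<Rightarrow> bool" where
  "any_split f K [] = False"
| "any_split f K ((p, q) # xs) =
    (if K p = [] then
      if K q = [] then True else if any_pair f p (K q) then True else any_split f K xs
    else any_split f K xs)"

text \<open>The number bounds the nested trades; at 0 only the list \<open>Z\<close> of monomials
  already known to vanish is consulted.\<close>

primrec vanishes_at :: "nat \<Rightarrow> (vpair \<Rightarrow> vpair list) \<Rightarrow> nat list list \<Rightarrow> nat list \<Rightarrow> bool" where
  "vanishes_at 0 K Z m = member m Z"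
| "vanishes_at (Suc k) K Z m =
    (if member m Z then True else any_split (vanishes_at k K Z) K (splits m))"

definition vanishes :: "(vpair \<Rightarrow> vpair list) \<Rightarrow> nat list list \<Rightarrow> nat list \<Rightarrow> bool" where
  "vanishes = vanishes_at (Suc (Suc 0))"

fun ordered :: "nat \<Rightarrow> vpair \<Rightarrow> bool" where
  "ordered n (a, b) = (if a \<le> b then b < n else False)"

text \<open>A step (p, p', q, q') derives that the functional vanishes at p + q, from the relation between
  p and p' with q and q', where p = p' stands for a single uncovered pair p.\<close>

definition step_ok :: "nat \<Rightarrow> (vpair \<Rightarrow> vpair list) \<Rightarrow> nat list list \<Rightarrow> vpair \<Rightarrow> vpair \<Rightarrow> vpair \<Rightarrow> vpair \<Rightarrow> bool" where
  "step_ok n K Z p p' q q' =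
    (if member q' (K q) then
      if p = p' then
        if ordered n p then if K p = [] then vanishes K Z (quad p q') else False else False
      else if member p' (K p) then
        if vanishes K Z (quad p q') then
          if vanishes K Z (quad p' q) then
            if quad p' q' = quad p q then True else vanishes K Z (quad p' q')
          else False
        else False
      else False
    else False)"

text \<open>Runs through all sorted continuations of \<open>xs\<close> by k entries from a to n - 1,
  as a recursion that rewriting can evaluate.\<close>

function all_sorted :: "nat \<Rightarrow> (nat list \<Rightarrow> bool) \<Rightarrow> nat list \<Rightarrow> nat \<Rightarrow> nat \<Rightarrow> bool" where
  "all_sorted 0 f xs a n = f xs"
| "all_sorted (Suc k) f xs a n =
    (if a < n then if all_sorted k f (xs @ [a]) a n then all_sorted (Suc k) f xs (Suc a) n else False
     else True)"
  by pat_completeness auto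
termination by (relation "measure (\<lambda>(k, f, xs, a, n). k + (n - a))") auto

declare all_sorted.simps(2) [simp del]

text \<open>Each step of the certificate adds one vanishing monomial to \<open>Z\<close>; after the
  last one, every quartic monomial must pass the bounded search by trades.\<close>

fun propagate :: "nat \<Rightarrow> (vpair \<Rightarrow> vpair list) \<Rightarrow> nat list list \<Rightarrow> (vpair \<times> vpair \<times> vpair \<times> vpair) list \<Rightarrow> bool" where
  "propagate n K Z [] = all_sorted (Suc (Suc (Suc (Suc 0)))) (vanishes K Z) [] 0 n"
| "propagate n K Z ((p, p', q, q') # steps) =
    (if step_ok n K Z p p' q q' then propagate n K (quad p q # Z) steps else False)"

lemmas propagate_simps = propagate.simps step_ok_def ordered.simps vanishes_def vanishes_at.simps any_split.simps any_pair.simps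
  all_sorted.simps splits.simps quad.simps insert_sorted.simps link_of.simps member.simps
  prod.inject list.inject list.distinct append.simps simp_thms if_True if_False
  nat.inject nat.distinct Suc_le_mono le0 le_zero_eq Suc_less_eq zero_less_Suc not_less_zero
  eval_nat_numeral BitM.simps One_nat_def

text \<open>The list Ls holds, for each vertex, the pairs that form a triple with it.\<close>

definition links_valid :: "nat \<Rightarrow> nat multiset set \<Rightarrow> vpair list list \<Rightarrow> bool" where
  "links_valid n T Ls \<longleftrightarrow> T \<subseteq> msets n 3 \<and>
    (\<forall>l\<in>set Ls. \<exists>v. \<forall>(a, b)\<in>set l. a \<le> b \<and> {#v, a, b#} \<in> T) \<and>
    (\<forall>v a b. a \<le> b \<longrightarrow> {#v, a, b#} \<in> T \<longrightarrow> (\<exists>l\<in>set Ls. (a, b) \<in> set l))"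

definition pair_mset :: "vpair \<Rightarrow> nat multiset" where
  "pair_mset p = {#fst p, snd p#}"

section \<open>Soundness of the evaluated checks\<close>

lemma member_iff [simp]: "member x xs \<longleftrightarrow> x \<in> set xs"
  by (induction xs) auto

lemma link_of_empty: "link_of Ls p = [] \<Longrightarrow> l \<in> set Ls \<Longrightarrow> p \<notin> set l"
  by (induction Ls) (auto split: if_splits)

lemma link_of_in: "p' \<in> set (link_of Ls p) \<Longrightarrow> \<exists>l\<in>set Ls. p \<in> set l \<and> p' \<in> set l"
  by (induction Ls) (auto split: if_splits)

lemma mset_insert_sorted [simp]: "mset (insert_sorted x xs) = add_mset x (mset xs)"
  by (induction xs) auto

lemma set_insert_sorted [simp]: "set (insert_sorted x xs) = insert x (set xs)"
  by (induction xs) auto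

lemma sorted_insert_sorted: "sorted xs \<Longrightarrow> sorted (insert_sorted x xs)"
  by (induction xs) auto

lemma mset_quad: "mset (quad p q) = pair_mset p + pair_mset q"
  by (cases p; cases q) (simp add: pair_mset_def)

lemma any_pair_iff: "any_pair f p qs \<longleftrightarrow> (\<exists>q\<in>set qs. f (quad p q))"
  by (induction qs) auto

lemma any_splitD: "any_split f K xs \<Longrightarrow>
    \<exists>(p, q)\<in>set xs. K p = [] \<and> (K q = [] \<or> (\<exists>q'\<in>set (K q). f (quad p q')))"
  by (induction xs) (auto simp: any_pair_iff split: if_splits)

lemma all_sorted_Suc:
  assumes "all_sorted (Suc k) f xs a n" "a < n"
  shows "all_sorted k f (xs @ [a]) a n" "all_sorted (Suc k) f xs (Suc a) n"
  using assms(1) unfolding all_sorted.simps(2)[of k f xs a n] using assms(2) by (auto split: if_splits)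

lemma all_sorted_later:
  assumes "all_sorted (Suc k) f xs a n" "a \<le> b" "b < n"
  shows "all_sorted (Suc k) f xs b n"
  using assms(2,3)
proof (induction b rule: dec_induct)
  case (step b)
  then show ?case using all_sorted_Suc(2)[of k f xs b n] by simp
qed (rule assms(1))

lemma all_sortedD:
  "all_sorted k f xs a n \<Longrightarrow> length ys = k \<Longrightarrow> sorted ys \<Longrightarrow> set ys \<subseteq> {a..<n} \<Longrightarrow> f (xs @ ys)"
proof (induction k arbitrary: xs a ys)
  case (Suc k)
  obtain b zs where ys: "ys = b # zs" using Suc.prems(2) by (cases ys) auto
  then have b: "a \<le> b" "b < n" using Suc.prems(4) by auto
  have "all_sorted k f (xs @ [b]) b n"
    by (rule all_sorted_Suc(1)[OF all_sorted_later[OF Suc.prems(1) b] b(2)])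
  then have "f ((xs @ [b]) @ zs)"
    by (rule Suc.IH) (use Suc.prems ys in auto)
  then show ?case by (simp add: ys)
qed simp

context
  fixes n :: nat and T :: "nat multiset set" and Ls :: "vpair list list"
    and \<phi> :: "nat multiset \<Rightarrow> 'k::field_char_0"
  assumes \<phi>: "kills_square n T \<phi>" and Ls: "links_valid n T Ls"
begin

lemma link_of_triple:
  assumes "p' \<in> set (link_of Ls p)"
  obtains v where "add_mset v (pair_mset p) \<in> T" "add_mset v (pair_mset p') \<in> T" "ordered n p" "ordered n p'"
proof -
  obtain l where l: "l \<in> set Ls" "p \<in> set l" "p' \<in> set l" using link_of_in[OF assms] by blast
  then obtain v where v: "\<forall>(a, b)\<in>set l. a \<le> b \<and> {#v, a, b#} \<in> T"
    using Ls unfolding links_valid_def by blast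
  have "add_mset v (pair_mset x) \<in> T \<and> ordered n x" if "x \<in> set l" for x
  proof -
    obtain a b where x: "x = (a, b)" by (cases x)
    then have "a \<le> b" "{#v, a, b#} \<in> T" using v that by auto
    moreover from this have "{#v, a, b#} \<in> msets n 3" using Ls unfolding links_valid_def by blast
    ultimately show ?thesis by (simp add: x pair_mset_def msets_def)
  qed
  then show ?thesis using that l by blast
qed

lemma link_of_uncovered:
  assumes "link_of Ls p = []" "ordered n p"
  shows "uncovered n T (pair_mset p)"
proof -
  obtain a b where p: "p = (a, b)" by (cases p)
  then have ab: "a \<le> b" "b < n" using assms(2) by (auto split: if_splits)
  have "add_mset v {#a, b#} \<notin> T" for v
    using ab Ls link_of_empty[OF assms(1)] unfolding links_valid_def p by blast
  then show ?thesis using ab by (auto simp: uncovered_def p pair_mset_def msets_def)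
qed

lemma zero_UC:
  assumes "link_of Ls p = []" "ordered n p" "q' \<in> set (link_of Ls q)" "\<phi> (mset (quad p q')) = 0"
  shows "\<phi> (pair_mset p + pair_mset q) = 0"
proof -
  obtain v where "add_mset v (pair_mset q) \<in> T" "add_mset v (pair_mset q') \<in> T"
    using link_of_triple[OF assms(3)] by blast
  then have "\<phi> (pair_mset p + pair_mset q) = \<phi> (pair_mset p + pair_mset q')"
    using \<phi> link_of_uncovered[OF assms(1,2)] unfolding kills_square_def by blast
  then show ?thesis using assms(4) by (simp add: mset_quad)
qed

lemma quad_good:
  assumes "ordered n p" "ordered n q"
  shows "length (quad p q) = 4" "sorted (quad p q)" "set (quad p q) \<subseteq> {..<n}"
proof -
  obtain a b c d where pq: "p = (a, b)" "q = (c, d)" by (cases p; cases q)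
  then have le: "a \<le> b" "b < n" "c \<le> d" "d < n" using assms by (auto split: if_splits)
  have "size (mset (quad p q)) = 4" by (simp add: mset_quad pair_mset_def)
  then show "length (quad p q) = 4" by simp
  show "sorted (quad p q)" using le by (simp add: pq sorted_insert_sorted)
  show "set (quad p q) \<subseteq> {..<n}" using le by (auto simp: pq)
qed

lemma vanishes_at_sound:
  assumes "\<forall>m\<in>set Z. \<phi> (mset m) = 0"
  shows "vanishes_at k (link_of Ls) Z m \<Longrightarrow> length m = 4 \<Longrightarrow> sorted m \<Longrightarrow> set m \<subseteq> {..<n} \<Longrightarrow> \<phi> (mset m) = 0"
proof (induction k arbitrary: m)
  case 0
  then show ?case using assms by simp
next
  case (Suc k)
  show ?case
  proof (cases "m \<in> set Z")
    case False
    then have "any_split (vanishes_at k (link_of Ls) Z) (link_of Ls) (splits m)"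
      using Suc.prems(1) by simp
    from any_splitD[OF this] obtain p q where pq: "(p, q) \<in> set (splits m)" "link_of Ls p = []"
      "link_of Ls q = [] \<or> (\<exists>q'\<in>set (link_of Ls q). vanishes_at k (link_of Ls) Z (quad p q'))"
      by blast
    obtain a b c d where m: "m = [a, b, c, d]"
      using Suc.prems(2) by (auto simp: numeral_eq_Suc length_Suc_conv)
    have ord: "ordered n p" "ordered n q"
      using pq(1) Suc.prems(3,4) by (auto simp: m)
    have sum: "mset m = pair_mset p + pair_mset q"
      using pq(1) by (auto simp: m pair_mset_def)
    show ?thesis
    proof (cases "link_of Ls q = []")
      case True
      then show ?thesis
        using \<phi> link_of_uncovered[OF pq(2) ord(1)] link_of_uncovered[OF True ord(2)]
        unfolding kills_square_def sum by blast
    next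
      case False
      then obtain q' where q': "q' \<in> set (link_of Ls q)" "vanishes_at k (link_of Ls) Z (quad p q')"
        using pq(3) by blast
      then have "ordered n q'" using link_of_triple by blast
      then have "\<phi> (mset (quad p q')) = 0"
        using Suc.IH[OF q'(2)] quad_good[OF ord(1)] by blast
      then show ?thesis unfolding sum using zero_UC pq(2) ord(1) q'(1) by blast
    qed
  qed (use assms in simp)
qed

lemma vanishes_sound:
  assumes "\<forall>m\<in>set Z. \<phi> (mset m) = 0" "vanishes (link_of Ls) Z (quad p q)" "ordered n p" "ordered n q"
  shows "\<phi> (pair_mset p + pair_mset q) = 0"
  using vanishes_at_sound[OF assms(1) assms(2)[unfolded vanishes_def] quad_good[OF assms(3,4)]]
  by (simp add: mset_quad)

text \<open>The exchange relation ties together the four products of p, p' with q, q', so p + q is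
  zero if the other three are. If p + q and p' + q' are the same monomial, the relation reads 2
  times its value equals 0, and 2 is invertible in characteristic 0. For p = p' a single trade of q
  suffices.\<close>

lemma step_sound:
  assumes Z: "\<forall>m\<in>set Z. \<phi> (mset m) = 0" and ok: "step_ok n (link_of Ls) Z p p' q q'"
  shows "\<phi> (mset (quad p q)) = 0"
proof -
  have q': "q' \<in> set (link_of Ls q)" using ok by (auto simp: step_ok_def split: if_splits)
  then obtain w where w: "add_mset w (pair_mset q) \<in> T" "add_mset w (pair_mset q') \<in> T" "ordered n q" "ordered n q'"
    using link_of_triple by blast
  show ?thesis
  proof (cases "p = p'")
    case True
    then have *: "ordered n p" "link_of Ls p = []" "vanishes (link_of Ls) Z (quad p q')"
      using ok by (auto simp: step_ok_def split: if_splits)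
    have "\<phi> (mset (quad p q')) = 0" using vanishes_sound[OF Z *(3,1) w(4)] by (simp add: mset_quad)
    then show ?thesis using zero_UC[OF *(2,1) q'] by (simp add: mset_quad)
  next
    case False
    then have *: "p' \<in> set (link_of Ls p)" "vanishes (link_of Ls) Z (quad p q')" "vanishes (link_of Ls) Z (quad p' q)"
      "quad p' q' = quad p q \<or> vanishes (link_of Ls) Z (quad p' q')"
      using ok by (auto simp: step_ok_def split: if_splits)
    obtain v where v: "add_mset v (pair_mset p) \<in> T" "add_mset v (pair_mset p') \<in> T" "ordered n p" "ordered n p'"
      using link_of_triple[OF *(1)] by blast
    have "\<phi> (pair_mset p + pair_mset q) + \<phi> (pair_mset p' + pair_mset q') =
        \<phi> (pair_mset p + pair_mset q') + \<phi> (pair_mset p' + pair_mset q)"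
      using \<phi> v(1,2) w(1,2) unfolding kills_square_def by blast
    also have "\<dots> = 0"
      using vanishes_sound[OF Z *(2) v(3) w(4)] vanishes_sound[OF Z *(3) v(4) w(3)] by simp
    finally have sum: "\<phi> (mset (quad p q)) + \<phi> (mset (quad p' q')) = 0" by (simp add: mset_quad)
    show ?thesis
    proof (cases "quad p' q' = quad p q")
      case True
      then have "2 * \<phi> (mset (quad p q)) = 0" using sum by simp
      then show ?thesis by simp
    next
      case False
      then have "\<phi> (mset (quad p' q')) = 0"
        using vanishes_sound[OF Z _ v(4) w(4)] *(4) by (simp add: mset_quad)
      then show ?thesis using sum by simp
    qed
  qed
qed

lemma propagate_sound:
  "propagate n (link_of Ls) Z steps \<Longrightarrow> \<forall>m\<in>set Z. \<phi> (mset m) = 0 \<Longrightarrow> M \<in> msets n 4 \<Longrightarrow> \<phi> M = 0"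
proof (induction steps arbitrary: Z)
  case Nil
  let ?m = "sorted_list_of_multiset M"
  have m: "mset ?m = M" "sorted ?m" by simp_all
  then have "length ?m = 4" "set ?m \<subseteq> {..<n}"
    using Nil(3) by (auto simp: msets_def simp flip: size_mset)
  then have "vanishes (link_of Ls) Z ?m"
    using all_sortedD[of "Suc (Suc (Suc (Suc 0)))" "vanishes (link_of Ls) Z" "[]" 0 n ?m] Nil(1) m(2)
    by (simp add: atLeast0LessThan)
  then have "\<phi> (mset ?m) = 0"
    using vanishes_at_sound[OF Nil(2)] m(2) \<open>length ?m = 4\<close> \<open>set ?m \<subseteq> {..<n}\<close> unfolding vanishes_def by blast
  then show ?case by simp
next
  case (Cons step steps)
  obtain p p' q q' where step: "step = (p, p', q, q')" by (cases step)
  then have *: "step_ok n (link_of Ls) Z p p' q q'" "propagate n (link_of Ls) (quad p q # Z) steps"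
    using Cons.prems(1) by (auto split: if_splits)
  have "\<phi> (mset (quad p q)) = 0" by (rule step_sound[OF Cons.prems(2) *(1)])
  then show ?case using Cons.IH[OF *(2)] Cons.prems(2,3) by auto
qed

end

section \<open>Certificates in 6, 8 and 9 variables\<close>

definition links6 :: "vpair list list" where
  "links6 = [
    [(0,0), (1,1), (4,5)], [(0,1), (2,3)], [(1,3), (4,4)], [(1,2), (5,5)], [(0,5), (2,4)],
    [(0,4), (3,5)]]"

text \<open>The list at position v of \<open>links6\<close> is the link of vertex v. In the first
  step 0015 is written as 01 times 05; its companions 0124, 0235 and 2234 split into the uncovered
  pairs 02 and 14, 03 and 25, 22 and 34, so 0015 vanishes as well. The order matters, since a step
  may use the monomials obtained before it.\<close>

definition steps6 :: "(vpair \<times> vpair \<times> vpair \<times> vpair) list" where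
  "steps6 = [
    ((0,1), (2,3), (0,5), (2,4)), ((0,1), (2,3), (0,4), (3,5)), ((2,3), (0,1), (1,3), (4,4)),
    ((2,3), (0,1), (1,2), (5,5)), ((0,0), (4,5), (0,1), (2,3)), ((0,0), (1,1), (0,5), (2,4)),
    ((4,5), (0,0), (0,5), (2,4)), ((0,0), (1,1), (0,4), (3,5)), ((4,5), (0,0), (0,4), (3,5)),
    ((0,1), (2,3), (0,1), (2,3)), ((4,4), (1,3), (4,4), (1,3)), ((4,4), (1,3), (2,4), (0,5)),
    ((5,5), (1,2), (5,5), (1,2)), ((5,5), (1,2), (3,5), (0,4)), ((0,5), (2,4), (0,5), (2,4)),
    ((1,1), (0,0), (1,2), (5,5)), ((4,5), (0,0), (5,5), (1,2)), ((0,5), (2,4), (0,4), (3,5)),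
    ((0,0), (1,1), (0,0), (4,5)), ((1,1), (0,0), (1,1), (0,0)), ((4,5), (0,0), (4,5), (0,0)),
    ((1,3), (4,4), (1,2), (5,5)), ((1,1), (0,0), (0,1), (2,3)), ((0,4), (3,5), (0,4), (3,5)),
    ((1,1), (0,0), (1,3), (4,4)), ((4,5), (0,0), (4,4), (1,3)), ((2,2), (2,2), (0,4), (3,5)),
    ((5,5), (1,2), (0,5), (2,4)), ((2,5), (2,5), (0,5), (2,4)), ((3,3), (3,3), (0,5), (2,4)),
    ((4,4), (1,3), (0,4), (3,5)), ((3,4), (3,4), (0,4), (3,5)), ((1,4), (1,4), (4,4), (1,3)),
    ((1,5), (1,5), (5,5), (1,2))]"

lemma propagate6: "propagate 6 (link_of links6)
    [[0,1,2,3], [0,1,4,5], [0,2,4,5], [0,3,4,5], [1,2,3,4], [1,2,3,5]] steps6"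
  \<comment> \<open>The table stays folded as an argument and is unfolded only where it is applied
    to a pair; \<open>if_weak_cong\<close> keeps the branches of a conditional untouched until its
    condition is decided.\<close>
  by (simp only: propagate_simps arg_cong[OF links6_def, of link_of, THEN fun_cong]
      steps6_def cong: if_weak_cong)

definition links8 :: "vpair list list" where
  "links8 = [
    [(0,0), (1,1), (4,5), (6,7)], [(0,1), (2,3)], [(1,3), (4,4), (6,6)], [(1,2), (5,5), (7,7)],
    [(0,5), (2,4)], [(0,4), (3,5)], [(0,7), (2,6)], [(0,6), (3,7)]]"

definition steps8 :: "(vpair \<times> vpair \<times> vpair \<times> vpair) list" where
  "steps8 = [
    ((6,7), (4,5), (0,1), (2,3)), ((2,3), (0,1), (1,3), (4,4)), ((2,3), (0,1), (1,2), (5,5)),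
    ((1,1), (4,5), (1,1), (6,7)), ((4,5), (1,1), (4,5), (1,1)), ((6,7), (1,1), (6,7), (1,1)),
    ((0,0), (4,5), (0,1), (2,3)), ((0,0), (4,5), (6,6), (1,3)), ((1,1), (0,0), (1,3), (6,6)),
    ((0,0), (1,1), (4,4), (1,3)), ((4,5), (0,0), (4,4), (1,3)), ((6,7), (0,0), (6,6), (1,3)),
    ((0,0), (4,5), (7,7), (1,2)), ((1,1), (0,0), (1,2), (7,7)), ((0,0), (1,1), (5,5), (1,2)),
    ((4,5), (0,0), (5,5), (1,2)), ((6,7), (0,0), (7,7), (1,2)), ((0,0), (1,1), (0,5), (2,4)),
    ((4,5), (0,0), (0,5), (2,4)), ((0,0), (1,1), (0,4), (3,5)), ((4,5), (0,0), (0,4), (3,5)),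
    ((0,0), (1,1), (0,7), (2,6)), ((6,7), (0,0), (0,7), (2,6)), ((0,0), (1,1), (0,6), (3,7)),
    ((6,7), (0,0), (0,6), (3,7)), ((0,1), (2,3), (0,1), (2,3)), ((0,0), (1,1), (0,0), (1,1)),
    ((0,0), (1,1), (4,5), (0,0)), ((0,0), (1,1), (6,7), (0,0)), ((4,4), (1,3), (4,4), (1,3)),
    ((6,6), (1,3), (6,6), (1,3)), ((1,3), (4,4), (1,2), (5,5)), ((1,1), (0,0), (0,1), (2,3)),
    ((4,4), (1,3), (2,4), (0,5)), ((6,6), (1,3), (2,4), (0,5)), ((4,4), (1,3), (0,4), (3,5)),
    ((4,4), (1,3), (2,6), (0,7)), ((6,6), (1,3), (2,6), (0,7)), ((6,6), (1,3), (0,6), (3,7)),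
    ((5,5), (1,2), (5,5), (1,2)), ((7,7), (1,2), (7,7), (1,2)), ((5,5), (1,2), (0,5), (2,4)),
    ((5,5), (1,2), (3,5), (0,4)), ((7,7), (1,2), (3,5), (0,4)), ((7,7), (1,2), (0,7), (2,6)),
    ((5,5), (1,2), (3,7), (0,6)), ((7,7), (1,2), (3,7), (0,6)), ((0,2), (0,2), (2,4), (0,5)),
    ((0,2), (0,2), (2,6), (0,7)), ((2,5), (2,5), (0,5), (2,4)), ((0,3), (0,3), (3,5), (0,4)),
    ((0,3), (0,3), (3,7), (0,6)), ((3,4), (3,4), (0,4), (3,5)), ((4,6), (4,6), (1,2), (5,5))]"

lemma propagate8: "propagate 8 (link_of links8)
    [[0,1,2,3], [0,1,4,5], [0,2,4,5], [0,3,4,5], [1,2,3,4], [1,2,3,5], [1,2,3,6], [1,2,3,7]] steps8"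
  by (simp only: propagate_simps arg_cong[OF links8_def, of link_of, THEN fun_cong]
      steps8_def cong: if_weak_cong)

definition links9 :: "vpair list list" where
  "links9 = [
    [(0,1), (2,2)], [(0,0), (5,6), (7,8)], [(0,2), (3,4)], [(2,4), (5,5), (7,7)],
    [(2,3), (6,6), (8,8)], [(1,6), (3,5)], [(1,5), (4,6)], [(1,8), (3,7)], [(1,7), (4,8)]]"

definition steps9 :: "(vpair \<times> vpair \<times> vpair \<times> vpair) list" where
  "steps9 = [
    ((3,4), (0,2), (2,4), (5,5)), ((3,4), (0,2), (2,3), (6,6)), ((1,6), (3,5), (1,5), (4,6)),
    ((2,2), (0,1), (2,2), (0,1)), ((2,2), (0,1), (2,4), (5,5)), ((2,2), (0,1), (2,3), (6,6)),
    ((0,0), (5,6), (0,0), (7,8)), ((5,6), (0,0), (5,6), (0,0)), ((7,8), (0,0), (7,8), (0,0)),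
    ((0,0), (5,6), (0,2), (3,4)), ((5,6), (0,0), (5,5), (2,4)), ((7,8), (0,0), (7,7), (2,4)),
    ((5,6), (0,0), (6,6), (2,3)), ((7,8), (0,0), (8,8), (2,3)), ((5,6), (0,0), (1,6), (3,5)),
    ((5,6), (0,0), (1,5), (4,6)), ((7,8), (0,0), (1,8), (3,7)), ((7,8), (0,0), (1,7), (4,8)),
    ((0,2), (3,4), (0,2), (3,4)), ((0,1), (2,2), (0,0), (5,6)), ((5,5), (2,4), (5,5), (2,4)),
    ((7,7), (2,4), (7,7), (2,4)), ((2,4), (5,5), (2,3), (6,6)), ((2,2), (0,1), (0,2), (3,4)),
    ((5,5), (2,4), (3,5), (1,6)), ((7,7), (2,4), (3,5), (1,6)), ((5,5), (2,4), (1,5), (4,6)),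
    ((5,5), (2,4), (3,7), (1,8)), ((7,7), (2,4), (3,7), (1,8)), ((7,7), (2,4), (1,7), (4,8)),
    ((6,6), (2,3), (6,6), (2,3)), ((8,8), (2,3), (8,8), (2,3)), ((6,6), (2,3), (1,6), (3,5)),
    ((6,6), (2,3), (4,6), (1,5)), ((8,8), (2,3), (4,6), (1,5)), ((8,8), (2,3), (1,8), (3,7)),
    ((6,6), (2,3), (4,8), (1,7)), ((8,8), (2,3), (4,8), (1,7)), ((1,1), (1,1), (1,5), (4,6)),
    ((1,1), (1,1), (1,6), (3,5)), ((1,1), (1,1), (1,7), (4,8)), ((1,1), (1,1), (1,8), (3,7)),
    ((1,2), (1,2), (2,2), (0,1)), ((3,3), (3,3), (3,4), (0,2)), ((4,4), (4,4), (3,4), (0,2))]"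

lemma propagate9: "propagate 9 (link_of links9)
    [[0,2,3,4], [1,2,3,4], [1,2,5,6], [0,0,1,3], [0,0,1,4], [2,3,4,5], [2,3,4,6], [2,3,4,7], [2,3,4,8]] steps9"
  by (simp only: propagate_simps arg_cong[OF links9_def, of link_of, THEN fun_cong]
      steps9_def cong: if_weak_cong)

section \<open>The two families of cubics\<close>

lemma mset_triple_eq:
  "{#a, b, c#} = {#x, y, z#} \<longleftrightarrow>
    a = x \<and> {#b, c#} = {#y, z#} \<or> a = y \<and> {#b, c#} = {#x, z#} \<or> a = z \<and> {#b, c#} = {#x, y#}"
  by (auto dest!: mset_two_of_three simp: add_mset_commute)

text \<open>A chain that starts with a loop at q = 0: vertex 0 completes 00 and 11, vertex 1
  completes 23, and p = 2 and r = 3 complete yy and zz in each block, whose pair yz is completed by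
  0 again. Every core vertex lies in a core triple, which supplies its representative pair.\<close>

definition core_even :: "nat multiset set" where
  "core_even = {{#0, 0, 0#}, {#0, 1, 1#}, {#1, 2, 3#}}"

text \<open>A chain with one more vertex: q = 1 completes 00, vertex 0 completes 22, vertex 2
  completes 34, with p = 3 and r = 4.\<close>

definition core_odd :: "nat multiset set" where
  "core_odd = {{#0, 0, 1#}, {#0, 2, 2#}, {#2, 3, 4#}}"

interpretation even: block_design 4 core_even 2 0 3
proof
  show "v = w" if "add_mset v P \<in> core_even" "add_mset w P \<in> core_even" for v w P
    using that unfolding core_even_def by (auto dest!: mset_two_of_three simp: mset_pair_eq)
qed (auto simp: core_even_def msets_def)

interpretation odd: block_design 5 core_odd 3 1 4
proof
  show "v = w" if "add_mset v P \<in> core_odd" "add_mset w P \<in> core_odd" for v w P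
    using that unfolding core_odd_def by (auto dest!: mset_two_of_three simp: mset_pair_eq)
qed (auto simp: core_odd_def msets_def)

text \<open>For v = 1, 2, 3 no core triple offers two different vertices uncovered with v: 000 has
  only one vertex, 123 contains v, and in 011 the vertex 1 is v itself or is covered together with
  v. So the triple 045 of block 0 is used.\<close>

definition split_even :: "nat \<Rightarrow> nat multiset" where
  "split_even v = (if v = 1 \<or> v = 2 \<or> v = 3 then {#0, 4, 5#} else {#1, 2, 3#})"

text \<open>For v = 2 the core triple 001 fails because 02 is covered, and the other core triples
  contain 2; hence the triple 156 of block 0.\<close>

definition split_odd :: "nat \<Rightarrow> nat multiset" where
  "split_odd v = (if v = 2 then {#1, 5, 6#} else if v = 3 \<or> v = 4 then {#0, 0, 1#} else {#2, 3, 4#})"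

lemma T_even1: "even.T 1 = {{#0, 0, 0#}, {#0, 1, 1#}, {#1, 2, 3#}, {#0, 4, 5#}, {#2, 4, 4#}, {#3, 5, 5#}}"
  unfolding even.T_def even.block_def even.y_def even.z_def unfolding core_even_def by auto

lemma T_even2: "even.T 2 = {{#0, 0, 0#}, {#0, 1, 1#}, {#1, 2, 3#}, {#0, 4, 5#}, {#2, 4, 4#}, {#3, 5, 5#},
    {#0, 6, 7#}, {#2, 6, 6#}, {#3, 7, 7#}}"
proof -
  have "{..<2} = {0, 1::nat}" by auto
  then show ?thesis
    unfolding even.T_def even.block_def even.y_def even.z_def unfolding core_even_def by auto
qed

lemma T_odd1: "odd.T 1 = {{#0, 0, 1#}, {#0, 2, 2#}, {#2, 3, 4#}, {#1, 5, 6#}, {#3, 5, 5#}, {#4, 6, 6#}}"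
  unfolding odd.T_def odd.block_def odd.y_def odd.z_def unfolding core_odd_def by auto

lemma T_odd2: "odd.T 2 = {{#0, 0, 1#}, {#0, 2, 2#}, {#2, 3, 4#}, {#1, 5, 6#}, {#3, 5, 5#}, {#4, 6, 6#},
    {#1, 7, 8#}, {#3, 7, 7#}, {#4, 8, 8#}}"
proof -
  have "{..<2} = {0, 1::nat}" by auto
  then show ?thesis
    unfolding odd.T_def odd.block_def odd.y_def odd.z_def unfolding core_odd_def by auto
qed

text \<open>The triples are listed in sorted form, so an ordered pair inside xyz is xy, xz or yz;
  this turns the quantifiers over multisets into checks on lists.\<close>

lemma links_validI:
  assumes "T \<subseteq> msets n 3"
    and "list_all2 (\<lambda>v. list_all (\<lambda>(a, b). a \<le> b \<and> {#v, a, b#} \<in> T)) [0..<n] Ls"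
    and T: "T = (\<lambda>(x, y, z). {#x, y, z#}) ` set L"
    and L: "list_all (\<lambda>(x, y, z). x \<le> y \<and> y \<le> z \<and> (\<exists>l\<in>set Ls. (x, y) \<in> set l) \<and>
      (\<exists>l\<in>set Ls. (x, z) \<in> set l) \<and> (\<exists>l\<in>set Ls. (y, z) \<in> set l)) L"
  shows "links_valid n T Ls"
  unfolding links_valid_def
proof (intro conjI ballI allI impI)
  fix l assume "l \<in> set Ls"
  then obtain i where "i < length Ls" "l = Ls ! i" by (metis in_set_conv_nth)
  then show "\<exists>v. \<forall>(a, b)\<in>set l. a \<le> b \<and> {#v, a, b#} \<in> T"
    using assms(2) by (intro exI[of _ "[0..<n] ! i"]) (auto simp: list_all2_conv_all_nth list_all_iff)
next
  fix v a b assume "a \<le> b" "{#v, a, b#} \<in> T"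
  then obtain x y z where xyz: "(x, y, z) \<in> set L" "{#v, a, b#} = {#x, y, z#}" using T by auto
  then have "x \<le> y" "y \<le> z" using L by (auto simp: list_all_iff)
  then have "(a, b) \<in> {(x, y), (x, z), (y, z)}"
    using mset_two_of_three[OF xyz(2)] \<open>a \<le> b\<close> by (auto simp: mset_pair_eq)
  then show "\<exists>l\<in>set Ls. (a, b) \<in> set l" using L xyz(1) by (auto simp: list_all_iff)
qed (rule assms(1))

section \<open>The link tables match the designs\<close>

lemma links6_valid: "links_valid 6 (even.T 1) links6"
proof (rule links_validI)
  show "even.T 1 \<subseteq> msets 6 3" using even.T_sub[of 1] by simp
  show "list_all2 (\<lambda>v. list_all (\<lambda>(a, b). a \<le> b \<and> {#v, a, b#} \<in> even.T 1)) [0..<6] links6"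
    unfolding links6_def T_even1 by (simp add: upt_rec add_mset_commute)
  let ?L = "[(0,0,0::nat), (0,1,1), (1,2,3), (0,4,5), (2,4,4), (3,5,5)]"
  show "even.T 1 = (\<lambda>(x, y, z). {#x, y, z#}) ` set ?L" unfolding T_even1 by simp
  show "list_all (\<lambda>(x, y, z). x \<le> y \<and> y \<le> z \<and> (\<exists>l\<in>set links6. (x, y) \<in> set l) \<and>
      (\<exists>l\<in>set links6. (x, z) \<in> set l) \<and> (\<exists>l\<in>set links6. (y, z) \<in> set l)) ?L"
    by (simp add: links6_def)
qed

lemma links8_valid: "links_valid 8 (even.T 2) links8"
proof (rule links_validI)
  show "even.T 2 \<subseteq> msets 8 3" using even.T_sub[of 2] by simp
  show "list_all2 (\<lambda>v. list_all (\<lambda>(a, b). a \<le> b \<and> {#v, a, b#} \<in> even.T 2)) [0..<8] links8"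
    unfolding links8_def T_even2 by (simp add: upt_rec add_mset_commute)
  let ?L = "[(0,0,0::nat), (0,1,1), (1,2,3), (0,4,5), (2,4,4), (3,5,5), (0,6,7), (2,6,6), (3,7,7)]"
  show "even.T 2 = (\<lambda>(x, y, z). {#x, y, z#}) ` set ?L" unfolding T_even2 by simp
  show "list_all (\<lambda>(x, y, z). x \<le> y \<and> y \<le> z \<and> (\<exists>l\<in>set links8. (x, y) \<in> set l) \<and>
      (\<exists>l\<in>set links8. (x, z) \<in> set l) \<and> (\<exists>l\<in>set links8. (y, z) \<in> set l)) ?L"
    by (simp add: links8_def)
qed

lemma links9_valid: "links_valid 9 (odd.T 2) links9"
proof (rule links_validI)
  show "odd.T 2 \<subseteq> msets 9 3" using odd.T_sub[of 2] by simp
  show "list_all2 (\<lambda>v. list_all (\<lambda>(a, b). a \<le> b \<and> {#v, a, b#} \<in> odd.T 2)) [0..<9] links9"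
    unfolding links9_def T_odd2 by (simp add: upt_rec add_mset_commute)
  let ?L = "[(0,0,1::nat), (0,2,2), (2,3,4), (1,5,6), (3,5,5), (4,6,6), (1,7,8), (3,7,7), (4,8,8)]"
  show "odd.T 2 = (\<lambda>(x, y, z). {#x, y, z#}) ` set ?L" unfolding T_odd2 by simp
  show "list_all (\<lambda>(x, y, z). x \<le> y \<and> y \<le> z \<and> (\<exists>l\<in>set links9. (x, y) \<in> set l) \<and>
      (\<exists>l\<in>set links9. (x, z) \<in> set l) \<and> (\<exists>l\<in>set links9. (y, z) \<in> set l)) ?L"
    by (simp add: links9_def)
qed

lemma quartics_even:
  fixes \<psi> :: "nat multiset \<Rightarrow> 'k::field_char_0"
  assumes k: "k = 1 \<or> k = 2" and \<psi>: "kills_square (4 + 2 * k) (even.T k) \<psi>"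
    and s: "\<forall>v<4 + 2 * k. \<psi> (add_mset v (split_even v)) = 0"
  shows "\<forall>M\<in>msets (4 + 2 * k) 4. \<psi> M = 0"
  using k
proof
  assume k: "k = 1"
  have "\<psi> (add_mset v (split_even v)) = 0" if "v < 6" for v using s that by (simp add: k)
  from this[of 0] this[of 1] this[of 2] this[of 3] this[of 4] this[of 5]
  have "\<forall>m\<in>set [[0,1,2,3], [0,1,4,5], [0,2,4,5], [0,3,4,5], [1,2,3,4], [1,2,3,5]]. \<psi> (mset m) = 0"
    by (simp add: split_even_def add_mset_commute)
  then show ?thesis
    using propagate_sound[OF _ links6_valid propagate6, of \<psi>] \<psi> by (simp add: k)
next
  assume k: "k = 2"
  have "\<psi> (add_mset v (split_even v)) = 0" if "v < 8" for v using s that by (simp add: k)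
  from this[of 0] this[of 1] this[of 2] this[of 3] this[of 4] this[of 5] this[of 6] this[of 7]
  have "\<forall>m\<in>set [[0,1,2,3], [0,1,4,5], [0,2,4,5], [0,3,4,5], [1,2,3,4], [1,2,3,5], [1,2,3,6], [1,2,3,7]].
      \<psi> (mset m) = 0"
    by (simp add: split_even_def add_mset_commute)
  then show ?thesis
    using propagate_sound[OF _ links8_valid propagate8, of \<psi>] \<psi> by (simp add: k)
qed

lemma quartics_odd:
  fixes \<psi> :: "nat multiset \<Rightarrow> 'k::field_char_0"
  assumes \<psi>: "kills_square 9 (odd.T 2) \<psi>" and s: "\<forall>v<9. \<psi> (add_mset v (split_odd v)) = 0"
  shows "\<forall>M\<in>msets 9 4. \<psi> M = 0"
proof -
  have "\<psi> (add_mset v (split_odd v)) = 0" if "v < 9" for v using s that by simp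
  from this[of 0] this[of 1] this[of 2] this[of 3] this[of 4] this[of 5] this[of 6] this[of 7] this[of 8]
  have "\<forall>m\<in>set [[0,2,3,4], [1,2,3,4], [1,2,5,6], [0,0,1,3], [0,0,1,4], [2,3,4,5], [2,3,4,6], [2,3,4,7], [2,3,4,8]]. \<psi> (mset m) = 0"
    by (simp add: split_odd_def add_mset_commute)
  then show ?thesis
    using propagate_sound[OF _ links9_valid propagate9, of \<psi>] \<psi> by simp
qed

definition cubic_of :: "nat multiset set \<Rightarrow> nat monomial \<Rightarrow> 'k::zero_neq_one" where
  "cubic_of T m = (if m \<in> monom_of ` T then 1 else 0)"

lemma cubic_of_monom_of: "cubic_of T (monom_of M) = (if M \<in> T then 1 else 0)"
  by (auto simp: cubic_of_def)

lemma general_even: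
  assumes "1 \<le> m"
  shows "for_general_cubic (4 + 2 * m) (small_tangent_space (4 + 2 * m) :: (nat, 'k::field_char_0) mpoly \<Rightarrow> bool)"
proof -
  interpret triple_design "4 + 2 * m" "even.T m"
    "\<lambda>v. if v < 4 then [{#0, 0#}, {#0, 1#}, {#1, 3#}, {#1, 2#}] ! v
      else if even (v - 4) then {#0, v + 1#} else {#0, v - 1#}"
    "\<lambda>v. add_mset v (split_even v)" "cubic_of (even.T m) :: nat monomial \<Rightarrow> 'k"
  proof (rule even.triple_design_blocks[OF assms])
    show "split_even v \<in> even.T 1" if "v < 4" for v
      unfolding T_even1 by (simp add: split_even_def)
    show "{#1, 2, 3#} \<in> core_even" by (simp add: core_even_def)
    show "split_even v = {#1, 2, 3#}" if "4 \<le> v" for v using that by (simp add: split_even_def)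
    show "add_mset v ([{#0, 0#}, {#0, 1#}, {#1, 3#}, {#1, 2#}] ! v) \<in> core_even" if "v < 4" for v
      using that by (auto simp: less_Suc_eq numeral_eq_Suc core_even_def add_mset_commute)
    show "cubic_of (even.T m) (monom_of M) = (if M \<in> even.T m then 1 else 0)" for M
      by (rule cubic_of_monom_of)
    show "\<forall>M\<in>msets (4 + 2 * min m 2) 4. \<psi> M = 0"
      if "kills_square (4 + 2 * min m 2) (even.T (min m 2)) \<psi>"
        "\<forall>v<4 + 2 * min m 2. \<psi> (add_mset v (split_even v)) = 0" for \<psi> :: "nat multiset \<Rightarrow> 'k"
      using quartics_even[OF _ that] assms by linarith
    show "\<exists>a a'. a \<noteq> a' \<and> a \<in># {#1, 2, 3#} \<and> a' \<in># {#1, 2, 3#} \<and> a \<notin> {2, 0} \<and> a' \<notin> {2, 0::nat}"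
      by (intro exI[of _ 1] exI[of _ 3]) simp
    show "\<exists>a a'. a \<noteq> a' \<and> a \<in># {#1, 2, 3#} \<and> a' \<in># {#1, 2, 3#} \<and> a \<notin> {0, 3} \<and> a' \<notin> {0, 3::nat}"
      by (intro exI[of _ 1] exI[of _ 2]) simp
    have unc: "uncovered (4 + 2) (even.T 1) {#a, b#}"
      if "(a, b) \<in> {(0,2), (0,3), (1,4), (1,5), (2,0), (2,5), (3,0), (3,4)}" for a b
      using that unfolding uncovered_def T_even1 by (auto simp: msets_def mset_triple_eq mset_pair_eq)
    show "\<exists>a a'. a \<noteq> a' \<and> a \<in># split_even v \<and> a' \<in># split_even v \<and>
        uncovered (4 + 2) (even.T 1) {#v, a#} \<and> uncovered (4 + 2) (even.T 1) {#v, a'#}" if v: "v < 4" for v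
    proof -
      consider "v = 0" | "v = 1" | "v = 2" | "v = 3" using v by linarith
      then show ?thesis
      proof cases
        case 1
        then show ?thesis using unc[of 0 2] unc[of 0 3]
          by (intro exI[of _ 2] exI[of _ 3]) (simp add: split_even_def)
      next
        case 2
        then show ?thesis using unc[of 1 4] unc[of 1 5]
          by (intro exI[of _ 4] exI[of _ 5]) (simp add: split_even_def)
      next
        case 3
        then show ?thesis using unc[of 2 0] unc[of 2 5]
          by (intro exI[of _ 0] exI[of _ 5]) (simp add: split_even_def)
      next
        case 4
        then show ?thesis using unc[of 3 0] unc[of 3 4]
          by (intro exI[of _ 0] exI[of _ 4]) (simp add: split_even_def)
      qed
    qed
  qed
  show ?thesis by (rule for_general_cubic_small_tangent_space)
qed

lemma general_odd:
  assumes "2 \<le> m"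
  shows "for_general_cubic (5 + 2 * m) (small_tangent_space (5 + 2 * m) :: (nat, 'k::field_char_0) mpoly \<Rightarrow> bool)"
proof -
  have m1: "1 \<le> m" and m2: "min m 2 = 2" using assms by auto
  interpret triple_design "5 + 2 * m" "odd.T m"
    "\<lambda>v. if v < 5 then [{#0, 1#}, {#0, 0#}, {#0, 2#}, {#2, 4#}, {#2, 3#}] ! v
      else if even (v - 5) then {#1, v + 1#} else {#1, v - 1#}"
    "\<lambda>v. add_mset v (split_odd v)" "cubic_of (odd.T m) :: nat monomial \<Rightarrow> 'k"
  proof (rule odd.triple_design_blocks[OF m1])
    show "split_odd v \<in> odd.T 1" if "v < 5" for v
      unfolding T_odd1 by (simp add: split_odd_def)
    show "{#2, 3, 4#} \<in> core_odd" by (simp add: core_odd_def)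
    show "split_odd v = {#2, 3, 4#}" if "5 \<le> v" for v using that by (simp add: split_odd_def)
    show "add_mset v ([{#0, 1#}, {#0, 0#}, {#0, 2#}, {#2, 4#}, {#2, 3#}] ! v) \<in> core_odd" if "v < 5" for v
      using that by (auto simp: less_Suc_eq numeral_eq_Suc core_odd_def add_mset_commute)
    show "cubic_of (odd.T m) (monom_of M) = (if M \<in> odd.T m then 1 else 0)" for M
      by (rule cubic_of_monom_of)
    show "\<forall>M\<in>msets (5 + 2 * min m 2) 4. \<psi> M = 0"
      if "kills_square (5 + 2 * min m 2) (odd.T (min m 2)) \<psi>"
        "\<forall>v<5 + 2 * min m 2. \<psi> (add_mset v (split_odd v)) = 0" for \<psi> :: "nat multiset \<Rightarrow> 'k"
      using quartics_odd that unfolding m2 by simp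
    show "\<exists>a a'. a \<noteq> a' \<and> a \<in># {#2, 3, 4#} \<and> a' \<in># {#2, 3, 4#} \<and> a \<notin> {3, 1} \<and> a' \<notin> {3, 1::nat}"
      by (intro exI[of _ 2] exI[of _ 4]) simp
    show "\<exists>a a'. a \<noteq> a' \<and> a \<in># {#2, 3, 4#} \<and> a' \<in># {#2, 3, 4#} \<and> a \<notin> {1, 4} \<and> a' \<notin> {1, 4::nat}"
      by (intro exI[of _ 2] exI[of _ 3]) simp
    have unc: "uncovered (5 + 2) (odd.T 1) {#a, b#}"
      if "(a, b) \<in> {(0,3), (0,4), (1,2), (1,3), (2,1), (2,5), (3,0), (3,1), (4,0), (4,1)}" for a b
      using that unfolding uncovered_def T_odd1 by (auto simp: msets_def mset_triple_eq mset_pair_eq)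
    show "\<exists>a a'. a \<noteq> a' \<and> a \<in># split_odd v \<and> a' \<in># split_odd v \<and>
        uncovered (5 + 2) (odd.T 1) {#v, a#} \<and> uncovered (5 + 2) (odd.T 1) {#v, a'#}" if v: "v < 5" for v
    proof -
      consider "v = 0" | "v = 1" | "v = 2" | "v = 3" | "v = 4" using v by linarith
      then show ?thesis
      proof cases
        case 1
        then show ?thesis using unc[of 0 3] unc[of 0 4]
          by (intro exI[of _ 3] exI[of _ 4]) (simp add: split_odd_def)
      next
        case 2
        then show ?thesis using unc[of 1 2] unc[of 1 3]
          by (intro exI[of _ 2] exI[of _ 3]) (simp add: split_odd_def)
      next
        case 3
        then show ?thesis using unc[of 2 1] unc[of 2 5]
          by (intro exI[of _ 1] exI[of _ 5]) (simp add: split_odd_def)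
      next
        case 4
        then show ?thesis using unc[of 3 0] unc[of 3 1]
          by (intro exI[of _ 0] exI[of _ 1]) (simp add: split_odd_def)
      next
        case 5
        then show ?thesis using unc[of 4 0] unc[of 4 1]
          by (intro exI[of _ 0] exI[of _ 1]) (simp add: split_odd_def)
      qed
    qed
  qed
  show ?thesis by (rule for_general_cubic_small_tangent_space)
qed

theorem theorem2:
  fixes n :: nat
  assumes "n \<ge> 6" and "n \<noteq> 7"
  shows "for_general_cubic n (small_tangent_space n :: (nat, 'k::field_char_0) mpoly \<Rightarrow> bool)"
proof (cases "even n")
  case True
  then have "n = 4 + 2 * ((n - 4) div 2)" "1 \<le> (n - 4) div 2" using assms by presburger+
  then show ?thesis using general_even[of "(n - 4) div 2"] by simp
next
  case False
  \<comment> \<open>An odd n that is at least 6 and not 7 is at least 9, which leaves at least two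
    blocks besides the core of 5 vertices, as the certificate in 9 variables requires.\<close>
  then have "n = 5 + 2 * ((n - 5) div 2)" "2 \<le> (n - 5) div 2" using assms by presburger+
  then show ?thesis using general_odd[of "(n - 5) div 2"] by simp
qed

end
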